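(* Let $l\ge 2$ and $d_1,\ldots,d_l\ge 2$ be integers. $GL_\otimes(\otimes_{i=1}^l\mathbb{R}^{d_i})$ and $O_{\otimes}(\otimes_{i=1}^l\mathbb{R}^{d_i})$ are isomorphic (as Lie groups) to the semidirect products $\otimes(GL(d_1),\ldots,GL(d_l))\rtimes \mathcal{P}$ and $\otimes(O(d_1),\ldots,O(d_l))\rtimes \mathcal{P}$, respectively.
   Context: $\otimes_{i=1}^l\mathbb{R}^{d_i}$ is a Euclidean space with the scalar product $\langle\cdot,\cdot\rangle_H$ determined by $\langle x^1\otimes\cdots\otimes x^l,y^1\otimes\cdots\otimes y^l\rangle_H=\prod_{i=1}^l\langle x^i,y^i\rangle$. A decomposable vector is one of the form $x^1\otimes\cdots\otimes x^l$, $x^i\in\mathbb{R}^{d_i}$. $GL_\otimes(\otimes_{i=1}^l\mathbb{R}^{d_i})$ is the group of linear isomorphisms of $\otimes_{i=1}^l\mathbb{R}^{d_i}$ mapping decomposable vectors to decomposable vectors; it is a closed subgroup of $GL(\otimes_{i=1}^l\mathbb{R}^{d_i})$, hence a Lie group. $O_\otimes(\otimes_{i=1}^l\mathbb{R}^{d_i})$ is the subgroup of its elements that are orthogonal for $\langle\cdot,\cdot\rangle_H$. $\otimes(GL(d_1),\ldots,GL(d_l))$ is the group of tensor products $T_1\otimes\cdots\otimes T_l$ with $T_i\in GL(d_i)$, and $\otimes(O(d_1),\ldots,O(d_l))$ is the group of tensor products $U_1\otimes\cdots\otimes U_l$ with $U_i\in O(d_i)$; both are closed subgroups of $GL_\otimes(\otimes_{i=1}^l\mathbb{R}^{d_i})$.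 For a permutation $\sigma$ of $\{1,\ldots,l\}$ such that $x^{\sigma(1)}\otimes\cdots\otimes x^{\sigma(l)}\in\otimes_{i=1}^l\mathbb{R}^{d_i}$ whenever $x^i\in\mathbb{R}^{d_i}$ for all $i$ (i.e. $d_{\sigma(i)}=d_i$ for all $i$), $U_\sigma$ is the linear map of $\otimes_{i=1}^l\mathbb{R}^{d_i}$ determined by $U_\sigma(x^1\otimes\cdots\otimes x^l)=x^{\sigma(1)}\otimes\cdots\otimes x^{\sigma(l)}$. $\mathcal{P}$ is the finite subgroup of $O_\otimes(\otimes_{i=1}^l\mathbb{R}^{d_i})$ consisting of all such $U_\sigma$. The semidirect products are with respect to the action of $\mathcal{P}$ by conjugation inside $GL_\otimes(\otimes_{i=1}^l\mathbb{R}^{d_i})$. *)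

theory Defs
  imports "HOL-Analysis.Analysis" "HOL-Combinatorics.Permutations" "HOL-Algebra.Group"
    "Jordan_Normal_Form.Matrix"
begin

text \<open>
  \<open>\<real>\<^sup>n\<close> is \<^term>\<open>carrier_vec n :: real Matrix.vec set\<close>.  A tuple \<open>(x\<^sup>1, \<dots>, x\<^sup>l)\<close> with
  \<open>x\<^sup>i \<in> \<real>\<^sup>d\<^sup>i\<close> is an extensional function on \<^term>\<open>{1..l}\<close>.
\<close>

definition tuples :: "nat \<Rightarrow> (nat \<Rightarrow> nat) \<Rightarrow> (nat \<Rightarrow> real Matrix.vec) set" where
  "tuples l d = (\<Pi>\<^sub>E i\<in>{1..l}. carrier_vec (d i))"

definition multilinear_on_tuples ::
  "nat \<Rightarrow> (nat \<Rightarrow> nat) \<Rightarrow> ((nat \<Rightarrow> real Matrix.vec) \<Rightarrow> 'b::real_vector) \<Rightarrow> bool" where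
  "multilinear_on_tuples l d f \<longleftrightarrow>
     (\<forall>x\<in>tuples l d. \<forall>i\<in>{1..l}. \<forall>u\<in>carrier_vec (d i). \<forall>v\<in>carrier_vec (d i). \<forall>c.
        f (x(i := u + v)) = f (x(i := u)) + f (x(i := v)) \<and>
        f (x(i := c \<cdot>\<^sub>v u)) = c *\<^sub>R f (x(i := u)))"

text \<open>
  The Euclidean space \<open>'v\<close> together with \<open>\<tau> (x\<^sup>1, \<dots>, x\<^sup>l) = x\<^sup>1 \<otimes> \<dots> \<otimes> x\<^sup>l\<close> is the tensor product
  of \<open>\<real>\<^sup>d\<^sup>1, \<dots>, \<real>\<^sup>d\<^sup>l\<close> (universal property), and its inner product is \<open>\<langle>\<cdot>,\<cdot>\<rangle>\<^sub>H\<close>.  Scalar-valued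
  multilinear maps suffice in the universal property, by passing to coordinates in the target.
  The dot on the left is the inner product of \<open>'v\<close>, the one on the right that of \<open>\<real>\<^sup>d\<^sup>i\<close>.
\<close>

definition is_tensor_product ::
  "nat \<Rightarrow> (nat \<Rightarrow> nat) \<Rightarrow> ((nat \<Rightarrow> real Matrix.vec) \<Rightarrow> 'v::euclidean_space) \<Rightarrow> bool" where
  "is_tensor_product l d \<tau> \<longleftrightarrow>
     multilinear_on_tuples l d \<tau> \<and>
     (\<forall>\<phi> :: (nat \<Rightarrow> real Matrix.vec) \<Rightarrow> real. multilinear_on_tuples l d \<phi> \<longrightarrow>
        (\<exists>!g. linear g \<and> (\<forall>x\<in>tuples l d. g (\<tau> x) = \<phi> x))) \<and>
     (\<forall>x\<in>tuples l d. \<forall>y\<in>tuples l d.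
        inner (\<tau> x) (\<tau> y) = (\<Prod>i\<in>{1..l}. scalar_prod (x i) (y i)))"

definition decomposable ::
  "nat \<Rightarrow> (nat \<Rightarrow> nat) \<Rightarrow> ((nat \<Rightarrow> real Matrix.vec) \<Rightarrow> 'v::euclidean_space) \<Rightarrow> 'v set" where
  "decomposable l d \<tau> = \<tau> ` tuples l d"

definition GL_mat :: "nat \<Rightarrow> real mat set" where
  "GL_mat n = {A \<in> carrier_mat n n. invertible_mat A}"

definition O_mat :: "nat \<Rightarrow> real mat set" where
  "O_mat n = {A \<in> carrier_mat n n. transpose_mat A * A = 1\<^sub>m n}"

definition GL_space :: "('v::euclidean_space \<Rightarrow>\<^sub>L 'v) monoid" where
  "GL_space = \<lparr>carrier = {T. bij (blinfun_apply T)}, monoid.mult = (o\<^sub>L), one = id_blinfun\<rparr>"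

definition GL_tensor ::
  "nat \<Rightarrow> (nat \<Rightarrow> nat) \<Rightarrow> ((nat \<Rightarrow> real Matrix.vec) \<Rightarrow> 'v::euclidean_space)
    \<Rightarrow> ('v \<Rightarrow>\<^sub>L 'v) monoid" where
  "GL_tensor l d \<tau> = GL_space\<lparr>carrier :=
     {T \<in> carrier GL_space. blinfun_apply T ` decomposable l d \<tau> \<subseteq> decomposable l d \<tau>}\<rparr>"

definition O_tensor ::
  "nat \<Rightarrow> (nat \<Rightarrow> nat) \<Rightarrow> ((nat \<Rightarrow> real Matrix.vec) \<Rightarrow> 'v::euclidean_space)
    \<Rightarrow> ('v \<Rightarrow>\<^sub>L 'v) monoid" where
  "O_tensor l d \<tau> = (GL_tensor l d \<tau>)\<lparr>carrier :=
     {T \<in> carrier (GL_tensor l d \<tau>). orthogonal_transformation (blinfun_apply T)}\<rparr>"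

text \<open>
  \<open>T = A\<^sub>1 \<otimes> \<dots> \<otimes> A\<^sub>l\<close>; there is exactly one such \<open>T\<close> if the square matrices \<open>A\<^sub>i\<close> have size \<open>d\<^sub>i\<close>.
\<close>

definition is_tensor_of_maps ::
  "nat \<Rightarrow> (nat \<Rightarrow> nat) \<Rightarrow> ((nat \<Rightarrow> real Matrix.vec) \<Rightarrow> 'v::euclidean_space)
    \<Rightarrow> (nat \<Rightarrow> real mat) \<Rightarrow> ('v \<Rightarrow>\<^sub>L 'v) \<Rightarrow> bool" where
  "is_tensor_of_maps l d \<tau> A T \<longleftrightarrow>
     (\<forall>x\<in>tuples l d. blinfun_apply T (\<tau> x) = \<tau> (\<lambda>i\<in>{1..l}. A i *\<^sub>v x i))"

definition tensor_GL ::
  "nat \<Rightarrow> (nat \<Rightarrow> nat) \<Rightarrow> ((nat \<Rightarrow> real Matrix.vec) \<Rightarrow> 'v::euclidean_space)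
    \<Rightarrow> ('v \<Rightarrow>\<^sub>L 'v) monoid" where
  "tensor_GL l d \<tau> = GL_space\<lparr>carrier :=
     {T. \<exists>A. (\<forall>i\<in>{1..l}. A i \<in> GL_mat (d i)) \<and> is_tensor_of_maps l d \<tau> A T}\<rparr>"

definition tensor_O ::
  "nat \<Rightarrow> (nat \<Rightarrow> nat) \<Rightarrow> ((nat \<Rightarrow> real Matrix.vec) \<Rightarrow> 'v::euclidean_space)
    \<Rightarrow> ('v \<Rightarrow>\<^sub>L 'v) monoid" where
  "tensor_O l d \<tau> = GL_space\<lparr>carrier :=
     {T. \<exists>A. (\<forall>i\<in>{1..l}. A i \<in> O_mat (d i)) \<and> is_tensor_of_maps l d \<tau> A T}\<rparr>"

definition perm_group ::
  "nat \<Rightarrow> (nat \<Rightarrow> nat) \<Rightarrow> ((nat \<Rightarrow> real Matrix.vec) \<Rightarrow> 'v::euclidean_space)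
    \<Rightarrow> ('v \<Rightarrow>\<^sub>L 'v) monoid" where
  "perm_group l d \<tau> = GL_space\<lparr>carrier :=
     {T. \<exists>\<sigma>. \<sigma> permutes {1..l} \<and> (\<forall>i\<in>{1..l}. d (\<sigma> i) = d i) \<and>
        (\<forall>x\<in>tuples l d. blinfun_apply T (\<tau> x) = \<tau> (\<lambda>i\<in>{1..l}. x (\<sigma> i)))}\<rparr>"

text \<open>\<open>N \<rtimes>\<^sub>\<phi> P\<close>, where \<open>\<phi> p\<close> is the action of \<open>p\<close> on \<open>N\<close>.\<close>

definition semidirect_product ::
  "'a monoid \<Rightarrow> 'b monoid \<Rightarrow> ('b \<Rightarrow> 'a \<Rightarrow> 'a) \<Rightarrow> ('a \<times> 'b) monoid" where
  "semidirect_product N P \<phi> =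
     \<lparr>carrier = carrier N \<times> carrier P,
      monoid.mult = (\<lambda>(n, p) (m, q). (n \<otimes>\<^bsub>N\<^esub> \<phi> p m, p \<otimes>\<^bsub>P\<^esub> q)),
      one = (\<one>\<^bsub>N\<^esub>, \<one>\<^bsub>P\<^esub>)\<rparr>"

definition conjugation :: "'a monoid \<Rightarrow> 'a \<Rightarrow> 'a \<Rightarrow> 'a" where
  "conjugation G p n = p \<otimes>\<^bsub>G\<^esub> n \<otimes>\<^bsub>G\<^esub> inv\<^bsub>G\<^esub> p"

text \<open>
  \<open>C\<^sup>k\<close> maps, via iterated directional derivatives; this is the usual notion for
  finite-dimensional domains.
\<close>

fun Ck_on :: "nat \<Rightarrow> ('a::real_normed_vector \<Rightarrow> 'b::real_normed_vector) \<Rightarrow> 'a set \<Rightarrow> bool" where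
  "Ck_on 0 F U \<longleftrightarrow> continuous_on U F"
| "Ck_on (Suc k) F U \<longleftrightarrow>
     (\<forall>x\<in>U. F differentiable (at x)) \<and> (\<forall>v. Ck_on k (\<lambda>x. frechet_derivative F (at x) v) U)"

text \<open>
  Smoothness on an arbitrary subset: local extendability to smooth maps on open sets of the
  ambient space.  On embedded submanifolds this is smoothness in the sense of manifolds.
\<close>

definition smooth_map_on ::
  "('a::real_normed_vector \<Rightarrow> 'b::real_normed_vector) \<Rightarrow> 'a set \<Rightarrow> bool" where
  "smooth_map_on f S \<longleftrightarrow>
     (\<forall>a\<in>S. \<exists>U F. open U \<and> a \<in> U \<and> (\<forall>k. Ck_on k F U) \<and> (\<forall>x\<in>S \<inter> U. F x = f x))"

text \<open>
  Lie group isomorphism for Lie groups whose underlying manifolds are embedded in normed spaces.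
  This applies to closed subgroups of \<open>GL('v)\<close>, which are embedded submanifolds of the space of
  endomorphisms, and to semidirect products of two of them, whose underlying manifold is the
  product.
\<close>

definition lie_isomorphic ::
  "'a::real_normed_vector monoid \<Rightarrow> 'b::real_normed_vector monoid \<Rightarrow> bool" where
  "lie_isomorphic G H \<longleftrightarrow> Group.group G \<and> Group.group H \<and>
     (\<exists>h\<in>iso G H. smooth_map_on h (carrier G) \<and>
        smooth_map_on (inv_into (carrier G) h) (carrier H))"

lemma multilinear_sum:
  assumes f: "multilinear_on_tuples l d f" and x: "x \<in> tuples l d" and i: "i \<in> {1..l}"
    and u: "u \<in> carrier_vec (d i)"
  shows "f (x(i := u)) = (\<Sum>j<d i. vec_index u j *\<^sub>R f (x(i := unit_vec (d i) j)))"
proof -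
  let ?w = "\<lambda>m. Matrix.vec (d i) (\<lambda>j. if j < m then vec_index u j else 0)"
  have add: "f (x(i := a + b)) = f (x(i := a)) + f (x(i := b))"
    if "a \<in> carrier_vec (d i)" "b \<in> carrier_vec (d i)" for a b
    using f x i that unfolding multilinear_on_tuples_def by blast
  have scale: "f (x(i := c \<cdot>\<^sub>v a)) = c *\<^sub>R f (x(i := a))" if "a \<in> carrier_vec (d i)" for a c
    using f x i that unfolding multilinear_on_tuples_def by blast
  have "f (x(i := ?w m)) = (\<Sum>j<m. vec_index u j *\<^sub>R f (x(i := unit_vec (d i) j)))"
    if "m \<le> d i" for m
    using that
  proof (induction m)
    case 0
    have w: "?w 0 = 0 \<cdot>\<^sub>v 0\<^sub>v (d i)" by (auto simp: vec_eq_iff)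
    have "f (x(i := ?w 0)) = 0" unfolding w by (subst scale) auto
    then show ?case by (simp add: fun_upd_def)
  next
    case (Suc m)
    have w: "?w (Suc m) = ?w m + vec_index u m \<cdot>\<^sub>v unit_vec (d i) m"
      using Suc.prems by (auto simp: vec_eq_iff less_Suc_eq)
    have "f (x(i := ?w (Suc m))) = f (x(i := ?w m)) + vec_index u m *\<^sub>R f (x(i := unit_vec (d i) m))"
      unfolding w by (subst add; (subst scale)?) auto
    then show ?case using Suc.IH Suc.prems by (simp only: sum.lessThan_Suc Suc_leD)
  qed
  from this[of "d i"] have "f (x(i := ?w (d i))) = (\<Sum>j<d i. vec_index u j *\<^sub>R f (x(i := unit_vec (d i) j)))"
    by simp
  moreover have "?w (d i) = u" using u by (auto simp: vec_eq_iff)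
  ultimately show ?thesis by simp
qed

lemma multilinear_expansion:
  assumes f: "multilinear_on_tuples l d f" and x: "x \<in> tuples l d"
  shows "f x = (\<Sum>k\<in>(\<Pi>\<^sub>E i\<in>{1..l}. {..<d i}).
    (\<Prod>i\<in>{1..l}. vec_index (x i) (k i)) *\<^sub>R f (\<lambda>i\<in>{1..l}. unit_vec (d i) (k i)))"
proof -
  have *: "f x = (\<Sum>k\<in>(\<Pi>\<^sub>E i\<in>I. {..<d i}).
    (\<Prod>i\<in>I. vec_index (x i) (k i)) *\<^sub>R f (\<lambda>i. if i \<in> I then unit_vec (d i) (k i) else x i))"
    if "finite I" "I \<subseteq> {1..l}" for I
    using that
  proof (induction I)
    case empty
    then show ?case by simp
  next
    case (insert a I)
    let ?y = "\<lambda>I k i. if i \<in> I then unit_vec (d i) (k i) else x i"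
    have step: "f (?y I k) = (\<Sum>j<d a. vec_index (x a) j *\<^sub>R f (?y (insert a I) (k(a := j))))" for k
    proof -
      have y: "?y I k \<in> tuples l d" using x insert.prems unfolding tuples_def
        by (auto simp: PiE_iff extensional_def)
      have xa: "x a \<in> carrier_vec (d a)" using x insert.prems unfolding tuples_def by auto
      have e1: "(?y I k)(a := x a) = ?y I k" using insert.hyps by auto
      have e2: "(?y I k)(a := unit_vec (d a) j) = ?y (insert a I) (k(a := j))" for j
        using insert.hyps by auto
      show ?thesis
        using multilinear_sum[OF f y _ xa] insert.prems unfolding e1 e2 by simp
    qed
    have "f x = (\<Sum>k\<in>(\<Pi>\<^sub>E i\<in>I. {..<d i}). \<Sum>j<d a.
       ((\<Prod>i\<in>I. vec_index (x i) (k i)) * vec_index (x a) j) *\<^sub>R f (?y (insert a I) (k(a := j))))"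
      using insert by (simp add: step scaleR_sum_right)
    also have "\<dots> = (\<Sum>(j,k)\<in>{..<d a} \<times> (\<Pi>\<^sub>E i\<in>I. {..<d i}).
       ((\<Prod>i\<in>I. vec_index (x i) (k i)) * vec_index (x a) j) *\<^sub>R f (?y (insert a I) (k(a := j))))"
      by (subst sum.swap) (simp add: sum.cartesian_product)
    also have "\<dots> = (\<Sum>k\<in>(\<lambda>(j, k). k(a := j)) ` ({..<d a} \<times> (\<Pi>\<^sub>E i\<in>I. {..<d i})).
       (\<Prod>i\<in>insert a I. vec_index (x i) (k i)) *\<^sub>R f (?y (insert a I) k))"
    proof (subst sum.reindex)
      show "inj_on (\<lambda>(j, k). k(a := j)) ({..<d a} \<times> (\<Pi>\<^sub>E i\<in>I. {..<d i}))"
        by (rule inj_combinator) (use insert.hyps in auto)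
      have p: "(\<Prod>i\<in>I. vec_index (x i) ((k(a := j)) i)) = (\<Prod>i\<in>I. vec_index (x i) (k i))" for j k
        using insert.hyps by (intro prod.cong) auto
      show "(\<Sum>(j,k)\<in>{..<d a} \<times> (\<Pi>\<^sub>E i\<in>I. {..<d i}).
       ((\<Prod>i\<in>I. vec_index (x i) (k i)) * vec_index (x a) j) *\<^sub>R f (?y (insert a I) (k(a := j)))) =
       sum ((\<lambda>k. (\<Prod>i\<in>insert a I. vec_index (x i) (k i)) *\<^sub>R f (?y (insert a I) k)) \<circ> (\<lambda>(j, k). k(a := j)))
         ({..<d a} \<times> (\<Pi>\<^sub>E i\<in>I. {..<d i}))"
        using insert.hyps by (intro sum.cong) (auto simp: p mult.commute simp del: fun_upd_apply, simp)
    qed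
    finally show ?case by (simp only: PiE_insert_eq)
  qed
  have "(\<lambda>i. if i \<in> {1..l} then unit_vec (d i) (k i) else x i) = (\<lambda>i\<in>{1..l}. unit_vec (d i) (k i))" for k
    using x unfolding tuples_def by (auto simp: PiE_iff extensional_def)
  with *[of "{1..l}"] show ?thesis by simp
qed

text \<open>
  Coordinate arrays indexed by the multi-indices, with the standard inner product, form a tensor
  product, so \<^const>\<open>is_tensor_product\<close> is satisfiable for all \<open>l\<close> and all positive \<open>d\<close>, for
  instance with \<open>'v = real ^ 'k\<close> where \<open>CARD('k) = d\<^sub>1 \<cdot> \<dots> \<cdot> d\<^sub>l\<close>.
\<close>

lemma is_tensor_product_coordinates:
  fixes e :: "'k::finite \<Rightarrow> nat \<Rightarrow> nat"
  assumes e: "bij_betw e UNIV (\<Pi>\<^sub>E i\<in>{1..l}. {..<d i})"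
  shows "is_tensor_product l d (\<lambda>x. (\<chi> k. \<Prod>i\<in>{1..l}. vec_index (x i) (e k i)) :: real ^ 'k)"
proof -
  let ?\<tau> = "\<lambda>x. (\<chi> k. \<Prod>i\<in>{1..l}. vec_index (x i) (e k i)) :: real ^ 'k"
  have ek: "e k i < d i" if "i \<in> {1..l}" for k i
    using bij_betwE[OF e, rule_format, of k] that by (auto simp: PiE_iff)
  have ei: "e k = e k' \<longleftrightarrow> k = k'" for k k'
    using e by (auto simp: bij_betw_def inj_on_def)
  have ml: "multilinear_on_tuples l d ?\<tau>"
    unfolding multilinear_on_tuples_def
  proof (intro ballI allI)
    fix x :: "nat \<Rightarrow> real Matrix.vec" and i and u v :: "real Matrix.vec" and c :: real
    assume i: "i \<in> {1..l}" and u: "u \<in> carrier_vec (d i)" and v: "v \<in> carrier_vec (d i)"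
    have r: "(\<Prod>j\<in>{1..l}. vec_index ((x(i := w)) j) (e k j)) =
        vec_index w (e k i) * (\<Prod>j\<in>{1..l} - {i}. vec_index (x j) (e k j))" for w k
      using i by (subst prod.remove[of _ i]) auto
    show "?\<tau> (x(i := u + v)) = ?\<tau> (x(i := u)) + ?\<tau> (x(i := v)) \<and>
        ?\<tau> (x(i := c \<cdot>\<^sub>v u)) = c *\<^sub>R ?\<tau> (x(i := u))"
      unfolding r using u v ek[OF i] by (simp add: Finite_Cartesian_Product.vec_eq_iff algebra_simps)
  qed
  have inn: "inner (?\<tau> x) (?\<tau> y) = (\<Prod>i\<in>{1..l}. scalar_prod (x i) (y i))"
    if "x \<in> tuples l d" "y \<in> tuples l d" for x y
  proof -
    have "inner (?\<tau> x) (?\<tau> y) = (\<Sum>k\<in>UNIV. \<Prod>i\<in>{1..l}. vec_index (x i) (e k i) * vec_index (y i) (e k i))"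
      by (simp add: inner_vec_def prod.distrib)
    also have "\<dots> = (\<Sum>k\<in>(\<Pi>\<^sub>E i\<in>{1..l}. {..<d i}). \<Prod>i\<in>{1..l}. vec_index (x i) (k i) * vec_index (y i) (k i))"
      by (rule sum.reindex_bij_betw[OF e])
    also have "\<dots> = (\<Prod>i\<in>{1..l}. \<Sum>j<d i. vec_index (x i) j * vec_index (y i) j)"
      by (rule prod_sum_PiE[symmetric]) auto
    also have "\<dots> = (\<Prod>i\<in>{1..l}. scalar_prod (x i) (y i))"
    proof (rule prod.cong[OF refl])
      fix i assume "i \<in> {1..l}"
      then have "dim_vec (y i) = d i" using that unfolding tuples_def by (auto simp: PiE_iff)
      then show "(\<Sum>j<d i. vec_index (x i) j * vec_index (y i) j) = scalar_prod (x i) (y i)"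
        by (simp add: scalar_prod_def atLeast0LessThan)
    qed
    finally show ?thesis .
  qed
  let ?E = "\<lambda>k. \<lambda>i\<in>{1..l}. unit_vec (d i) (e k i) :: real Matrix.vec"
  have Et: "?E k \<in> tuples l d" for k unfolding tuples_def by auto
  have tE: "?\<tau> (?E k) = axis k 1" for k
  proof -
    have "(\<Prod>i\<in>{1..l}. vec_index (?E k i) (e k' i)) = (if k' = k then 1 else 0 :: real)" for k'
    proof (cases "k' = k")
      case True
      then show ?thesis using ek by (auto intro!: prod.neutral)
    next
      case False
      have "e k' \<noteq> e k" using False ei by blast
      moreover have "e k' \<in> extensional {1..l}" "e k \<in> extensional {1..l}"
        using bij_betwE[OF e] by (auto simp: PiE_iff)
      ultimately obtain i where i: "i \<in> {1..l}" "e k' i \<noteq> e k i"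
        by (meson extensionalityI)
      then have "vec_index (?E k i) (e k' i) = 0" using ek by auto
      then show ?thesis using i False by (intro trans[OF prod_zero]) auto
    qed
    then show ?thesis by (simp add: axis_def)
  qed
  have univ: "\<exists>!g. linear g \<and> (\<forall>x\<in>tuples l d. g (?\<tau> x) = \<phi> x)"
    if \<phi>: "multilinear_on_tuples l d \<phi>" for \<phi> :: "(nat \<Rightarrow> real Matrix.vec) \<Rightarrow> real"
  proof (rule ex1I)
    let ?g = "\<lambda>v :: real ^ 'k. \<Sum>k\<in>UNIV. v $ k * \<phi> (?E k)"
    have lin: "linear ?g"
      by (rule linearI) (auto simp: algebra_simps sum.distrib sum_distrib_left)
    have gE: "?g (?\<tau> x) = \<phi> x" if "x \<in> tuples l d" for x
      unfolding multilinear_expansion[OF \<phi> that]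
      by (subst sum.reindex_bij_betw[OF e, symmetric]) simp
    show "linear ?g \<and> (\<forall>x\<in>tuples l d. ?g (?\<tau> x) = \<phi> x)" by (intro conjI ballI lin gE)
    fix g assume g: "linear g \<and> (\<forall>x\<in>tuples l d. g (?\<tau> x) = \<phi> x)"
    show "g = ?g"
    proof (rule linear_eq_stdbasis)
      show "linear g" "linear ?g" by (rule conjunct1[OF g], rule lin)
      fix b :: "real ^ 'k" assume "b \<in> Basis"
      then obtain k where "b = axis k 1" by (auto simp: Basis_vec_def)
      then have b: "b = ?\<tau> (?E k)" by (simp only: tE)
      show "g b = ?g b"
        unfolding b by (rule trans[OF bspec[OF conjunct2[OF g] Et] gE[OF Et, symmetric]])
    qed
  qed
  show ?thesis unfolding is_tensor_product_def using ml inn univ by blast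
qed

end

theory Submission
  imports Defs "Jordan_Normal_Form.Determinant"
begin

text \<open>
  Call two nonzero decomposable vectors adjacent if all but one of their factors are proportional.
  If the sum of two decomposable vectors is decomposable, they are adjacent or proportional, so an
  isomorphism \<open>T\<close> preserving decomposable vectors maps adjacent vectors to adjacent vectors.  As \<open>T\<close> is
  injective, opposite edges of a 4-cycle in the image vary the same factor; hence varying the \<open>i\<close>-th
  factor of \<open>x\<close> only affects the factor \<open>\<pi> i\<close> of \<open>T x\<close>, with \<open>\<pi> i\<close> independent of \<open>x\<close>.  Since the decomposable
  vectors span and \<open>T\<close> is onto, \<open>\<pi>\<close> is a permutation, and comparing two multilinear maps that agree up to
  scalars gives \<open>T = (A\<^sub>1 \<otimes> \<dots> \<otimes> A\<^sub>l) U\<^sub>\<sigma>\<close> with \<open>\<sigma> = \<pi>\<^sup>-\<^sup>1\<close>.  The group of tensor products meets \<open>\<P>\<close>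
  trivially, is normalized by it and is open in the product, so the permutation part is locally
  constant and the bijection \<open>(n, p) \<mapsto> n p\<close> is smooth in both directions.
\<close>

section \<open>Proportional vectors\<close>

text \<open>A nonzero decomposable vector fixes its factors only up to scalars, so \<open>T\<close>
  induces no canonical map on tuples. \<open>rep\<close> chooses some factors of the image, and
  everything is expressed by \<open>differing\<close>, the set of slots whose lines differ. Inner
  products of decomposable vectors factor over the slots, so claims about lines are proved by
  pairing with test tensors built slot by slot. Nothing is assumed about the inverse of
  \<open>T\<close> on decomposable vectors. Slot dimensions are therefore first compared by an
  inequality, and that the inverse also preserves decomposable vectors is known only after the final
  form of \<open>T\<close> is. In a 4-cycle of adjacent tuples the danger is that consecutive edges
  use the same slot. Opposite edges could then use different slots, but only if a diagonal
  collapses, which injectivity forbids. The assumption \<open>2 \<le> d i\<close> provides two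
  different lines in every slot; a slot with a single line could not be observed.\<close>

text \<open>The condition \<open>c \<noteq> 0\<close> makes this an equivalence relation on all
  vectors, in which a zero vector is related only to itself; on nonzero vectors it is equality of
  lines.\<close>

definition proportional :: "real Matrix.vec \<Rightarrow> real Matrix.vec \<Rightarrow> bool" where
  "proportional u v \<longleftrightarrow> (\<exists>c. c \<noteq> 0 \<and> v = c \<cdot>\<^sub>v u)"

lemma proportional_refl [simp]: "proportional u u"
  unfolding proportional_def by (rule exI[of _ 1]) simp

lemma proportional_sym: "proportional u v \<Longrightarrow> proportional v u"
  unfolding proportional_def
proof (elim exE conjE)
  fix c :: real assume "c \<noteq> 0" "v = c \<cdot>\<^sub>v u"
  then show "\<exists>c. c \<noteq> 0 \<and> u = c \<cdot>\<^sub>v v"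
    by (intro exI[of _ "inverse c"]) (simp add: smult_smult_assoc)
qed

lemma proportional_trans: "proportional u v \<Longrightarrow> proportional v w \<Longrightarrow> proportional u w"
  unfolding proportional_def
proof (elim exE conjE)
  fix b c :: real assume "b \<noteq> 0" "v = b \<cdot>\<^sub>v u" "c \<noteq> 0" "w = c \<cdot>\<^sub>v v"
  then show "\<exists>c. c \<noteq> 0 \<and> w = c \<cdot>\<^sub>v u"
    by (intro exI[of _ "c * b"]) (simp add: smult_smult_assoc)
qed

lemma proportional_smult: "c \<noteq> 0 \<Longrightarrow> proportional u (c \<cdot>\<^sub>v u)"
  unfolding proportional_def by blast

lemma proportional_euclid:
  "proportional u v \<Longrightarrow> proportional u w \<Longrightarrow> proportional v w"
  by (meson proportional_sym proportional_trans)

lemma scalar_prod_self_pos: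
  fixes v :: "real Matrix.vec"
  assumes "v \<in> carrier_vec n" "v \<noteq> 0\<^sub>v n"
  shows "0 < scalar_prod v v"
proof -
  obtain j where "j < n" "vec_index v j \<noteq> 0" using assms by (auto simp: vec_eq_iff)
  moreover from this have "0 < vec_index v j * vec_index v j" using not_real_square_gt_zero by blast
  ultimately have "0 < (\<Sum>j\<in>{0..<n}. vec_index v j * vec_index v j)"
    by (intro sum_pos2[of _ j]) auto
  moreover have "dim_vec v = n" using assms(1) by simp
  ultimately show ?thesis unfolding scalar_prod_def by simp
qed

text \<open>The component of \<open>u\<close> orthogonal to \<open>v\<close> works: it is nonzero,
  since otherwise \<open>u\<close> would be a multiple of \<open>v\<close>, and its product with
  \<open>u\<close> is its own squared norm. Placed in one slot of a test tensor, it kills the factor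
  \<open>v\<close> but not \<open>u\<close>.\<close>

lemma separating_vector:
  fixes u v :: "real Matrix.vec"
  assumes u: "u \<in> carrier_vec n" "u \<noteq> 0\<^sub>v n" and v: "v \<in> carrier_vec n" "v \<noteq> 0\<^sub>v n"
    and np: "\<not> proportional u v"
  obtains w where "w \<in> carrier_vec n" "scalar_prod v w = 0" "scalar_prod u w \<noteq> 0"
proof -
  let ?a = "scalar_prod v v" and ?b = "scalar_prod v u"
  have a: "0 < ?a" by (rule scalar_prod_self_pos[OF v])
  define w where "w = u + (- ?b / ?a) \<cdot>\<^sub>v v"
  have w: "w \<in> carrier_vec n" unfolding w_def using u v by simp
  have vw: "scalar_prod v w = 0"
    unfolding w_def using u v a by (simp add: scalar_prod_add_distrib[of _ n])
  have ueq: "u = w + (?b / ?a) \<cdot>\<^sub>v v"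
    unfolding w_def using u v by (auto simp: vec_eq_iff)
  have "w \<noteq> 0\<^sub>v n"
  proof
    assume "w = 0\<^sub>v n"
    then have "u = (?b / ?a) \<cdot>\<^sub>v v" using ueq v by simp
    moreover from this have "?b / ?a \<noteq> 0" using u v by auto
    ultimately show False using np proportional_smult proportional_sym by metis
  qed
  then have "0 < scalar_prod w w" using w scalar_prod_self_pos by blast
  moreover have "scalar_prod u w = scalar_prod w w"
    using vw w v by (subst ueq) (simp add: add_scalar_prod_distrib[of _ n])
  ultimately show ?thesis using that w vw by auto
qed

text \<open>Orthogonal vectors admit \<open>u + v\<close>, all others \<open>u\<close> itself. Such
  a \<open>w\<close> fills the slots of a test tensor that must not decide whether an inner product
  vanishes.\<close>

lemma common_nonorthogonal_vector:
  fixes u v :: "real Matrix.vec"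
  assumes u: "u \<in> carrier_vec n" "u \<noteq> 0\<^sub>v n" and v: "v \<in> carrier_vec n" "v \<noteq> 0\<^sub>v n"
  obtains w where "w \<in> carrier_vec n" "scalar_prod u w \<noteq> 0" "scalar_prod v w \<noteq> 0"
proof (cases "scalar_prod u v = 0")
  case True
  show ?thesis
  proof (rule that[of "u + v"])
    show "scalar_prod u (u + v) \<noteq> 0"
      using scalar_prod_self_pos[OF u] u v True by (simp add: scalar_prod_add_distrib[of _ n])
    show "scalar_prod v (u + v) \<noteq> 0"
      using scalar_prod_self_pos[OF v] u v True
      by (simp add: scalar_prod_add_distrib[of _ n] comm_scalar_prod[of v n u])
  qed (use u v in simp)
next
  case False
  then show ?thesis
    using that[of u] u v scalar_prod_self_pos[OF u] by (simp add: comm_scalar_prod[of v n u])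
qed

lemma unit_vec_not_proportional:
  assumes "i < n" "j < n" "i \<noteq> j"
  shows "\<not> proportional (unit_vec n i) (unit_vec n j)"
proof
  assume "proportional (unit_vec n i) (unit_vec n j)"
  then obtain c :: real where "unit_vec n j = c \<cdot>\<^sub>v unit_vec n i"
    unfolding proportional_def by blast
  then have "vec_index (unit_vec n j) j = vec_index (c \<cdot>\<^sub>v unit_vec n i :: real Matrix.vec) j" by simp
  then show False using assms by simp
qed

section \<open>The tensor product\<close>

locale tensor_product =
  fixes l :: nat and d :: "nat \<Rightarrow> nat"
    and \<tau> :: "(nat \<Rightarrow> real Matrix.vec) \<Rightarrow> 'v::euclidean_space"
  assumes two_le_dim: "i \<in> {1..l} \<Longrightarrow> 2 \<le> d i"
    and tensor: "is_tensor_product l d \<tau>"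
begin

definition nonzero_tuples :: "(nat \<Rightarrow> real Matrix.vec) set" where
  "nonzero_tuples = (\<Pi>\<^sub>E i\<in>{1..l}. carrier_vec (d i) - {0\<^sub>v (d i)})"

lemma multilinear: "multilinear_on_tuples l d \<tau>"
  using tensor unfolding is_tensor_product_def by blast

lemma inner_tau: "x \<in> tuples l d \<Longrightarrow> y \<in> tuples l d \<Longrightarrow>
    inner (\<tau> x) (\<tau> y) = (\<Prod>i\<in>{1..l}. scalar_prod (x i) (y i))"
  using tensor unfolding is_tensor_product_def by blast

lemma ex1_functional: "multilinear_on_tuples l d (\<phi> :: _ \<Rightarrow> real) \<Longrightarrow>
    \<exists>!g. linear g \<and> (\<forall>x\<in>tuples l d. g (\<tau> x) = \<phi> x)"
  using tensor unfolding is_tensor_product_def by blast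

lemma tuples_carrier: "x \<in> tuples l d \<Longrightarrow> i \<in> {1..l} \<Longrightarrow> x i \<in> carrier_vec (d i)"
  unfolding tuples_def by (rule PiE_mem)

lemma nonzero_tuplesD:
  assumes "x \<in> nonzero_tuples"
  shows "x \<in> tuples l d" "i \<in> {1..l} \<Longrightarrow> x i \<in> carrier_vec (d i)" "i \<in> {1..l} \<Longrightarrow> x i \<noteq> 0\<^sub>v (d i)"
  using assms unfolding nonzero_tuples_def tuples_def by (auto simp: PiE_iff)

lemma nonzero_tuplesI:
  "x \<in> tuples l d \<Longrightarrow> (\<And>i. i \<in> {1..l} \<Longrightarrow> x i \<noteq> 0\<^sub>v (d i)) \<Longrightarrow> x \<in> nonzero_tuples"
  unfolding nonzero_tuples_def tuples_def by (auto simp: PiE_iff)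

lemma tuples_upd:
  "x \<in> tuples l d \<Longrightarrow> i \<in> {1..l} \<Longrightarrow> u \<in> carrier_vec (d i) \<Longrightarrow> x(i := u) \<in> tuples l d"
  unfolding tuples_def by (auto simp: PiE_iff extensional_def)

lemma nonzero_tuples_upd: "x \<in> nonzero_tuples \<Longrightarrow> i \<in> {1..l} \<Longrightarrow>
    u \<in> carrier_vec (d i) \<Longrightarrow> u \<noteq> 0\<^sub>v (d i) \<Longrightarrow> x(i := u) \<in> nonzero_tuples"
  unfolding nonzero_tuples_def by (auto simp: PiE_iff extensional_def)

lemma restrict_tuples:
  "(\<And>i. i \<in> {1..l} \<Longrightarrow> f i \<in> carrier_vec (d i)) \<Longrightarrow> (\<lambda>i\<in>{1..l}. f i) \<in> tuples l d"
  unfolding tuples_def by auto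

lemma tuples_ext:
  assumes "x \<in> tuples l d" "y \<in> tuples l d" "\<And>i. i \<in> {1..l} \<Longrightarrow> x i = y i"
  shows "x = y"
  using assms unfolding tuples_def by (rule PiE_ext)

definition unit_tuple :: "nat \<Rightarrow> real Matrix.vec" where
  "unit_tuple = (\<lambda>i\<in>{1..l}. unit_vec (d i) 0)"

lemma unit_tuple: "unit_tuple \<in> nonzero_tuples"
  unfolding nonzero_tuples_def unit_tuple_def using two_le_dim by force

lemma tau_add: "x \<in> tuples l d \<Longrightarrow> i \<in> {1..l} \<Longrightarrow> u \<in> carrier_vec (d i) \<Longrightarrow> v \<in> carrier_vec (d i)
    \<Longrightarrow> \<tau> (x(i := u + v)) = \<tau> (x(i := u)) + \<tau> (x(i := v))"
  and tau_smult: "x \<in> tuples l d \<Longrightarrow> i \<in> {1..l} \<Longrightarrow> u \<in> carrier_vec (d i)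
    \<Longrightarrow> \<tau> (x(i := c \<cdot>\<^sub>v u)) = c *\<^sub>R \<tau> (x(i := u))"
  using multilinear unfolding multilinear_on_tuples_def by blast+

lemma tau_smult_all:
  assumes x: "x \<in> tuples l d"
  shows "\<tau> (\<lambda>i\<in>{1..l}. c i \<cdot>\<^sub>v x i) = (\<Prod>i\<in>{1..l}. c i) *\<^sub>R \<tau> x"
proof -
  have "\<tau> (\<lambda>i. if i \<in> I then c i \<cdot>\<^sub>v x i else x i) = (\<Prod>i\<in>I. c i) *\<^sub>R \<tau> x"
    if "finite I" "I \<subseteq> {1..l}" for I
    using that
  proof (induction I)
    case (insert a I)
    let ?y = "\<lambda>i. if i \<in> I then c i \<cdot>\<^sub>v x i else x i"
    have y: "?y \<in> tuples l d" using x insert.prems unfolding tuples_def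
      by (auto simp: PiE_iff extensional_def)
    have "(\<lambda>i. if i \<in> insert a I then c i \<cdot>\<^sub>v x i else x i) = ?y(a := c a \<cdot>\<^sub>v x a)" by auto
    moreover have "?y(a := x a) = ?y" using insert.hyps by auto
    ultimately show ?case
      using tau_smult[OF y, of a "x a" "c a"] insert x by (simp add: tuples_carrier)
  qed simp
  from this[of "{1..l}"] have "\<tau> (\<lambda>i. if i \<in> {1..l} then c i \<cdot>\<^sub>v x i else x i) = (\<Prod>i\<in>{1..l}. c i) *\<^sub>R \<tau> x"
    by simp
  moreover have "(\<lambda>i. if i \<in> {1..l} then c i \<cdot>\<^sub>v x i else x i) = (\<lambda>i\<in>{1..l}. c i \<cdot>\<^sub>v x i)"
    using x unfolding tuples_def by (auto simp: PiE_iff extensional_def)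
  ultimately show ?thesis by simp
qed

text \<open>The squared norm of \<open>\<tau> x\<close> is the product of the squared norms of the
  factors.\<close>

lemma tau_eq_0_iff:
  assumes x: "x \<in> tuples l d"
  shows "\<tau> x = 0 \<longleftrightarrow> x \<notin> nonzero_tuples"
proof -
  have "\<tau> x = 0 \<longleftrightarrow> (\<Prod>i\<in>{1..l}. scalar_prod (x i) (x i)) = 0"
    using inner_tau[OF x x] by (metis inner_eq_zero_iff)
  also have "\<dots> \<longleftrightarrow> (\<exists>i\<in>{1..l}. scalar_prod (x i) (x i) = 0)" by simp
  also have "\<dots> \<longleftrightarrow> (\<exists>i\<in>{1..l}. x i = 0\<^sub>v (d i))"
  proof (rule bex_cong[OF refl])
    fix i assume "i \<in> {1..l}"
    from tuples_carrier[OF x this] show "(scalar_prod (x i) (x i) = 0) = (x i = 0\<^sub>v (d i))"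
      using scalar_prod_self_pos[of "x i" "d i"] by fastforce
  qed
  also have "\<dots> \<longleftrightarrow> x \<notin> nonzero_tuples" using x nonzero_tuplesI nonzero_tuplesD by blast
  finally show ?thesis .
qed

section \<open>Spanning and the universal property\<close>

lemma functionals_eqI:
  fixes g h :: "'v \<Rightarrow> real"
  assumes "linear g" "linear h" "\<And>x. x \<in> tuples l d \<Longrightarrow> g (\<tau> x) = h (\<tau> x)"
  shows "g = h"
proof -
  have "multilinear_on_tuples l d (\<lambda>x. h (\<tau> x))"
    using multilinear assms(2) unfolding multilinear_on_tuples_def
    by (metis linear_add linear_scale)
  from ex1_functional[OF this] show ?thesis using assms by blast
qed

text \<open>A hyperplane containing all decomposable vectors would be the kernel of a nonzero
  functional that vanishes on them, against the uniqueness half of the universal property.\<close>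

lemma span_tau: "span (\<tau> ` tuples l d) = UNIV"
proof (rule ccontr)
  assume "span (\<tau> ` tuples l d) \<noteq> UNIV"
  then obtain a where a: "a \<noteq> 0" "\<forall>x\<in>span (\<tau> ` tuples l d). inner a x = 0"
    using span_not_univ_subset_hyperplane by blast
  have "inner a = (\<lambda>_. 0)"
    by (rule functionals_eqI)
      (use a in \<open>auto simp: linear_iff inner_add_right span_base\<close>)
  then have "inner a a = 0" by metis
  then show False using a(1) by simp
qed

lemma linear_eqI:
  assumes "linear g" "linear h" "\<And>x. x \<in> tuples l d \<Longrightarrow> g (\<tau> x) = h (\<tau> x)"
  shows "g = h"
  using linear_eq_on[OF assms(1,2)] assms(3) span_tau by fast

lemma blinfun_eqI_tau:
  fixes S T :: "'v \<Rightarrow>\<^sub>L 'v"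
  assumes "\<And>x. x \<in> tuples l d \<Longrightarrow> S (\<tau> x) = T (\<tau> x)"
  shows "S = T"
proof -
  have "blinfun_apply S = blinfun_apply T"
    by (rule linear_eqI) (use assms in \<open>auto intro: bounded_linear.linear blinfun.bounded_linear_right\<close>)
  then show ?thesis by (simp add: blinfun_apply_inject)
qed

text \<open>The universal property is stated for scalar-valued forms, so it is applied to the
  coordinates of \<open>\<phi>\<close> in the orthonormal basis and the functionals are
  reassembled.\<close>

lemma ex_blinfun:
  fixes \<phi> :: "_ \<Rightarrow> 'v"
  assumes \<phi>: "multilinear_on_tuples l d \<phi>"
  obtains T :: "'v \<Rightarrow>\<^sub>L 'v" where "\<And>x. x \<in> tuples l d \<Longrightarrow> T (\<tau> x) = \<phi> x"
proof -
  have "\<exists>g. linear g \<and> (\<forall>x\<in>tuples l d. g (\<tau> x) = inner (\<phi> x) b)" for b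
  proof (rule ex1_implies_ex[OF ex1_functional])
    show "multilinear_on_tuples l d (\<lambda>x. inner (\<phi> x) b)"
      using \<phi> unfolding multilinear_on_tuples_def
      by (metis inner_add_left inner_scaleR_left real_scaleR_def)
  qed
  then obtain g where g: "\<And>b. linear (g b)" "\<And>b x. x \<in> tuples l d \<Longrightarrow> g b (\<tau> x) = inner (\<phi> x) b"
    by metis
  let ?G = "\<lambda>v. \<Sum>b\<in>Basis. g b v *\<^sub>R b"
  have "linear ?G"
    by (rule linearI)
      (simp_all add: linear_add[OF g(1)] linear_scale[OF g(1)] scaleR_add_left sum.distrib scaleR_sum_right)
  then have "bounded_linear ?G" by (simp add: linear_conv_bounded_linear)
  then have "blinfun_apply (Blinfun ?G) = ?G" by (rule bounded_linear_Blinfun_apply)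
  then have "Blinfun ?G (\<tau> x) = \<phi> x" if "x \<in> tuples l d" for x
    using g(2)[OF that] by (simp add: euclidean_representation)
  then show ?thesis by (rule that)
qed

text \<open>A path from \<open>x\<close> to \<open>y\<close> replaces one slot at a time. The extra
  fact \<open>z i = x i\<close> lets a step with \<open>x i = y i\<close> be recognised as no change
  at all.\<close>

lemma nonzero_tuples_induct [consumes 2, case_names base step]:
  assumes x: "x \<in> nonzero_tuples" and y: "y \<in> nonzero_tuples" and base: "P x"
    and step: "\<And>z i. z \<in> nonzero_tuples \<Longrightarrow> i \<in> {1..l} \<Longrightarrow> z i = x i \<Longrightarrow> P z \<Longrightarrow> P (z(i := y i))"
  shows "P y"
proof -
  have "P (\<lambda>i. if i \<in> I then y i else x i)" if "finite I" "I \<subseteq> {1..l}" for I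
    using that
  proof (induction I)
    case empty
    then show ?case using base by simp
  next
    case (insert a I)
    let ?z = "\<lambda>i. if i \<in> I then y i else x i"
    have "?z \<in> nonzero_tuples" using x y insert.prems unfolding nonzero_tuples_def
      by (auto simp: PiE_iff extensional_def)
    then have "P (?z(a := y a))" using insert by (intro step) auto
    moreover have "?z(a := y a) = (\<lambda>i. if i \<in> insert a I then y i else x i)" by auto
    ultimately show ?case by simp
  qed
  from this[of "{1..l}"] have "P (\<lambda>i. if i \<in> {1..l} then y i else x i)" by simp
  moreover have "(\<lambda>i. if i \<in> {1..l} then y i else x i) = y"
    using x y unfolding nonzero_tuples_def by (auto simp: PiE_iff extensional_def)
  ultimately show ?thesis by simp
qed

section \<open>Factor lines and adjacency\<close>

text \<open>A set-valued Hamming distance: symmetric, with a triangle inequality for inclusion. On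
  nonzero tuples it compares points of a product of projective spaces, and adjacency means that it
  is a singleton or empty.\<close>

definition differing :: "(nat \<Rightarrow> real Matrix.vec) \<Rightarrow> (nat \<Rightarrow> real Matrix.vec) \<Rightarrow> nat set" where
  "differing x y = {i\<in>{1..l}. \<not> proportional (x i) (y i)}"

lemma differing_sym: "differing x y = differing y x"
  unfolding differing_def using proportional_sym by blast

lemma differing_triangle: "differing x z \<subseteq> differing x y \<union> differing y z"
  unfolding differing_def using proportional_trans by blast

lemma tau_proportional:
  assumes x: "x \<in> tuples l d" and y: "y \<in> tuples l d" and "differing x y = {}"
  obtains c where "c \<noteq> 0" "\<tau> y = c *\<^sub>R \<tau> x"
proof -
  have "\<forall>i\<in>{1..l}. \<exists>c. c \<noteq> 0 \<and> y i = c \<cdot>\<^sub>v x i"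
    using assms(3) unfolding differing_def proportional_def by blast
  then obtain c where c: "\<And>i. i \<in> {1..l} \<Longrightarrow> c i \<noteq> 0 \<and> y i = c i \<cdot>\<^sub>v x i" by metis
  have "y = (\<lambda>i\<in>{1..l}. c i \<cdot>\<^sub>v x i)"
    by (rule tuples_ext[OF y restrict_tuples]) (use c x tuples_carrier in auto)
  then have "\<tau> y = (\<Prod>i\<in>{1..l}. c i) *\<^sub>R \<tau> x" using tau_smult_all[OF x] by simp
  moreover have "(\<Prod>i\<in>{1..l}. c i) \<noteq> 0" using c by simp
  ultimately show ?thesis using that by blast
qed

text \<open>By multilinearity, the scalars relating the other slots can all be moved into slot
  \<open>j\<close>.\<close>

lemma tau_differing_subset_singleton:
  assumes x: "x \<in> tuples l d" and y: "y \<in> tuples l d" and j: "j \<in> {1..l}"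
    and "differing x y \<subseteq> {j}"
  obtains w where "w \<in> carrier_vec (d j)" "\<tau> y = \<tau> (x(j := w))"
proof -
  have yj: "y j \<in> carrier_vec (d j)" using y j tuples_carrier by blast
  have "differing (x(j := y j)) y = {}" using assms(4) unfolding differing_def by auto
  then obtain c where "\<tau> y = c *\<^sub>R \<tau> (x(j := y j))"
    using tau_proportional[OF tuples_upd[OF x j yj] y] by metis
  then have "\<tau> y = \<tau> (x(j := c \<cdot>\<^sub>v y j))" using tau_smult[OF x j yj] by simp
  then show ?thesis by (rule that[rotated]) (use yj in simp)
qed

text \<open>If the lines in slot \<open>i\<close> differed, replacing \<open>x i\<close> by a vector
  orthogonal to \<open>y i\<close> but not to \<open>x i\<close> would give a test tensor orthogonal
  to \<open>\<tau> y\<close> but not to \<open>\<tau> x\<close>.\<close>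

lemma scaleR_tau_proportional:
  assumes x: "x \<in> nonzero_tuples" and y: "y \<in> nonzero_tuples" and eq: "\<tau> x = c *\<^sub>R \<tau> y"
  shows "differing x y = {}"
proof (rule ccontr)
  assume "differing x y \<noteq> {}"
  then obtain i where i: "i \<in> {1..l}" "\<not> proportional (x i) (y i)" unfolding differing_def by blast
  obtain w where w: "w \<in> carrier_vec (d i)" "scalar_prod (y i) w = 0" "scalar_prod (x i) w \<noteq> 0"
    using separating_vector[OF _ _ _ _ i(2)] nonzero_tuplesD[OF x] nonzero_tuplesD[OF y] i(1) by metis
  have z: "x(i := w) \<in> tuples l d" using x w i nonzero_tuplesD tuples_upd by blast
  have "scalar_prod (x k) ((x(i := w)) k) \<noteq> 0" if "k \<in> {1..l}" for k
    using scalar_prod_self_pos[of "x k" "d k"] nonzero_tuplesD[OF x] that w(3) by auto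
  then have "inner (\<tau> x) (\<tau> (x(i := w))) \<noteq> 0"
    using inner_tau[OF nonzero_tuplesD(1)[OF x] z] by simp
  moreover have "inner (\<tau> y) (\<tau> (x(i := w))) = 0"
    unfolding inner_tau[OF nonzero_tuplesD(1)[OF y] z] using w(2) i(1) by (intro prod_zero) auto
  ultimately show False using eq by simp
qed

text \<open>With the other slots frozen, pairing with \<open>\<tau> c\<close> is a product of a
  function of slot \<open>i\<close> and one of slot \<open>m\<close>, a form of rank at most one. If
  both slots differed, \<open>\<tau> a + \<tau> b\<close> would give a form of rank two.\<close>

lemma differing_of_decomposable_sum:
  assumes a: "a \<in> nonzero_tuples" and b: "b \<in> nonzero_tuples" and c: "c \<in> tuples l d"
    and sum: "\<tau> a + \<tau> b = \<tau> c" and i: "i \<in> differing a b" and m: "m \<in> differing a b"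
  shows "i = m"
proof (rule ccontr)
  assume im: "i \<noteq> m"
  note aD = nonzero_tuplesD[OF a] and bD = nonzero_tuplesD[OF b]
  have I: "i \<in> {1..l}" "m \<in> {1..l}" "\<not> proportional (a i) (b i)" "\<not> proportional (a m) (b m)"
    using i m unfolding differing_def by auto
  have I': "\<not> proportional (b i) (a i)" "\<not> proportional (b m) (a m)"
    using I proportional_sym by blast+
  have "\<forall>k\<in>{1..l}. \<exists>w\<in>carrier_vec (d k). scalar_prod (a k) w \<noteq> 0 \<and> scalar_prod (b k) w \<noteq> 0"
    using common_nonorthogonal_vector[OF aD(2,3) bD(2,3)] by metis
  then obtain w where w: "\<And>k. k \<in> {1..l} \<Longrightarrow> w k \<in> carrier_vec (d k) \<and>
      scalar_prod (a k) (w k) \<noteq> 0 \<and> scalar_prod (b k) (w k) \<noteq> 0" by metis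
  obtain p where p: "p \<in> carrier_vec (d i)" "scalar_prod (b i) p = 0" "scalar_prod (a i) p \<noteq> 0"
    using separating_vector[OF aD(2,3) bD(2,3) I(3)] I by metis
  obtain q where q: "q \<in> carrier_vec (d i)" "scalar_prod (a i) q = 0" "scalar_prod (b i) q \<noteq> 0"
    using separating_vector[OF bD(2,3) aD(2,3) I'(1)] I by metis
  obtain r where r: "r \<in> carrier_vec (d m)" "scalar_prod (b m) r = 0" "scalar_prod (a m) r \<noteq> 0"
    using separating_vector[OF aD(2,3) bD(2,3) I(4)] I by metis
  obtain s where s: "s \<in> carrier_vec (d m)" "scalar_prod (a m) s = 0" "scalar_prod (b m) s \<noteq> 0"
    using separating_vector[OF bD(2,3) aD(2,3) I'(2)] I by metis
  define z where "z u v = (\<lambda>k\<in>{1..l}. if k = i then u else if k = m then v else w k)" for u v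
  have z: "z u v \<in> tuples l d" if "u \<in> carrier_vec (d i)" "v \<in> carrier_vec (d m)" for u v
    unfolding z_def using that w by (intro restrict_tuples) auto
  have nz: "inner (\<tau> x) (\<tau> (z u v)) \<noteq> 0 \<longleftrightarrow> scalar_prod (x i) u \<noteq> 0 \<and> scalar_prod (x m) v \<noteq> 0 \<and>
      (\<forall>k\<in>{1..l}-{i,m}. scalar_prod (x k) (w k) \<noteq> 0)"
    if "x \<in> tuples l d" "u \<in> carrier_vec (d i)" "v \<in> carrier_vec (d m)" for x u v
    unfolding inner_tau[OF that(1) z[OF that(2,3)]] using I(1,2) im by (auto simp: z_def)
  have eq: "inner (\<tau> c) (\<tau> y) = inner (\<tau> a) (\<tau> y) + inner (\<tau> b) (\<tau> y)" for y
    by (simp add: sum[symmetric] inner_add_left)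
  \<comment> \<open>The pair \<open>(p, r)\<close> sees only \<open>a\<close>, \<open>(q, s)\<close>
    sees only \<open>b\<close>, and \<open>(p, s)\<close> sees neither. A product form that is
    nonzero at the first two pairs is also nonzero at the third.\<close>
  have "inner (\<tau> b) (\<tau> (z p r)) = 0" "inner (\<tau> a) (\<tau> (z p r)) \<noteq> 0"
    "inner (\<tau> a) (\<tau> (z q s)) = 0" "inner (\<tau> b) (\<tau> (z q s)) \<noteq> 0"
    "inner (\<tau> a) (\<tau> (z p s)) = 0" "inner (\<tau> b) (\<tau> (z p s)) = 0"
    using nz[OF aD(1)] nz[OF bD(1)] p q r s w by blast+
  then have "inner (\<tau> c) (\<tau> (z p r)) \<noteq> 0" "inner (\<tau> c) (\<tau> (z q s)) \<noteq> 0" "inner (\<tau> c) (\<tau> (z p s)) = 0"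
    unfolding eq by simp_all
  then show False using nz[OF c] p(1) q(1) r(1) s(1) by blast
qed

end

lemma mult_mat_vec_zero: "A \<in> carrier_mat m n \<Longrightarrow> A *\<^sub>v 0\<^sub>v n = (0\<^sub>v m :: real Matrix.vec)"
  by (intro eq_vecI) (auto simp: scalar_prod_def)

lemma GL_matI:
  assumes A: "A \<in> carrier_mat n n"
    and ker: "\<And>v. v \<in> carrier_vec n \<Longrightarrow> A *\<^sub>v v = 0\<^sub>v n \<Longrightarrow> v = 0\<^sub>v n"
  shows "A \<in> GL_mat n"
proof -
  have "det A \<noteq> 0" using det_0_iff_vec_prod_zero[OF A] ker by blast
  from det_non_zero_imp_unit[OF A this, of "()"]
  obtain B where "B \<in> carrier_mat n n" "B * A = 1\<^sub>m n" "A * B = 1\<^sub>m n"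
    unfolding Units_def by (auto simp: ring_mat_simps)
  then have "invertible_mat A" using A unfolding invertible_mat_def inverts_mat_def by auto
  then show ?thesis using A unfolding GL_mat_def by simp
qed

context tensor_product
begin

section \<open>Triangles and 4-cycles of adjacent tuples\<close>

lemma differing_cong:
  assumes "differing x x' = {}" "differing y y' = {}"
  shows "differing x y = differing x' y'"
proof -
  have "proportional (x i) (y i) \<longleftrightarrow> proportional (x' i) (y' i)" if "i \<in> {1..l}" for i
  proof -
    have "proportional (x i) (x' i)" "proportional (y i) (y' i)"
      using assms that unfolding differing_def by blast+
    then show ?thesis using proportional_trans proportional_sym by blast
  qed
  then show ?thesis unfolding differing_def by blast
qed

text \<open>The triangle inequality puts each singleton inside the union of the other two, which
  forces all three to coincide.\<close>

lemma differing_cycle3: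
  assumes "differing p q = {i}" "differing q r = {j}" "differing p r = {k}"
  shows "k = i"
  using differing_triangle[of p r q] differing_triangle[of p q r] differing_triangle[of q r p]
    differing_sym[of r q] differing_sym[of q p] assms by auto

lemma differing_cycle4:
  assumes pq: "differing p q = {i}" and qr: "differing q r = {j}"
    and rs: "differing r s = {i'}" and sp: "differing s p = {j'}"
    and pr: "differing p r \<noteq> {}" and qs: "differing q s \<noteq> {}"
  shows "i = i'"
proof (rule ccontr)
  assume ne: "i \<noteq> i'"
  have pr1: "differing p r \<subseteq> {i, j}" using differing_triangle[of p r q] pq qr by auto
  have pr2: "differing p r \<subseteq> {i', j'}"
    using differing_triangle[of p r s] rs sp by (auto simp: differing_sym[of p s] differing_sym[of s r])
  have qs1: "differing q s \<subseteq> {j, i'}" using differing_triangle[of q s r] qr rs by auto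
  have qs2: "differing q s \<subseteq> {i, j'}"
    using differing_triangle[of q s p] pq sp by (auto simp: differing_sym[of q p] differing_sym[of p s])
  have "{i} \<subseteq> differing p r \<union> {j}"
    using differing_triangle[of p q r] pq qr by (auto simp: differing_sym[of r q])
  then have "i = j \<or> i = j'" using pr2 ne by auto
  moreover have "{i'} \<subseteq> differing p r \<union> {j'}"
    using differing_triangle[of r s p] rs sp by (auto simp: differing_sym[of r p] differing_sym[of p s])
  then have "i' = j \<or> i' = j'" using pr1 ne by auto
  ultimately show False using pr1 pr2 qs1 qs2 pr qs ne by auto
qed

end

section \<open>Linear isomorphisms preserving decomposable vectors\<close>

locale decomposable_isomorphism = tensor_product l d \<tau>
  for l d and \<tau> :: "(nat \<Rightarrow> real Matrix.vec) \<Rightarrow> 'v::euclidean_space" +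
  fixes T :: "'v \<Rightarrow> 'v"
  assumes linear_T: "linear T" and bij_T: "bij T"
    and T_decomposable: "T ` decomposable l d \<tau> \<subseteq> decomposable l d \<tau>"
begin

text \<open>An arbitrary choice of factors of \<open>T (\<tau> x)\<close>: only their lines are
  controlled, and \<open>rep\<close> need not be multilinear.\<close>

definition rep :: "(nat \<Rightarrow> real Matrix.vec) \<Rightarrow> nat \<Rightarrow> real Matrix.vec" where
  "rep x = (SOME y. y \<in> tuples l d \<and> T (\<tau> x) = \<tau> y)"

lemma rep:
  assumes "x \<in> tuples l d"
  shows rep_tuples: "rep x \<in> tuples l d" and tau_rep: "\<tau> (rep x) = T (\<tau> x)"
proof -
  have "\<exists>y. y \<in> tuples l d \<and> T (\<tau> x) = \<tau> y"
    using T_decomposable assms unfolding decomposable_def by blast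
  from someI_ex[OF this] show "rep x \<in> tuples l d" "\<tau> (rep x) = T (\<tau> x)"
    unfolding rep_def by simp_all
qed

lemma inj_T: "T v = T w \<longleftrightarrow> v = w"
  using bij_T by (simp add: bij_def inj_eq)

lemma T_eq_0_iff: "T v = 0 \<longleftrightarrow> v = 0"
  using inj_T[of v 0] linear_0[OF linear_T] by simp

lemma rep_nonzero: "x \<in> nonzero_tuples \<Longrightarrow> rep x \<in> nonzero_tuples"
  using tau_eq_0_iff rep nonzero_tuplesD(1) T_eq_0_iff by metis

lemma differing_rep_eq_empty_iff:
  assumes x: "x \<in> nonzero_tuples" and y: "y \<in> nonzero_tuples"
  shows "differing (rep x) (rep y) = {} \<longleftrightarrow> differing x y = {}"
proof
  note x' = nonzero_tuplesD(1)[OF x] and y' = nonzero_tuplesD(1)[OF y]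
  {
    assume "differing (rep x) (rep y) = {}"
    then obtain c where "\<tau> (rep y) = c *\<^sub>R \<tau> (rep x)"
      using tau_proportional[OF rep_tuples[OF x'] rep_tuples[OF y']] by metis
    then have "T (\<tau> y) = T (c *\<^sub>R \<tau> x)"
      by (simp add: tau_rep x' y' linear_scale[OF linear_T])
    then show "differing x y = {}"
      using scaleR_tau_proportional[OF y x] inj_T differing_sym by metis
  next
    assume "differing x y = {}"
    then obtain c where "\<tau> y = c *\<^sub>R \<tau> x" using tau_proportional[OF x' y'] by metis
    then have "\<tau> (rep y) = c *\<^sub>R \<tau> (rep x)"
      by (simp add: tau_rep x' y' linear_scale[OF linear_T])
    then show "differing (rep x) (rep y) = {}"
      using scaleR_tau_proportional[OF rep_nonzero[OF y] rep_nonzero[OF x]] differing_sym by metis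
  }
qed

text \<open>Additivity in slot \<open>i\<close> makes the sum of the two decomposable vectors
  decomposable, and \<open>T\<close> preserves this, so at most one slot of the images differs. At
  least one does, because \<open>T\<close> keeps different lines apart.\<close>

lemma differing_rep_upd:
  assumes x: "x \<in> nonzero_tuples" and i: "i \<in> {1..l}"
    and u: "u \<in> carrier_vec (d i)" "u \<noteq> 0\<^sub>v (d i)" and np: "\<not> proportional (x i) u"
  obtains j where "j \<in> {1..l}" "differing (rep x) (rep (x(i := u))) = {j}"
proof -
  note x' = nonzero_tuplesD(1)[OF x] and xi = nonzero_tuplesD(2)[OF x i]
  have y: "x(i := u) \<in> nonzero_tuples" by (rule nonzero_tuples_upd[OF x i u])
  have s: "x(i := x i + u) \<in> tuples l d" using tuples_upd[OF x' i] xi u by simp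
  have "\<tau> x + \<tau> (x(i := u)) = \<tau> (x(i := x i + u))" using tau_add[OF x' i xi u(1)] by simp
  then have "\<tau> (rep x) + \<tau> (rep (x(i := u))) = \<tau> (rep (x(i := x i + u)))"
    using tau_rep[OF s] tau_rep[OF x'] tau_rep[OF nonzero_tuplesD(1)[OF y]]
      linear_add[OF linear_T] by metis
  then have one: "k = m" if "k \<in> differing (rep x) (rep (x(i := u)))"
    "m \<in> differing (rep x) (rep (x(i := u)))" for k m
    using differing_of_decomposable_sum[OF rep_nonzero[OF x] rep_nonzero[OF y] rep_tuples[OF s]] that
    by blast
  have "i \<in> differing x (x(i := u))" using np i unfolding differing_def by simp
  then obtain j where j: "j \<in> differing (rep x) (rep (x(i := u)))"
    using differing_rep_eq_empty_iff[OF x y] by blast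
  then have "j \<in> {1..l}" unfolding differing_def by blast
  moreover have "differing (rep x) (rep (x(i := u))) = {j}" using one[OF j] j by blast
  ultimately show ?thesis using that by blast
qed

text \<open>The four tuples form a cycle with two sides in slot \<open>i\<close> and two in slot
  \<open>m\<close>. Both diagonals differ in slot \<open>i\<close>, so their images do not collapse
  and \<open>differing_cycle4\<close> applies. If \<open>w\<close> is proportional to
  \<open>x m\<close>, the two edges are projectively the same.\<close>

lemma differing_rep_parallel_edges:
  assumes x: "x \<in> nonzero_tuples" and i: "i \<in> {1..l}" and m: "m \<in> {1..l}" and im: "i \<noteq> m"
    and u: "u \<in> carrier_vec (d i)" "u \<noteq> 0\<^sub>v (d i)" and v: "v \<in> carrier_vec (d i)" "v \<noteq> 0\<^sub>v (d i)"
    and np: "\<not> proportional u v"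
    and w: "w \<in> carrier_vec (d m)" "w \<noteq> 0\<^sub>v (d m)"
  shows "differing (rep (x(i := u))) (rep (x(i := v))) =
    differing (rep (x(m := w, i := u))) (rep (x(m := w, i := v)))"
proof -
  let ?p = "x(i := u)" and ?q = "x(i := v)" and ?r = "x(m := w, i := v)" and ?s = "x(m := w, i := u)"
  have nz: "?p \<in> nonzero_tuples" "?q \<in> nonzero_tuples" "?r \<in> nonzero_tuples" "?s \<in> nonzero_tuples"
    using x i m u v w by (simp_all add: nonzero_tuples_upd)
  have upd: "?q = ?p(i := v)" "?r = ?q(m := w)" "?s = ?r(i := u)" "?s = ?p(m := w)" using im by auto
  show ?thesis
  proof (cases "proportional (x m) w")
    case True
    then have "differing ?p ?s = {}" "differing ?q ?r = {}"
      using im unfolding differing_def by auto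
    then have "differing (rep ?p) (rep ?s) = {}" "differing (rep ?q) (rep ?r) = {}"
      using differing_rep_eq_empty_iff nz by blast+
    then show ?thesis by (rule differing_cong)
  next
    case False
    obtain j where j: "differing (rep ?p) (rep ?q) = {j}"
      using differing_rep_upd[OF nz(1) i v] np unfolding upd(1) by auto
    obtain k where k: "differing (rep ?q) (rep ?r) = {k}"
      using differing_rep_upd[OF nz(2) m w] False im unfolding upd(2) by auto
    obtain j' where j': "differing (rep ?r) (rep ?s) = {j'}"
      using differing_rep_upd[OF nz(3) i u] np proportional_sym[of v u] unfolding upd(3) by auto
    obtain k' where k': "differing (rep ?p) (rep ?s) = {k'}"
      using differing_rep_upd[OF nz(1) m w] False im unfolding upd(4) by auto
    have "i \<in> differing ?p ?r" "i \<in> differing ?q ?s"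
      using np proportional_sym[of v u] i im unfolding differing_def by auto
    then have "differing (rep ?p) (rep ?r) \<noteq> {}" "differing (rep ?q) (rep ?s) \<noteq> {}"
      using differing_rep_eq_empty_iff nz by blast+
    then have "j = j'"
      using differing_cycle4[OF j k j'] k' differing_sym by metis
    then show ?thesis using j j' differing_sym by metis
  qed
qed

section \<open>The permutation of the slots\<close>

text \<open>The edge between the first two unit vectors in slot \<open>i\<close> is carried from
  \<open>unit_tuple\<close> to any base point along parallel edges, so its image slot
  \<open>j\<close> is constant. Any further \<open>u\<close> forms a triangle with these two, hence
  moves the same slot, and an edge from \<open>x i\<close> to \<open>u\<close> passes through the
  first unit vector.\<close>

lemma ex_direction:
  assumes i: "i \<in> {1..l}"
  shows "\<exists>j\<in>{1..l}. \<forall>x\<in>nonzero_tuples. \<forall>u\<in>carrier_vec (d i) - {0\<^sub>v (d i)}.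
    differing (rep x) (rep (x(i := u))) \<subseteq> {j}"
proof -
  let ?e = "\<lambda>k. unit_vec (d i) k :: real Matrix.vec"
  let ?E = "\<lambda>x u v. differing (rep (x(i := u))) (rep (x(i := v)))"
  have e: "?e k \<in> carrier_vec (d i)" "?e k \<noteq> 0\<^sub>v (d i)" if "k < 2" for k
    using two_le_dim[OF i] that by auto
  have np: "\<not> proportional (?e 0) (?e 1)"
    using unit_vec_not_proportional two_le_dim[OF i] by simp
  have e0: "z(i := ?e 0) \<in> nonzero_tuples" if "z \<in> nonzero_tuples" for z
    using nonzero_tuples_upd[OF that i e] by simp
  obtain j where j: "j \<in> {1..l}" "?E unit_tuple (?e 0) (?e 1) = {j}"
    using differing_rep_upd[OF e0[OF unit_tuple] i e[of 1]] np by auto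
  have base: "?E x (?e 0) (?e 1) = {j}" if "x \<in> nonzero_tuples" for x
    using unit_tuple that
  proof (induction rule: nonzero_tuples_induct)
    case (step z k)
    show ?case
    proof (cases "k = i")
      case False
      then have "i \<noteq> k" by simp
      then have "?E z (?e 0) (?e 1) = ?E (z(k := x k)) (?e 0) (?e 1)"
        using nonzero_tuplesD[OF that] step(2) e np
        by (intro differing_rep_parallel_edges[OF step(1) i step(2)]) simp_all
      then show ?thesis using step.IH by (simp only:)
    next
      case True
      show ?thesis unfolding True fun_upd_upd by (rule step.IH)
    qed
  qed (rule j)
  have base0: "?E x (?e 0) u \<subseteq> {j}"
    if x: "x \<in> nonzero_tuples" and u: "u \<in> carrier_vec (d i)" "u \<noteq> 0\<^sub>v (d i)"
    for x u
  proof -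
    have nz: "x(i := ?e 0) \<in> nonzero_tuples" "x(i := ?e 1) \<in> nonzero_tuples" "x(i := u) \<in> nonzero_tuples"
      using nonzero_tuples_upd[OF x i] e u by auto
    consider "proportional (?e 0) u" | "proportional (?e 1) u" |
      "\<not> proportional (?e 0) u" "\<not> proportional (?e 1) u" by blast
    then show ?thesis
    proof cases
      case 1
      then have "differing (x(i := ?e 0)) (x(i := u)) = {}" unfolding differing_def by auto
      then show ?thesis using differing_rep_eq_empty_iff[OF nz(1,3)] by simp
    next
      case 2
      then have "differing (x(i := ?e 1)) (x(i := u)) = {}" unfolding differing_def by auto
      then have "?E x (?e 1) u = {}" using differing_rep_eq_empty_iff[OF nz(2,3)] by simp
      then show ?thesis
        using differing_triangle[of "rep (x(i := ?e 0))" "rep (x(i := u))" "rep (x(i := ?e 1))"]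
          base[OF x] by simp
    next
      case 3
      obtain k where "?E x (?e 0) u = {k}"
        using differing_rep_upd[OF nz(1) i u] 3 by auto
      moreover obtain m where "?E x (?e 1) u = {m}"
        using differing_rep_upd[OF nz(2) i u] 3 by auto
      ultimately show ?thesis using differing_cycle3[OF base[OF x]] by simp
    qed
  qed
  show ?thesis
  proof (intro bexI[OF _ j(1)] ballI)
    fix x and u :: "real Matrix.vec"
    assume x: "x \<in> nonzero_tuples" and u: "u \<in> carrier_vec (d i) - {0\<^sub>v (d i)}"
    have "?E x (?e 0) (x i) \<subseteq> {j}" "?E x (?e 0) u \<subseteq> {j}"
      using base0[OF x] nonzero_tuplesD(2,3)[OF x i] u by blast+
    then show "differing (rep x) (rep (x(i := u))) \<subseteq> {j}"
      using differing_triangle[of "rep x" "rep (x(i := u))" "rep (x(i := ?e 0))"]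
        differing_sym[of "rep x"] by simp blast
  qed
qed

definition direction :: "nat \<Rightarrow> nat" where
  "direction i = (SOME j. j \<in> {1..l} \<and> (\<forall>x\<in>nonzero_tuples. \<forall>u\<in>carrier_vec (d i) - {0\<^sub>v (d i)}.
    differing (rep x) (rep (x(i := u))) \<subseteq> {j}))"

lemma direction:
  assumes "i \<in> {1..l}"
  shows "direction i \<in> {1..l}"
    and "x \<in> nonzero_tuples \<Longrightarrow> u \<in> carrier_vec (d i) \<Longrightarrow> u \<noteq> 0\<^sub>v (d i) \<Longrightarrow>
      differing (rep x) (rep (x(i := u))) \<subseteq> {direction i}"
  using someI_ex[OF ex_direction[OF assms, unfolded Bex_def]] unfolding direction_def[symmetric] by auto

text \<open>Along a path from \<open>x\<close> to \<open>y\<close>, a slot with another direction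
  does not move the line of component \<open>j\<close>, and a slot with direction \<open>j\<close>
  is not changed at all.\<close>

lemma rep_component_cong:
  assumes x: "x \<in> nonzero_tuples" and y: "y \<in> nonzero_tuples"
    and agree: "\<And>i. i \<in> {1..l} \<Longrightarrow> direction i = j \<Longrightarrow> x i = y i"
  shows "j \<notin> differing (rep x) (rep y)"
  using x y
proof (induction rule: nonzero_tuples_induct)
  case base
  show ?case unfolding differing_def by simp
next
  case (step z i)
  show ?case
  proof (cases "direction i = j")
    case True
    then show ?thesis using agree[OF step(2)] step by (metis fun_upd_triv)
  next
    case False
    then have "j \<notin> differing (rep z) (rep (z(i := y i)))"
      using direction(2)[OF step(2) step(1)] nonzero_tuplesD[OF y] step(2) by blast
    then show ?thesis using step.IH differing_triangle by blast
  qed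
qed

text \<open>If slot \<open>j\<close> were never reached, \<open>rep x j\<close> would stay on one
  line for all nonzero \<open>x\<close>. A nonzero tensor whose \<open>j\<close>-th factor is
  orthogonal to that line would then be orthogonal to the whole range of \<open>T\<close>.\<close>

lemma direction_surj: "direction ` {1..l} = {1..l}"
proof (rule ccontr)
  assume "direction ` {1..l} \<noteq> {1..l}"
  then obtain j where j: "j \<in> {1..l}" "\<And>i. i \<in> {1..l} \<Longrightarrow> direction i \<noteq> j"
    using direction(1) by blast
  let ?e = "\<lambda>k. unit_vec (d j) k :: real Matrix.vec" and ?b = "rep unit_tuple j"
  have b: "?b \<in> carrier_vec (d j)" "?b \<noteq> 0\<^sub>v (d j)"
    using nonzero_tuplesD[OF rep_nonzero[OF unit_tuple]] j by blast+
  \<comment> \<open>At least one of two distinct unit vectors is not proportional to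
    \<open>?b\<close>; separating it from \<open>?b\<close> gives \<open>w\<close>, which is nonzero
    because it is not orthogonal to that unit vector.\<close>
  obtain w where w: "w \<in> carrier_vec (d j)" "w \<noteq> 0\<^sub>v (d j)" "scalar_prod ?b w = 0"
  proof -
    have e: "?e k \<in> carrier_vec (d j)" "?e k \<noteq> 0\<^sub>v (d j)" if "k < 2" for k
      using two_le_dim[OF j(1)] that by auto
    have "\<not> proportional (?e 0) (?e 1)"
      using unit_vec_not_proportional two_le_dim[OF j(1)] by simp
    then obtain k where k: "k < 2" "\<not> proportional (?e k) ?b"
    proof (cases "proportional (?e 0) ?b")
      case True
      then have "\<not> proportional (?e 1) ?b"
        using \<open>\<not> proportional (?e 0) (?e 1)\<close> proportional_trans proportional_sym by blast
      then show ?thesis using that[of 1] by simp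
    next
      case False
      then show ?thesis using that[of 0] by simp
    qed
    obtain w where "w \<in> carrier_vec (d j)" "scalar_prod ?b w = 0" "scalar_prod (?e k) w \<noteq> 0"
      using separating_vector[OF e[OF k(1)] b k(2)] by metis
    then show ?thesis using that scalar_prod_right_zero e(1)[OF k(1)] by metis
  qed
  define z where "z = unit_tuple(j := w)"
  have z: "z \<in> nonzero_tuples" unfolding z_def by (rule nonzero_tuples_upd[OF unit_tuple j(1) w(1,2)])
  have "(\<lambda>v. inner (T v) (\<tau> z)) = (\<lambda>_. 0)"
  proof (rule functionals_eqI)
    show "linear (\<lambda>v. inner (T v) (\<tau> z))"
      by (rule linearI) (simp_all add: linear_add[OF linear_T] linear_scale[OF linear_T] inner_add_left)
    fix x assume x: "x \<in> tuples l d"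
    show "inner (T (\<tau> x)) (\<tau> z) = 0"
    proof (cases "x \<in> nonzero_tuples")
      case True
      have "j \<notin> differing (rep unit_tuple) (rep x)"
        by (rule rep_component_cong[OF unit_tuple True]) (use j(2) in blast)
      then obtain c where c: "rep x j = c \<cdot>\<^sub>v ?b"
        using j(1) unfolding differing_def proportional_def by blast
      have "scalar_prod (rep x j) (z j) = 0" unfolding c z_def using w b by simp
      then show ?thesis
        unfolding tau_rep[OF x, symmetric] inner_tau[OF rep_tuples[OF x] nonzero_tuplesD(1)[OF z]]
        using j(1) by (intro prod_zero) auto
    qed (use tau_eq_0_iff[OF x] linear_0[OF linear_T] in simp)
  qed (simp add: linear_zero)
  moreover obtain v where "T v = \<tau> z" using bij_T by (metis bij_pointE)
  ultimately have "inner (\<tau> z) (\<tau> z) = 0" by metis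
  then show False using tau_eq_0_iff nonzero_tuplesD(1)[OF z] z by simp
qed

lemma direction_bij: "bij_betw direction {1..l} {1..l}"
  unfolding bij_betw_def using direction_surj by (simp add: eq_card_imp_inj_on)

section \<open>Dimensions and matrices of the factors\<close>

lemma ex_factor_vector:
  assumes i: "i \<in> {1..l}" and u: "u \<in> carrier_vec (d i)"
  shows "\<exists>w\<in>carrier_vec (d (direction i)).
    T (\<tau> (unit_tuple(i := u))) = \<tau> ((rep unit_tuple)(direction i := w))"
proof (cases "u = 0\<^sub>v (d i)")
  case True
  have "\<tau> (unit_tuple(i := u)) = 0"
    using tau_eq_0_iff[OF tuples_upd[OF nonzero_tuplesD(1)[OF unit_tuple] i u]] True
      nonzero_tuplesD(3)[of "unit_tuple(i := u)"] i by force
  moreover have "(rep unit_tuple)(direction i := 0\<^sub>v (d (direction i))) \<in> tuples l d"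
    using tuples_upd rep_tuples nonzero_tuplesD(1)[OF unit_tuple] direction(1)[OF i] by simp
  then have "\<tau> ((rep unit_tuple)(direction i := 0\<^sub>v (d (direction i)))) = 0"
    using tau_eq_0_iff nonzero_tuplesD(3)[of "(rep unit_tuple)(direction i := 0\<^sub>v (d (direction i)))"
      "direction i"] direction(1)[OF i] by force
  ultimately show ?thesis using T_eq_0_iff by (metis zero_carrier_vec)
next
  case False
  have nz: "unit_tuple(i := u) \<in> nonzero_tuples" by (rule nonzero_tuples_upd[OF unit_tuple i u False])
  show ?thesis
    using tau_differing_subset_singleton[OF rep_tuples rep_tuples direction(1)[OF i]
      direction(2)[OF i unit_tuple u False]] nz unit_tuple nonzero_tuplesD(1) tau_rep by metis
qed

text \<open>Varying slot \<open>i\<close> of \<open>unit_tuple\<close> gives a subspace of dimension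
  \<open>d i\<close>. The injective \<open>T\<close> sends it into the one obtained by varying slot
  \<open>direction i\<close> of \<open>rep unit_tuple\<close>, of dimension at most
  \<open>d (direction i)\<close>.\<close>

lemma dim_le_direction:
  assumes i: "i \<in> {1..l}"
  shows "d i \<le> d (direction i)"
proof -
  let ?j = "direction i"
  define g where "g k = \<tau> (unit_tuple(i := unit_vec (d i) k))" for k
  define h where "h k = \<tau> ((rep unit_tuple)(?j := unit_vec (d ?j) k))" for k
  have u: "unit_tuple \<in> tuples l d" "rep unit_tuple \<in> tuples l d"
    using unit_tuple nonzero_tuplesD rep_tuples by auto
  have gt: "unit_tuple(i := unit_vec (d i) k) \<in> tuples l d" for k
    using tuples_upd[OF u(1) i] by simp
  have orth: "inner (g k) (g m) = 0" if "k < d i" "m < d i" "k \<noteq> m" for k m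
    unfolding g_def inner_tau[OF gt gt] using that i by (intro prod_zero) (auto intro!: bexI[of _ i])
  have g0: "g k \<noteq> 0" if "k < d i" for k
    unfolding g_def using tau_eq_0_iff[OF gt] nonzero_tuples_upd[OF unit_tuple i] that
    by (simp add: unit_vec_nonzero)
  have inj: "inj_on g {..<d i}"
    using orth g0 by (intro inj_onI) (metis inner_eq_zero_iff lessThan_iff)
  have "independent (g ` {..<d i})"
  proof (rule pairwise_orthogonal_independent)
    show "pairwise real_inner_class.orthogonal (g ` {..<d i})"
      unfolding pairwise_def real_inner_class.orthogonal_def using orth by blast
    show "0 \<notin> g ` {..<d i}" using g0 by force
  qed
  then have ind: "independent (T ` g ` {..<d i})"
    using linear_independent_injective_image[OF linear_T] bij_T inj_on_subset
    by (metis bij_def subset_UNIV)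
  have sub: "T ` g ` {..<d i} \<subseteq> span (h ` {..<d ?j})"
  proof clarify
    fix k
    obtain w where w: "w \<in> carrier_vec (d ?j)" "T (g k) = \<tau> ((rep unit_tuple)(?j := w))"
      using ex_factor_vector[OF i, of "unit_vec (d i) k"] unfolding g_def by auto
    have "T (g k) = (\<Sum>r<d ?j. vec_index w r *\<^sub>R h r)"
      unfolding w(2) h_def by (rule multilinear_sum[OF multilinear u(2) direction(1)[OF i] w(1)])
    also have "\<dots> \<in> span (h ` {..<d ?j})"
      by (intro span_sum span_scale span_base imageI)
    finally show "T (g k) \<in> span (h ` {..<d ?j})" .
  qed
  have "d i = card (T ` g ` {..<d i})"
    using card_image[OF inj] card_image[OF inj_on_subset[of T UNIV]] bij_T
    by (simp add: bij_def)
  also have "\<dots> \<le> card (h ` {..<d ?j})"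
    using independent_span_bound[OF _ ind sub] by simp
  also have "\<dots> \<le> d ?j" using card_image_le[of "{..<d ?j}" h] by simp
  finally show ?thesis .
qed

text \<open>A bijection of the slots preserves the sum of the dimensions, so no inequality in
  \<open>dim_le_direction\<close> can be strict.\<close>

lemma dim_direction: "i \<in> {1..l} \<Longrightarrow> d (direction i) = d i"
proof -
  have "(\<Sum>i\<in>{1..l}. d (direction i)) = (\<Sum>i\<in>{1..l}. d i)"
    by (rule sum.reindex_bij_betw[OF direction_bij])
  then show "i \<in> {1..l} \<Longrightarrow> d (direction i) = d i"
    using sum_mono_inv[of d "{1..l}" "\<lambda>i. d (direction i)" i] dim_le_direction by simp
qed

text \<open>The factors chosen for the unit vectors become the columns of \<open>A\<close>;
  linearity of \<open>T\<close> and of \<open>\<tau>\<close> in a single slot extends the formula to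
  all \<open>u\<close>.\<close>

lemma ex_factor_matrix:
  assumes i: "i \<in> {1..l}"
  shows "\<exists>A\<in>carrier_mat (d i) (d i). \<forall>u\<in>carrier_vec (d i).
    T (\<tau> (unit_tuple(i := u))) = \<tau> ((rep unit_tuple)(direction i := A *\<^sub>v u))"
proof -
  let ?j = "direction i" and ?e = "\<lambda>k. unit_vec (d i) k :: real Matrix.vec"
  note dj = dim_direction[OF i]
  have u: "unit_tuple \<in> tuples l d" "rep unit_tuple \<in> tuples l d"
    using unit_tuple nonzero_tuplesD rep_tuples by auto
  have "\<forall>k. \<exists>w\<in>carrier_vec (d i). T (\<tau> (unit_tuple(i := ?e k))) = \<tau> ((rep unit_tuple)(?j := w))"
    using ex_factor_vector[OF i] dj by simp
  then obtain w where w: "\<And>k. w k \<in> carrier_vec (d i)"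
    "\<And>k. T (\<tau> (unit_tuple(i := ?e k))) = \<tau> ((rep unit_tuple)(?j := w k))" by metis
  define A where "A = Matrix.mat (d i) (d i) (\<lambda>(r, k). vec_index (w k) r)"
  have A: "A \<in> carrier_mat (d i) (d i)" unfolding A_def by simp
  have exp: "\<tau> ((rep unit_tuple)(?j := v)) =
      (\<Sum>r<d i. vec_index v r *\<^sub>R \<tau> ((rep unit_tuple)(?j := ?e r)))" if "v \<in> carrier_vec (d i)" for v
    using multilinear_sum[OF multilinear u(2) direction(1)[OF i], of v] that dj by simp
  have "T (\<tau> (unit_tuple(i := v))) = \<tau> ((rep unit_tuple)(?j := A *\<^sub>v v))"
    if v: "v \<in> carrier_vec (d i)" for v
  proof -
    have "T (\<tau> (unit_tuple(i := v))) = (\<Sum>k<d i. vec_index v k *\<^sub>R T (\<tau> (unit_tuple(i := ?e k))))"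
      unfolding multilinear_sum[OF multilinear u(1) i v] linear_sum[OF linear_T]
      by (simp add: linear_scale[OF linear_T])
    also have "\<dots> = (\<Sum>k<d i. \<Sum>r<d i. (vec_index v k * vec_index (w k) r) *\<^sub>R
        \<tau> ((rep unit_tuple)(?j := ?e r)))"
      unfolding w(2) by (subst exp[OF w(1)]) (simp add: scaleR_sum_right)
    also have "\<dots> = (\<Sum>r<d i. (\<Sum>k<d i. vec_index v k * vec_index (w k) r) *\<^sub>R
        \<tau> ((rep unit_tuple)(?j := ?e r)))"
      by (subst sum.swap) (simp add: scaleR_sum_left)
    also have "\<dots> = (\<Sum>r<d i. vec_index (A *\<^sub>v v) r *\<^sub>R \<tau> ((rep unit_tuple)(?j := ?e r)))"
      using v by (intro sum.cong refl arg_cong2[of _ _ _ _ scaleR])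
        (auto simp: A_def scalar_prod_def atLeast0LessThan mult.commute)
    also have "\<dots> = \<tau> ((rep unit_tuple)(?j := A *\<^sub>v v))"
      using A v by (intro exp[symmetric]) simp
    finally show ?thesis .
  qed
  then show ?thesis using A by blast
qed

text \<open>The matrices are read off from the tuples that differ from \<open>unit_tuple\<close> in
  one slot. The resulting candidate \<open>g x\<close> has the same lines as \<open>rep x\<close>,
  since the line of \<open>rep x i\<close> depends only on \<open>x (\<sigma> i)\<close>. This
  leaves one unknown scalar per tuple, which is shown to be \<open>1\<close> along paths starting at
  \<open>unit_tuple\<close>.\<close>

lemma tensor_decomposition:
  obtains \<sigma> A where "\<sigma> permutes {1..l}" "\<And>i. i \<in> {1..l} \<Longrightarrow> d (\<sigma> i) = d i"
    "\<And>i. i \<in> {1..l} \<Longrightarrow> A i \<in> GL_mat (d i)"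
    "\<And>x. x \<in> tuples l d \<Longrightarrow> T (\<tau> x) = \<tau> (\<lambda>i\<in>{1..l}. A i *\<^sub>v x (\<sigma> i))"
proof -
  define \<sigma> where "\<sigma> i = (if i \<in> {1..l} then inv_into {1..l} direction i else i)" for i
  have "bij_betw \<sigma> {1..l} {1..l}"
    using bij_betw_inv_into[OF direction_bij] by (rule bij_betw_cong[THEN iffD1, rotated]) (simp add: \<sigma>_def)
  then have \<sigma>: "\<sigma> permutes {1..l}" by (rule bij_imp_permutes) (auto simp: \<sigma>_def)
  have \<sigma>_in: "\<sigma> i \<in> {1..l}" if "i \<in> {1..l}" for i using \<sigma> that permutes_in_image by metis
  have dir: "direction (\<sigma> i) = i" if "i \<in> {1..l}" for i
    using that direction_surj by (simp add: \<sigma>_def f_inv_into_f)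
  have dir_eq: "k = \<sigma> i" if "k \<in> {1..l}" "direction k = i" for k i
    using direction_bij that direction(1)[OF that(1)] unfolding bij_betw_def \<sigma>_def
    by (auto simp: inv_into_f_f)
  have d\<sigma>: "d (\<sigma> i) = d i" if "i \<in> {1..l}" for i
    using dim_direction[OF \<sigma>_in[OF that]] dir[OF that] by simp
  let ?x0 = unit_tuple
  define y0 where "y0 = rep ?x0"
  have x0: "?x0 \<in> tuples l d" using unit_tuple nonzero_tuplesD by blast
  have y0: "y0 \<in> nonzero_tuples" unfolding y0_def by (rule rep_nonzero[OF unit_tuple])
  have "\<forall>i\<in>{1..l}. \<exists>A\<in>carrier_mat (d i) (d i). \<forall>u\<in>carrier_vec (d i).
      T (\<tau> (?x0(\<sigma> i := u))) = \<tau> (y0(i := A *\<^sub>v u))"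
    using ex_factor_matrix[OF \<sigma>_in] dir d\<sigma> unfolding y0_def by auto
  then obtain A where A: "\<And>i. i \<in> {1..l} \<Longrightarrow> A i \<in> carrier_mat (d i) (d i)"
    and TA: "\<And>i u. i \<in> {1..l} \<Longrightarrow> u \<in> carrier_vec (d i) \<Longrightarrow>
      T (\<tau> (?x0(\<sigma> i := u))) = \<tau> (y0(i := A i *\<^sub>v u))" by metis
  have y0A: "y0(i := A i *\<^sub>v u) \<in> nonzero_tuples"
    if i: "i \<in> {1..l}" and u: "u \<in> carrier_vec (d i)" "u \<noteq> 0\<^sub>v (d i)" for i u
  proof -
    have nz: "?x0(\<sigma> i := u) \<in> nonzero_tuples"
      using nonzero_tuples_upd[OF unit_tuple \<sigma>_in[OF i]] u d\<sigma>[OF i] by simp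
    have "y0(i := A i *\<^sub>v u) \<in> tuples l d"
      using tuples_upd[OF nonzero_tuplesD(1)[OF y0] i] A[OF i] u by simp
    moreover have "\<tau> (y0(i := A i *\<^sub>v u)) \<noteq> 0"
      using TA[OF i u(1)] T_eq_0_iff tau_eq_0_iff[OF nonzero_tuplesD(1)[OF nz]] nz by metis
    ultimately show ?thesis using tau_eq_0_iff by blast
  qed
  have A0: "A i *\<^sub>v u \<noteq> 0\<^sub>v (d i)" if "i \<in> {1..l}" "u \<in> carrier_vec (d i)" "u \<noteq> 0\<^sub>v (d i)" for i u
    using nonzero_tuplesD(3)[OF y0A[OF that] that(1)] by simp
  define g where "g x = (\<lambda>i\<in>{1..l}. A i *\<^sub>v x (\<sigma> i))" for x
  have x\<sigma>: "x (\<sigma> i) \<in> carrier_vec (d i)" if "x \<in> tuples l d" "i \<in> {1..l}" for x i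
    using tuples_carrier[OF that(1) \<sigma>_in[OF that(2)]] d\<sigma>[OF that(2)] by simp
  have g: "g x \<in> tuples l d" if "x \<in> tuples l d" for x
    unfolding g_def by (rule restrict_tuples) (use mult_mat_vec_carrier[OF A x\<sigma>[OF that]] in simp)
  have gnz: "g x \<in> nonzero_tuples" if x: "x \<in> nonzero_tuples" for x
  proof (rule nonzero_tuplesI)
    show "g x \<in> tuples l d" by (rule g[OF nonzero_tuplesD(1)[OF x]])
    fix i assume i: "i \<in> {1..l}"
    show "g x i \<noteq> 0\<^sub>v (d i)"
      using A0[OF i x\<sigma>[OF nonzero_tuplesD(1)[OF x] i]] nonzero_tuplesD(3)[OF x \<sigma>_in[OF i]] d\<sigma>[OF i] i
      by (simp add: g_def)
  qed
  have g_upd: "g (x(\<sigma> i := u)) = (g x)(i := A i *\<^sub>v u)" if i: "i \<in> {1..l}" for x i u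
  proof
    fix m
    have "\<sigma> m = \<sigma> i \<longleftrightarrow> m = i" using permutes_inj[OF \<sigma>] by (auto dest: injD)
    then show "g (x(\<sigma> i := u)) m = ((g x)(i := A i *\<^sub>v u)) m" using i by (auto simp: g_def)
  qed
  have rep_g: "differing (rep x) (g x) = {}" if x: "x \<in> nonzero_tuples" for x
  proof -
    have "proportional (rep x i) (g x i)" if i: "i \<in> {1..l}" for i
    proof -
      let ?u = "x (\<sigma> i)"
      have u: "?u \<in> carrier_vec (d i)" "?u \<noteq> 0\<^sub>v (d i)"
        using nonzero_tuplesD(2,3)[OF x \<sigma>_in[OF i]] d\<sigma>[OF i] by simp_all
      have nz: "?x0(\<sigma> i := ?u) \<in> nonzero_tuples"
        using nonzero_tuples_upd[OF unit_tuple \<sigma>_in[OF i]] u d\<sigma>[OF i] by simp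
      \<comment> \<open>The two tuples agree in \<open>\<sigma> i\<close>, the only slot with
        direction \<open>i\<close>.\<close>
      have "i \<notin> differing (rep x) (rep (?x0(\<sigma> i := ?u)))"
        using dir_eq by (intro rep_component_cong[OF x nz]) force
      then have 1: "proportional (rep x i) (rep (?x0(\<sigma> i := ?u)) i)"
        using i unfolding differing_def by blast
      have "\<tau> (rep (?x0(\<sigma> i := ?u))) = 1 *\<^sub>R \<tau> (y0(i := A i *\<^sub>v ?u))"
        using TA[OF i u(1)] tau_rep[OF nonzero_tuplesD(1)[OF nz]] by simp
      from scaleR_tau_proportional[OF rep_nonzero[OF nz] y0A[OF i u] this]
      have "proportional (rep (?x0(\<sigma> i := ?u)) i) (A i *\<^sub>v ?u)"
        using i unfolding differing_def by force
      then show ?thesis using proportional_trans[OF 1] i by (simp add: g_def)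
    qed
    then show ?thesis unfolding differing_def by blast
  qed
  have scalar: "\<exists>c. \<tau> (g x) = c *\<^sub>R T (\<tau> x)" if x: "x \<in> nonzero_tuples" for x
    using tau_proportional[OF rep_tuples g rep_g[OF x]] nonzero_tuplesD(1)[OF x]
      tau_rep[OF nonzero_tuplesD(1)[OF x]] by metis
  have main: "\<tau> (g x) = T (\<tau> x)" if x: "x \<in> nonzero_tuples" for x
    using unit_tuple x
  proof (induction rule: nonzero_tuples_induct)
    case base
    show ?case
    proof -
      have "g ?x0 i = y0 i" if i: "i \<in> {1..l}" for i
      proof -
        have u: "?x0 (\<sigma> i) \<in> carrier_vec (d i)" by (rule x\<sigma>[OF x0 i])
        \<comment> \<open>Inserting into slot \<open>\<sigma> i\<close> the vector already there
          changes nothing; this fixes the scalar in slot \<open>i\<close> to be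
          \<open>1\<close>.\<close>
        have eq: "\<tau> (y0(i := A i *\<^sub>v ?x0 (\<sigma> i))) = \<tau> y0"
          using TA[OF i u] tau_rep[OF x0] unfolding y0_def by simp
        have "proportional (y0 i) (g ?x0 i)"
          using rep_g[OF unit_tuple] i unfolding differing_def y0_def by blast
        then obtain c where c: "g ?x0 i = c \<cdot>\<^sub>v y0 i" unfolding proportional_def by blast
        then have "\<tau> y0 = \<tau> (y0(i := c \<cdot>\<^sub>v y0 i))" using eq i by (simp add: g_def)
        also have "\<dots> = c *\<^sub>R \<tau> y0"
          using tau_smult[OF nonzero_tuplesD(1)[OF y0] i nonzero_tuplesD(2)[OF y0 i]] by simp
        finally have "c = 1" using tau_eq_0_iff[OF nonzero_tuplesD(1)[OF y0]] y0
          by (metis scaleR_cancel_right scaleR_one)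
        then show ?thesis using c by simp
      qed
      then have "g ?x0 = y0" using tuples_ext[OF g[OF x0] nonzero_tuplesD(1)[OF y0]] by blast
      then show ?thesis using tau_rep[OF x0] unfolding y0_def by simp
    qed
  next
    case (step z k)
    define i where "i = direction k"
    have i: "i \<in> {1..l}" unfolding i_def by (rule direction(1)[OF step(2)])
    have k: "k = \<sigma> i" by (rule dir_eq[OF step(2) i_def[symmetric]])
    note z = nonzero_tuplesD(1)[OF step(1)]
    have zk: "z k \<in> carrier_vec (d k)" "x k \<in> carrier_vec (d k)" "x k \<noteq> 0\<^sub>v (d k)" "z k \<noteq> 0\<^sub>v (d k)"
      using nonzero_tuplesD step(1,2) x by blast+
    have zx: "z(k := x k) \<in> nonzero_tuples" by (rule nonzero_tuples_upd[OF step(1,2) zk(2,3)])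
    have Ai: "A i \<in> carrier_mat (d k) (d k)" using A[OF i] d\<sigma>[OF i] k by simp
    have dk: "d i = d k" using d\<sigma>[OF i] k by simp
    have G: "\<tau> (g (z(k := u))) = \<tau> ((g z)(i := A i *\<^sub>v u))" for u unfolding k g_upd[OF i] ..
    have G_add: "\<tau> (g (z(k := u + v))) = \<tau> (g (z(k := u))) + \<tau> (g (z(k := v)))"
      if "u \<in> carrier_vec (d k)" "v \<in> carrier_vec (d k)" for u v
      unfolding G mult_add_distrib_mat_vec[OF Ai that]
      by (rule tau_add[OF g[OF z] i]) (use Ai that dk in auto)
    have G_smult: "\<tau> (g (z(k := c \<cdot>\<^sub>v u))) = c *\<^sub>R \<tau> (g (z(k := u)))"
      if "u \<in> carrier_vec (d k)" for u c
      unfolding G mult_mat_vec[OF Ai that]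
      by (rule tau_smult[OF g[OF z] i]) (use Ai that dk in auto)
    show ?case
    proof (cases "proportional (z k) (x k)")
      case True
      then obtain c where xk: "x k = c \<cdot>\<^sub>v z k" unfolding proportional_def by blast
      have "\<tau> (g (z(k := x k))) = c *\<^sub>R T (\<tau> z)"
        using G_smult[OF zk(1), of c] step.IH unfolding xk by (simp only: fun_upd_triv)
      also have "\<dots> = T (\<tau> (z(k := x k)))"
        using tau_smult[OF z step(2) zk(1), of c] unfolding xk
        by (simp only: fun_upd_triv linear_scale[OF linear_T])
      finally show ?thesis .
    next
      case False
      have sum0: "z k + x k \<noteq> 0\<^sub>v (d k)"
      proof
        assume "z k + x k = 0\<^sub>v (d k)"
        then have "vec_index (z k) m + vec_index (x k) m = 0" if "m < d k" for m
          using that zk by (metis carrier_vecD index_add_vec(1) index_zero_vec(1))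
        then have "x k = (-1) \<cdot>\<^sub>v z k" using zk by (auto simp: vec_eq_iff add_eq_0_iff)
        then show False using False proportional_smult[of "-1" "z k"] by simp
      qed
      have zs: "z(k := z k + x k) \<in> nonzero_tuples"
        by (rule nonzero_tuples_upd[OF step(1,2) _ sum0]) (use zk in simp)
      \<comment> \<open>The scalar at \<open>z\<close> is \<open>1\<close> by induction;
        \<open>a\<close> belongs to the sum and \<open>c\<close> to the new tuple. Both maps are
        additive in slot \<open>k\<close>, and \<open>\<tau> z\<close> and
        \<open>\<tau> (z(k := x k))\<close> are linearly independent, so comparing coefficients
        gives \<open>a = 1\<close> and then \<open>c = 1\<close>.\<close>
      obtain a where a: "\<tau> (g (z(k := z k + x k))) = a *\<^sub>R T (\<tau> (z(k := z k + x k)))"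
        using scalar[OF zs] by blast
      obtain c where c: "\<tau> (g (z(k := x k))) = c *\<^sub>R T (\<tau> (z(k := x k)))"
        using scalar[OF zx] by blast
      have "T (\<tau> z + c *\<^sub>R \<tau> (z(k := x k))) = \<tau> (g z) + \<tau> (g (z(k := x k)))"
        using step.IH c by (simp add: linear_add[OF linear_T] linear_scale[OF linear_T])
      also have "\<dots> = a *\<^sub>R T (\<tau> z + \<tau> (z(k := x k)))"
        using a G_add[OF zk(1,2)] tau_add[OF z step(2) zk(1,2)] by simp
      finally have "T (\<tau> z + c *\<^sub>R \<tau> (z(k := x k))) = T (a *\<^sub>R (\<tau> z + \<tau> (z(k := x k))))"
        by (simp add: linear_scale[OF linear_T])
      then have eq: "\<tau> z + c *\<^sub>R \<tau> (z(k := x k)) = a *\<^sub>R \<tau> z + a *\<^sub>R \<tau> (z(k := x k))"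
        using inj_T by (simp add: scaleR_add_right)
      have a1: "a = 1"
      proof (rule ccontr)
        assume "a \<noteq> 1"
        have "(1 - a) *\<^sub>R \<tau> z = (a - c) *\<^sub>R \<tau> (z(k := x k))" using eq by (simp add: algebra_simps)
        then have "inverse (1 - a) *\<^sub>R ((1 - a) *\<^sub>R \<tau> z) = inverse (1 - a) *\<^sub>R (a - c) *\<^sub>R \<tau> (z(k := x k))"
          by simp
        then have "\<tau> z = (inverse (1 - a) * (a - c)) *\<^sub>R \<tau> (z(k := x k))" using \<open>a \<noteq> 1\<close> by simp
        then have "differing z (z(k := x k)) = {}" by (rule scaleR_tau_proportional[OF step(1) zx])
        then show False using False step(2) unfolding differing_def by auto
      qed
      then have "(c - 1) *\<^sub>R \<tau> (z(k := x k)) = 0" using eq by (simp add: algebra_simps)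
      then have "c = 1" using tau_eq_0_iff[OF nonzero_tuplesD(1)[OF zx]] zx by simp
      show ?thesis using c unfolding \<open>c = 1\<close> scaleR_one .
    qed
  qed
  show ?thesis
  proof (rule that[OF \<sigma> d\<sigma>])
    show "A i \<in> GL_mat (d i)" if "i \<in> {1..l}" for i
      using A[OF that] A0[OF that] by (intro GL_matI) blast+
    fix x assume x: "x \<in> tuples l d"
    show "T (\<tau> x) = \<tau> (\<lambda>i\<in>{1..l}. A i *\<^sub>v x (\<sigma> i))"
    proof (cases "x \<in> nonzero_tuples")
      case True
      then show ?thesis using main unfolding g_def by simp
    next
      case False
      then obtain k where k: "k \<in> {1..l}" "x k = 0\<^sub>v (d k)" using x nonzero_tuplesI by blast
      define i where "i = direction k"
      have i: "i \<in> {1..l}" "k = \<sigma> i"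
        unfolding i_def using direction(1)[OF k(1)] dir_eq[OF k(1)] by auto
      have "g x i = 0\<^sub>v (d i)" using k i d\<sigma>[OF i(1)] mult_mat_vec_zero[OF A[OF i(1)]] by (simp add: g_def)
      then have "g x \<notin> nonzero_tuples" using nonzero_tuplesD(3) i(1) by blast
      then have "\<tau> (g x) = 0" using tau_eq_0_iff[OF g[OF x]] by blast
      moreover have "\<tau> x = 0" using tau_eq_0_iff[OF x] False by blast
      ultimately show ?thesis using linear_0[OF linear_T] unfolding g_def by simp
    qed
  qed
qed

end

section \<open>Internal semidirect products in the general linear group\<close>

text \<open>Multiplying \<open>n p\<close> by \<open>m q\<close> gives \<open>n\<close> times the
  conjugate of \<open>m\<close> by \<open>p\<close>, times \<open>p q\<close>, so the product map
  \<open>k\<close> is a homomorphism; the trivial intersection makes it injective. Its inverse is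
  the isomorphism in the direction wanted later. Since \<open>\<phi>\<close> is prescribed only on
  \<open>P\<close> and \<open>N\<close>, conjugation formed in another group may be
  inserted.\<close>

lemma internal_semidirect_product:
  fixes G :: "'a monoid" (structure) and N P :: "'a set" and \<phi> :: "'a \<Rightarrow> 'a \<Rightarrow> 'a"
  defines "k \<equiv> \<lambda>(n, p). n \<otimes> p"
  assumes G: "Group.group G" and N: "subgroup N G" and P: "subgroup P G"
    and norm: "\<And>p n. p \<in> P \<Longrightarrow> n \<in> N \<Longrightarrow> p \<otimes> n \<otimes> inv p \<in> N"
    and triv: "N \<inter> P \<subseteq> {\<one>}"
    and \<phi>: "\<And>p n. p \<in> P \<Longrightarrow> n \<in> N \<Longrightarrow> \<phi> p n = p \<otimes> n \<otimes> inv p"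
  shows "inj_on k (N \<times> P)"
    and "subgroup (k ` (N \<times> P)) G"
    and "Group.group (semidirect_product (G\<lparr>carrier := N\<rparr>) (G\<lparr>carrier := P\<rparr>) \<phi>)"
    and "inv_into (N \<times> P) k \<in>
      iso (G\<lparr>carrier := k ` (N \<times> P)\<rparr>) (semidirect_product (G\<lparr>carrier := N\<rparr>) (G\<lparr>carrier := P\<rparr>) \<phi>)"
proof -
  let ?H = "k ` (N \<times> P)" and ?S = "semidirect_product (G\<lparr>carrier := N\<rparr>) (G\<lparr>carrier := P\<rparr>) \<phi>"
  let ?h = "inv_into (N \<times> P) k"
  interpret Group.group G by (rule G)
  interpret N: subgroup N G by (rule N)
  interpret P: subgroup P G by (rule P)
  have k: "k (n, p) = n \<otimes> p" for n p unfolding k_def by simp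
  show inj: "inj_on k (N \<times> P)"
  proof (rule inj_onI, clarify)
    fix n p m q assume *: "n \<in> N" "p \<in> P" "m \<in> N" "q \<in> P" and "k (n, p) = k (m, q)"
    then have eq: "n \<otimes> p = m \<otimes> q" by (simp add: k)
    have "inv m \<otimes> n = inv m \<otimes> (n \<otimes> p) \<otimes> inv p" using * by (simp add: m_assoc)
    also have "\<dots> = q \<otimes> inv p" unfolding eq using * by (simp add: m_assoc[symmetric])
    finally have "inv m \<otimes> n = q \<otimes> inv p" .
    moreover from this have "inv m \<otimes> n \<in> N \<inter> P" using * by (metis IntI N.m_closed N.m_inv_closed P.m_closed P.m_inv_closed)
    ultimately have "inv m \<otimes> n = \<one>" "q \<otimes> inv p = \<one>" using triv by auto
    then show "n = m \<and> p = q"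
      using * by (metis N.mem_carrier P.mem_carrier inv_closed inv_inv inv_equality)
  qed
  have mult: "k (n, p) \<otimes> k (m, q) = k (n \<otimes> \<phi> p m, p \<otimes> q)"
    if "n \<in> N" "p \<in> P" "m \<in> N" "q \<in> P" for n p m q
  proof -
    have "(p \<otimes> m \<otimes> inv p) \<otimes> (p \<otimes> q) = p \<otimes> m \<otimes> (inv p \<otimes> p) \<otimes> q"
      using that by (simp only: m_assoc N.mem_carrier P.mem_carrier m_closed inv_closed)
    also have "\<dots> = p \<otimes> m \<otimes> q" using that by simp
    finally have "n \<otimes> ((p \<otimes> m \<otimes> inv p) \<otimes> (p \<otimes> q)) = n \<otimes> (p \<otimes> m \<otimes> q)" by simp
    then show ?thesis using that by (simp add: k \<phi> m_assoc)
  qed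
  have closed: "n \<otimes> \<phi> p m \<in> N" if "n \<in> N" "p \<in> P" "m \<in> N" for n p m
    using that norm \<phi> by simp
  show H: "subgroup ?H G"
  proof (rule subgroupI)
    show "?H \<subseteq> carrier G" by (auto simp: k)
    have "k (\<one>, \<one>) \<in> ?H" by (intro imageI) auto
    then show "?H \<noteq> {}" by blast
    fix x y assume "x \<in> ?H" "y \<in> ?H"
    then obtain n p m q where *: "n \<in> N" "p \<in> P" "m \<in> N" "q \<in> P" and xy: "x = k (n, p)" "y = k (m, q)"
      by auto
    show "x \<otimes> y \<in> ?H" unfolding xy mult[OF *] using * closed by (intro imageI SigmaI) simp_all
  next
    fix x assume "x \<in> ?H"
    then obtain n p where *: "n \<in> N" "p \<in> P" "x = n \<otimes> p" by (auto simp: k)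
    \<comment> \<open>Moving \<open>inv n\<close> to the left of \<open>inv p\<close> conjugates it
      by \<open>inv p\<close>.\<close>
    have eq: "inv x = k (inv p \<otimes> inv n \<otimes> inv (inv p), inv p)"
      using * by (simp add: k inv_mult_group m_assoc)
    show "inv x \<in> ?H" unfolding eq using * by (intro imageI SigmaI norm) simp_all
  qed
  have grp: "Group.group (G\<lparr>carrier := ?H\<rparr>)" by (rule subgroup_imp_group[OF H])
  have hk: "?h (k z) = z" if "z \<in> N \<times> P" for z using inv_into_f_f[OF inj that] .
  have "bij_betw ?h ?H (N \<times> P)"
    by (rule bij_betw_inv_into) (simp add: bij_betw_def inj)
  moreover have "?h \<in> hom (G\<lparr>carrier := ?H\<rparr>) ?S"
  proof (rule homI)
    fix x assume "x \<in> carrier (G\<lparr>carrier := ?H\<rparr>)"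
    then show "?h x \<in> carrier ?S" using inv_into_into[of x k "N \<times> P"] by (simp add: semidirect_product_def)
  next
    fix x y assume "x \<in> carrier (G\<lparr>carrier := ?H\<rparr>)" "y \<in> carrier (G\<lparr>carrier := ?H\<rparr>)"
    then obtain n p m q where *: "n \<in> N" "p \<in> P" "m \<in> N" "q \<in> P" and xy: "x = k (n, p)" "y = k (m, q)"
      by auto
    have "?h (x \<otimes> y) = (n \<otimes> \<phi> p m, p \<otimes> q)"
      unfolding xy mult[OF *] using * closed by (intro hk) auto
    moreover have "?h x = (n, p)" "?h y = (m, q)" unfolding xy using * by (auto intro!: hk)
    ultimately show "?h (x \<otimes>\<^bsub>G\<lparr>carrier := ?H\<rparr>\<^esub> y) = ?h x \<otimes>\<^bsub>?S\<^esub> ?h y"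
      by (simp add: semidirect_product_def)
  qed
  ultimately show iso: "?h \<in> iso (G\<lparr>carrier := ?H\<rparr>) ?S"
    by (simp add: iso_def semidirect_product_def)
  \<comment> \<open>The isomorphic image of a group is a group once its unit is identified, so the
    axioms of the semidirect product need not be checked one by one.\<close>
  have "?h \<one> = (\<one>, \<one>)" using hk[of "(\<one>, \<one>)"] by (simp add: k)
  then have "?S\<lparr>one := ?h \<one>\<rparr> = ?S" by (simp add: semidirect_product_def)
  then show "Group.group ?S" using group.iso_imp_img_group[OF grp iso] by simp
qed

section \<open>The general linear group\<close>

lemma GL_space_simps [simp]:
  "carrier GL_space = {T. bij (blinfun_apply T)}" "monoid.mult GL_space = (o\<^sub>L)" "one GL_space = id_blinfun"
  by (simp_all add: GL_space_def)

lemma blinfun_compose_assoc: "(f o\<^sub>L g) o\<^sub>L h = f o\<^sub>L (g o\<^sub>L h)"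
  by (rule blinfun_eqI) simp

lemma blinfun_compose_id [simp]: "f o\<^sub>L id_blinfun = f" "id_blinfun o\<^sub>L f = f"
  by (simp_all add: blinfun_eqI)

lemma group_GL_space: "Group.group (GL_space :: ('v::euclidean_space \<Rightarrow>\<^sub>L 'v) monoid)"
proof (rule groupI)
  show "\<one>\<^bsub>GL_space\<^esub> \<in> (carrier GL_space :: ('v \<Rightarrow>\<^sub>L 'v) set)"
    using bij_id by (simp add: id_def)
next
  fix S T U :: "'v \<Rightarrow>\<^sub>L 'v"
  assume T: "T \<in> carrier GL_space"
  have lin: "linear (blinfun_apply T)" by (intro bounded_linear.linear blinfun.bounded_linear_right)
  have "linear (inv_into UNIV (blinfun_apply T))"
    using T lin by (intro inj_linear_imp_inv_linear) (auto simp: bij_def)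
  then have "bounded_linear (inv_into UNIV (blinfun_apply T))" by (simp add: linear_conv_bounded_linear)
  then have inv: "blinfun_apply (Blinfun (inv_into UNIV (blinfun_apply T))) = inv_into UNIV (blinfun_apply T)"
    by (rule bounded_linear_Blinfun_apply)
  show "\<exists>S\<in>carrier GL_space. S \<otimes>\<^bsub>GL_space\<^esub> T = \<one>\<^bsub>GL_space\<^esub>"
  proof
    show "Blinfun (inv_into UNIV (blinfun_apply T)) \<in> carrier GL_space"
      using T by (simp add: inv bij_imp_bij_inv)
    show "Blinfun (inv_into UNIV (blinfun_apply T)) \<otimes>\<^bsub>GL_space\<^esub> T = \<one>\<^bsub>GL_space\<^esub>"
      using T by (auto intro!: blinfun_eqI simp: inv bij_def inv_f_f)
  qed
  show "S \<otimes>\<^bsub>GL_space\<^esub> T \<in> carrier GL_space" if "S \<in> carrier GL_space"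
  proof -
    have "blinfun_apply (S o\<^sub>L T) = blinfun_apply S \<circ> blinfun_apply T" by auto
    then show ?thesis using that T by (simp add: bij_comp)
  qed
  show "S \<otimes>\<^bsub>GL_space\<^esub> T \<otimes>\<^bsub>GL_space\<^esub> U = S \<otimes>\<^bsub>GL_space\<^esub> (T \<otimes>\<^bsub>GL_space\<^esub> U)"
    by (simp add: blinfun_compose_assoc)
  show "\<one>\<^bsub>GL_space\<^esub> \<otimes>\<^bsub>GL_space\<^esub> T = T" by simp
qed

section \<open>Smoothness of affine and bilinear maps\<close>

lemma Ck_on_const: "Ck_on k (\<lambda>_. c) U"
  by (induction k arbitrary: c) (simp_all add: frechet_derivative_const)

text \<open>Every first directional derivative is constant in the base point, which settles all
  higher orders.\<close>

lemma Ck_on_affine: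
  assumes "bounded_linear f"
  shows "Ck_on k (\<lambda>x. f x + c) U"
proof (cases k)
  case 0
  then show ?thesis
    using assms by (simp add: linear_continuous_on continuous_on_add)
next
  case (Suc m)
  have D: "((\<lambda>x. f x + c) has_derivative f) (at x)" for x
    using bounded_linear_imp_has_derivative[OF assms] by (auto intro!: derivative_eq_intros)
  then have "frechet_derivative (\<lambda>x. f x + c) (at x) = f" for x
    using frechet_derivative_at by metis
  then show ?thesis using D Ck_on_const Suc by (auto simp: differentiable_def)
qed

text \<open>A directional derivative of a bilinear map is linear in the base point, which reduces
  the higher orders to the affine case.\<close>

lemma Ck_on_bilinear:
  assumes B: "bounded_bilinear B"
  shows "Ck_on k (\<lambda>z. B (fst z) (snd z)) U"
proof (cases k)
  case 0
  then show ?thesis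
    by (auto intro!: bounded_bilinear.continuous_on[OF B] continuous_intros)
next
  case (Suc m)
  have D: "((\<lambda>z. B (fst z) (snd z)) has_derivative (\<lambda>v. B (fst z) (snd v) + B (fst v) (snd z))) (at z)" for z
    by (intro bounded_bilinear.FDERIV[OF B] bounded_linear_imp_has_derivative bounded_linear_fst bounded_linear_snd)
  have F: "frechet_derivative (\<lambda>z. B (fst z) (snd z)) (at z) = (\<lambda>v. B (fst z) (snd v) + B (fst v) (snd z))" for z
    by (rule frechet_derivative_at[OF D, symmetric])
  have "bounded_linear (\<lambda>z. B (fst z) (snd v) + B (fst v) (snd z))" for v
  proof (rule bounded_linear_add)
    show "bounded_linear (\<lambda>z. B (fst z) (snd v))"
      by (rule bounded_linear_compose[of "\<lambda>a. B a (snd v)" fst])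
        (rule bounded_bilinear.bounded_linear_left[OF B], rule bounded_linear_fst)
    show "bounded_linear (\<lambda>z. B (fst v) (snd z))"
      by (rule bounded_linear_compose[of "B (fst v)" snd])
        (rule bounded_bilinear.bounded_linear_right[OF B], rule bounded_linear_snd)
  qed
  from Ck_on_affine[OF this, where c = 0] have "Ck_on m (\<lambda>z. B (fst z) (snd v) + B (fst v) (snd z)) U" for v
    by simp
  moreover have "(\<lambda>z. B (fst z) (snd z)) differentiable (at z)" for z
    using D unfolding differentiable_def by blast
  ultimately show ?thesis using Suc by (simp add: F)
qed

text \<open>The hypothesis on \<open>W\<close> says that \<open>N\<close> is open in \<open>N P\<close>, so the component in \<open>P\<close> is a
  locally constant function on \<open>N P\<close>.\<close>

lemma lie_isomorphic_internal_semidirect_product: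
  fixes N P :: "('v::euclidean_space \<Rightarrow>\<^sub>L 'v) set"
  assumes N: "subgroup N GL_space" and P: "subgroup P GL_space"
    and norm: "\<And>p n. p \<in> P \<Longrightarrow> n \<in> N \<Longrightarrow> p o\<^sub>L n o\<^sub>L inv\<^bsub>GL_space\<^esub> p \<in> N"
    and triv: "N \<inter> P \<subseteq> {id_blinfun}"
    and \<phi>: "\<And>p n. p \<in> P \<Longrightarrow> n \<in> N \<Longrightarrow> \<phi> p n = p o\<^sub>L n o\<^sub>L inv\<^bsub>GL_space\<^esub> p"
    and H: "H = {n o\<^sub>L p | n p. n \<in> N \<and> p \<in> P}"
    and W: "open W" "id_blinfun \<in> W" "W \<inter> H \<subseteq> N"
  shows "lie_isomorphic (GL_space\<lparr>carrier := H\<rparr>)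
    (semidirect_product (GL_space\<lparr>carrier := N\<rparr>) (GL_space\<lparr>carrier := P\<rparr>) \<phi>)"
proof -
  interpret GL: Group.group "GL_space :: ('v \<Rightarrow>\<^sub>L 'v) monoid" by (rule group_GL_space)
  let ?k = "\<lambda>(n, p). n o\<^sub>L p :: 'v \<Rightarrow>\<^sub>L 'v" and ?S = "semidirect_product (GL_space\<lparr>carrier := N\<rparr>) (GL_space\<lparr>carrier := P\<rparr>) \<phi>"
  let ?h = "inv_into (N \<times> P) ?k"
  have Hk: "H = ?k ` (N \<times> P)" unfolding H by auto
  note isp = internal_semidirect_product[OF group_GL_space N P, of \<phi>, simplified GL_space_simps, OF norm triv \<phi>, folded Hk]
  have carrier_S: "carrier ?S = N \<times> P" by (simp add: semidirect_product_def)
  have bij: "bij_betw ?k (N \<times> P) H" using isp(1) Hk by (simp add: bij_betw_def)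
  have hk: "?h (n o\<^sub>L p) = (n, p)" if "n \<in> N" "p \<in> P" for n p
    using inv_into_f_f[OF isp(1), of "(n, p)"] that by simp
  have "smooth_map_on ?h H"
    unfolding smooth_map_on_def
  proof
    fix T0 assume T0: "T0 \<in> H"
    then obtain n0 p0 where np: "n0 \<in> N" "p0 \<in> P" "T0 = n0 o\<^sub>L p0" unfolding H by blast
    have GL0: "T0 \<in> carrier GL_space" "p0 \<in> carrier GL_space" "n0 \<in> carrier GL_space"
      using np subgroup.mem_carrier[OF N np(1)] subgroup.mem_carrier[OF P np(2)]
        GL.m_closed[of n0 p0] by simp_all
    define S0 q0 where "S0 = inv\<^bsub>GL_space\<^esub> T0" and "q0 = inv\<^bsub>GL_space\<^esub> p0"
    have inv: "T0 o\<^sub>L S0 = id_blinfun" "S0 o\<^sub>L T0 = id_blinfun" "p0 o\<^sub>L q0 = id_blinfun"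
      unfolding S0_def q0_def using GL.r_inv[OF GL0(1)] GL.l_inv[OF GL0(1)] GL.r_inv[OF GL0(2)] by simp_all
    have S0: "S0 \<in> H"
      unfolding S0_def by (rule subgroup.m_inv_closed[OF isp(2) T0])
    \<comment> \<open>For \<open>T \<in> H\<close> near \<open>T0\<close>, the quotient
      \<open>T o\<^sub>L S0\<close> lies in \<open>W\<close> and hence in \<open>N\<close>, so
      \<open>T\<close> has the same component \<open>p0\<close> in \<open>P\<close> as
      \<open>T0\<close>. Locally the decomposition is thus the affine map sending \<open>T\<close>
      to \<open>(T o\<^sub>L q0, p0)\<close>.\<close>
    let ?U = "(\<lambda>T. T o\<^sub>L S0) -` W" and ?F = "\<lambda>T. (T o\<^sub>L q0, 0) + (0, p0)"
    have "continuous_on UNIV (\<lambda>T. T o\<^sub>L S0)" by (intro continuous_intros)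
    then have "open ?U" by (rule open_vimage[OF W(1)])
    moreover have "T0 \<in> ?U" using W(2) inv by simp
    moreover have "Ck_on k ?F ?U" for k
      by (intro Ck_on_affine bounded_linear_Pair bounded_linear_zero
          bounded_bilinear.bounded_linear_left[OF bounded_bilinear_blinfun_compose])
    moreover have "?F T = ?h T" if T: "T \<in> H \<inter> ?U" for T
    proof -
      have "T o\<^sub>L S0 \<in> H" using subgroup.m_closed[OF isp(2) _ S0] T by simp
      then have n: "T o\<^sub>L S0 \<in> N" using T W(3) by blast
      then have n': "(T o\<^sub>L S0) o\<^sub>L n0 \<in> N" using subgroup.m_closed[OF N _ np(1)] by simp
      have "T = (T o\<^sub>L S0) o\<^sub>L T0" using inv(2) by (simp add: blinfun_compose_assoc)
      also have "\<dots> = ((T o\<^sub>L S0) o\<^sub>L n0) o\<^sub>L p0" unfolding np(3) by (simp add: blinfun_compose_assoc)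
      finally have eq: "T = ((T o\<^sub>L S0) o\<^sub>L n0) o\<^sub>L p0" .
      then have "?h T = ((T o\<^sub>L S0) o\<^sub>L n0, p0)" using hk[OF n' np(2)] by simp
      moreover have "T o\<^sub>L q0 = (T o\<^sub>L S0) o\<^sub>L n0"
        by (subst eq) (simp add: blinfun_compose_assoc inv(3))
      ultimately show ?thesis by simp
    qed
    ultimately show "\<exists>U F. open U \<and> T0 \<in> U \<and> (\<forall>k. Ck_on k F U) \<and> (\<forall>T\<in>H \<inter> U. F T = ?h T)"
      by (intro exI[of _ ?U] exI[of _ ?F]) blast
  qed
  moreover have "smooth_map_on (inv_into H ?h) (N \<times> P)"
    unfolding smooth_map_on_def
  proof
    fix z assume "z \<in> N \<times> P"
    \<comment> \<open>The inverse of \<open>?h\<close> is the product map, the restriction of a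
      bilinear map defined everywhere.\<close>
    have "Ck_on k (\<lambda>z. fst z o\<^sub>L snd z) UNIV" for k :: nat
      by (rule Ck_on_bilinear[OF bounded_bilinear_blinfun_compose])
    moreover have "fst x o\<^sub>L snd x = inv_into H ?h x" if "x \<in> N \<times> P" for x
      using inv_into_inv_into_eq[OF bij that] by (simp add: case_prod_beta)
    ultimately show "\<exists>U F. open U \<and> z \<in> U \<and> (\<forall>k. Ck_on k F U) \<and> (\<forall>x\<in>N \<times> P \<inter> U. F x = inv_into H ?h x)"
      by (intro exI[of _ UNIV] exI[of _ "\<lambda>z. fst z o\<^sub>L snd z"]) auto
  qed
  ultimately show ?thesis
    unfolding lie_isomorphic_def using GL.subgroup_imp_group[OF isp(2)] isp(3,4) carrier_S by auto
qed

section \<open>Invertible and orthogonal matrices\<close>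

lemma GL_matE:
  assumes "A \<in> GL_mat n"
  obtains B where "B \<in> GL_mat n" "A * B = 1\<^sub>m n" "B * A = 1\<^sub>m n"
proof -
  from assms obtain B where A: "A \<in> carrier_mat n n" and AB: "A * B = 1\<^sub>m n" and BA: "B * A = 1\<^sub>m (dim_row B)"
    unfolding GL_mat_def invertible_mat_def inverts_mat_def by auto
  have "dim_col B = n" using arg_cong[OF AB, of dim_col] by simp
  moreover have "dim_row B = n" using arg_cong[OF BA, of dim_col] A by simp
  ultimately have B: "B \<in> carrier_mat n n" by auto
  then have "B \<in> GL_mat n"
    using A AB BA unfolding GL_mat_def invertible_mat_def inverts_mat_def by auto
  then show ?thesis using that AB BA B by simp
qed

lemma GL_mat_mult_vec_eq_0:
  assumes "A \<in> GL_mat n" "v \<in> carrier_vec n" "A *\<^sub>v v = 0\<^sub>v n"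
  shows "v = 0\<^sub>v n"
proof -
  obtain B where B: "B \<in> GL_mat n" "B * A = 1\<^sub>m n" using GL_matE[OF assms(1)] by blast
  have c: "A \<in> carrier_mat n n" "B \<in> carrier_mat n n" using assms(1) B(1) by (auto simp: GL_mat_def)
  have "v = (B * A) *\<^sub>v v" using B(2) assms(2) by simp
  also have "\<dots> = B *\<^sub>v (A *\<^sub>v v)" using c assms(2) by simp
  also have "\<dots> = 0\<^sub>v n" using c assms(3) mult_mat_vec_zero by simp
  finally show ?thesis .
qed

lemma GL_mat_mult: "A \<in> GL_mat n \<Longrightarrow> B \<in> GL_mat n \<Longrightarrow> A * B \<in> GL_mat n"
proof (rule GL_matI)
  assume *: "A \<in> GL_mat n" "B \<in> GL_mat n"
  then have c: "A \<in> carrier_mat n n" "B \<in> carrier_mat n n" by (auto simp: GL_mat_def)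
  then show "A * B \<in> carrier_mat n n" by simp
  fix v :: "real Matrix.vec" assume v: "v \<in> carrier_vec n" "A * B *\<^sub>v v = 0\<^sub>v n"
  then have "A *\<^sub>v (B *\<^sub>v v) = 0\<^sub>v n" using c by simp
  then have "B *\<^sub>v v = 0\<^sub>v n"
    by (rule GL_mat_mult_vec_eq_0[OF *(1) mult_mat_vec_carrier[OF c(2) v(1)]])
  then show "v = 0\<^sub>v n" by (rule GL_mat_mult_vec_eq_0[OF *(2) v(1)])
qed

lemma O_mat_scalar_prod:
  assumes A: "A \<in> O_mat n" and u: "u \<in> carrier_vec n" and v: "v \<in> carrier_vec n"
  shows "scalar_prod (A *\<^sub>v u) (A *\<^sub>v v) = scalar_prod u v"
proof -
  have c: "A \<in> carrier_mat n n" "transpose_mat A * A = 1\<^sub>m n" using A by (auto simp: O_mat_def)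
  have "scalar_prod (A *\<^sub>v u) (A *\<^sub>v v) = scalar_prod (transpose_mat A *\<^sub>v (A *\<^sub>v u)) v"
    using transpose_vec_mult_scalar[OF c(1) v, of "A *\<^sub>v u"] c(1) u by simp
  also have "transpose_mat A *\<^sub>v (A *\<^sub>v u) = (transpose_mat A * A) *\<^sub>v u"
    using c(1) u by (intro assoc_mult_mat_vec[symmetric]) auto
  finally show ?thesis using c(2) u by simp
qed

lemma O_mat_subset_GL_mat: "O_mat n \<subseteq> GL_mat n"
proof
  fix A assume A: "A \<in> O_mat n"
  show "A \<in> GL_mat n"
  proof (rule GL_matI)
    show "A \<in> carrier_mat n n" using A by (simp add: O_mat_def)
    fix v :: "real Matrix.vec" assume v: "v \<in> carrier_vec n" "A *\<^sub>v v = 0\<^sub>v n"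
    then have "scalar_prod v v = 0" using O_mat_scalar_prod[OF A v(1) v(1)] by simp
    then show "v = 0\<^sub>v n" using scalar_prod_self_pos[OF v(1)] by auto
  qed
qed

lemma O_matI:
  assumes A: "A \<in> carrier_mat n n"
    and pres: "\<And>u v. u \<in> carrier_vec n \<Longrightarrow> v \<in> carrier_vec n \<Longrightarrow>
      scalar_prod (A *\<^sub>v u) (A *\<^sub>v v) = scalar_prod u v"
  shows "A \<in> O_mat n"
proof -
  have col: "A *\<^sub>v unit_vec n i = col A i" if "i < n" for i
    using A that by (intro eq_vecI) (auto simp: scalar_prod_right_unit)
  have "transpose_mat A * A = 1\<^sub>m n"
  proof (rule eq_matI)
    fix i j assume "i < dim_row (1\<^sub>m n :: real mat)" "j < dim_col (1\<^sub>m n :: real mat)"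
    then have ij: "i < n" "j < n" by simp_all
    have "scalar_prod (col A i) (col A j) = (scalar_prod (unit_vec n i) (unit_vec n j) :: real)"
      using pres[of "unit_vec n i" "unit_vec n j"] col ij by simp
    then show "index_mat (transpose_mat A * A) (i, j) = index_mat (1\<^sub>m n) (i, j)"
      using A ij by simp
  qed (use A in auto)
  then show ?thesis using A by (simp add: O_mat_def)
qed

section \<open>The groups of tensor products and of permutations\<close>

context tensor_product
begin

text \<open>The range is a subspace containing all decomposable vectors, which span; in finite
  dimension surjectivity then gives injectivity.\<close>

lemma bij_if_onto_decomposable:
  fixes T :: "'v \<Rightarrow>\<^sub>L 'v"
  assumes "\<And>y. y \<in> tuples l d \<Longrightarrow> \<exists>x\<in>tuples l d. T (\<tau> x) = \<tau> y"
  shows "bij (blinfun_apply T)"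
proof -
  have lin: "linear (blinfun_apply T)" by (intro bounded_linear.linear blinfun.bounded_linear_right)
  have "\<tau> ` tuples l d \<subseteq> range (blinfun_apply T)" using assms by (metis image_subsetI rangeI)
  moreover have "subspace (range (blinfun_apply T))"
    by (rule linear_subspace_image[OF lin subspace_UNIV])
  ultimately have "span (\<tau> ` tuples l d) \<subseteq> range (blinfun_apply T)" by (rule span_minimal)
  then have "surj (blinfun_apply T)" using span_tau by auto
  then show ?thesis using linear_surjective_imp_injective[OF lin] by (simp add: bij_def)
qed

text \<open>Both sides are linear in each argument, so equality passes from decomposable vectors to
  all vectors, one argument at a time.\<close>

lemma orthogonal_if_preserves_inner_tau:
  fixes T :: "'v \<Rightarrow>\<^sub>L 'v"
  assumes "\<And>x y. x \<in> tuples l d \<Longrightarrow> y \<in> tuples l d \<Longrightarrow> inner (T (\<tau> x)) (T (\<tau> y)) = inner (\<tau> x) (\<tau> y)"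
  shows "orthogonal_transformation (blinfun_apply T)"
proof -
  have lin: "linear (blinfun_apply T)" by (intro bounded_linear.linear blinfun.bounded_linear_right)
  have linl: "linear (\<lambda>v. inner (T v) w)" and linr: "linear (\<lambda>v. inner w (T v))"
    and lin': "linear (\<lambda>v. inner v w)" "linear (inner w)" for w
    by (rule linearI; simp add: blinfun.add_right blinfun.scaleR_right inner_add_left inner_add_right)+
  have 1: "(\<lambda>v. inner (T v) (T (\<tau> y))) = (\<lambda>v. inner v (\<tau> y))" if "y \<in> tuples l d" for y
    using assms that by (intro functionals_eqI linl lin')
  have "(\<lambda>w. inner (T v) (T w)) = inner v" for v
    using fun_cong[OF 1] by (intro functionals_eqI linr lin')
  then show ?thesis using lin unfolding orthogonal_transformation_def by metis
qed

lemma permuted_tuple: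
  assumes "\<sigma> permutes {1..l}" "\<forall>i\<in>{1..l}. d (\<sigma> i) = d i" "x \<in> tuples l d"
  shows "(\<lambda>i\<in>{1..l}. x (\<sigma> i)) \<in> tuples l d"
  using assms(2) tuples_carrier[OF assms(3)] permutes_in_image[OF assms(1)]
  by (intro restrict_tuples) metis

lemma dim_inv_permutation:
  assumes "\<sigma> permutes {1..l}" "\<forall>i\<in>{1..l}. d (\<sigma> i) = d i"
  shows "\<forall>i\<in>{1..l}. d (inv_into UNIV \<sigma> i) = d i"
  using assms by (metis permutes_in_image permutes_inv permutes_inverses(1))

lemma restrict_mult_tuple:
  assumes "\<forall>i\<in>{1..l}. A i \<in> GL_mat (d i)" "x \<in> tuples l d"
  shows "(\<lambda>i\<in>{1..l}. A i *\<^sub>v x i) \<in> tuples l d"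
  using assms tuples_carrier[OF assms(2)]
  by (intro restrict_tuples mult_mat_vec_carrier) (auto simp: GL_mat_def)

lemma mem_tensor_GL: "T \<in> carrier (tensor_GL l d \<tau>) \<longleftrightarrow>
    (\<exists>A. (\<forall>i\<in>{1..l}. A i \<in> GL_mat (d i)) \<and>
      (\<forall>x\<in>tuples l d. T (\<tau> x) = \<tau> (\<lambda>i\<in>{1..l}. A i *\<^sub>v x i)))"
  and mem_tensor_O: "T \<in> carrier (tensor_O l d \<tau>) \<longleftrightarrow>
    (\<exists>A. (\<forall>i\<in>{1..l}. A i \<in> O_mat (d i)) \<and>
      (\<forall>x\<in>tuples l d. T (\<tau> x) = \<tau> (\<lambda>i\<in>{1..l}. A i *\<^sub>v x i)))"
  and mem_perm_group: "T \<in> carrier (perm_group l d \<tau>) \<longleftrightarrow>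
    (\<exists>\<sigma>. \<sigma> permutes {1..l} \<and> (\<forall>i\<in>{1..l}. d (\<sigma> i) = d i) \<and>
      (\<forall>x\<in>tuples l d. T (\<tau> x) = \<tau> (\<lambda>i\<in>{1..l}. x (\<sigma> i))))"
  for T :: "'v \<Rightarrow>\<^sub>L 'v"
  by (simp_all add: tensor_GL_def tensor_O_def perm_group_def is_tensor_of_maps_def)

lemma tensor_GLE:
  fixes T :: "'v \<Rightarrow>\<^sub>L 'v"
  assumes "T \<in> carrier (tensor_GL l d \<tau>)"
  obtains A where "\<forall>i\<in>{1..l}. A i \<in> GL_mat (d i)"
    "\<forall>x\<in>tuples l d. T (\<tau> x) = \<tau> (\<lambda>i\<in>{1..l}. A i *\<^sub>v x i)"
  using assms unfolding mem_tensor_GL by blast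

lemma tensor_GLI:
  fixes T :: "'v \<Rightarrow>\<^sub>L 'v"
  assumes "\<forall>i\<in>{1..l}. A i \<in> GL_mat (d i)"
    "\<And>x. x \<in> tuples l d \<Longrightarrow> T (\<tau> x) = \<tau> (\<lambda>i\<in>{1..l}. A i *\<^sub>v x i)"
  shows "T \<in> carrier (tensor_GL l d \<tau>)"
  using assms unfolding mem_tensor_GL by blast

lemma perm_groupE:
  fixes T :: "'v \<Rightarrow>\<^sub>L 'v"
  assumes "T \<in> carrier (perm_group l d \<tau>)"
  obtains \<sigma> where "\<sigma> permutes {1..l}" "\<forall>i\<in>{1..l}. d (\<sigma> i) = d i"
    "\<forall>x\<in>tuples l d. T (\<tau> x) = \<tau> (\<lambda>i\<in>{1..l}. x (\<sigma> i))"
  using assms unfolding mem_perm_group by blast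

lemma perm_groupI:
  fixes T :: "'v \<Rightarrow>\<^sub>L 'v"
  assumes "\<sigma> permutes {1..l}" "\<forall>i\<in>{1..l}. d (\<sigma> i) = d i"
    "\<And>x. x \<in> tuples l d \<Longrightarrow> T (\<tau> x) = \<tau> (\<lambda>i\<in>{1..l}. x (\<sigma> i))"
  shows "T \<in> carrier (perm_group l d \<tau>)"
  using assms unfolding mem_perm_group by blast

lemma inverse_apply:
  fixes T :: "'v \<Rightarrow>\<^sub>L 'v"
  assumes "bij (blinfun_apply T)" "T v = w"
  shows "(inv\<^bsub>GL_space\<^esub> T) w = v"
proof -
  have "inv\<^bsub>GL_space\<^esub> T o\<^sub>L T = id_blinfun"
    using Group.group.l_inv[OF group_GL_space, of T] assms(1) by simp
  then show ?thesis using assms(2) by (metis blinfun_apply_blinfun_compose blinfun_apply_id_blinfun id_apply)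
qed

section \<open>The group of tensor products of invertible maps\<close>

lemma tensor_GL_bij:
  fixes T :: "'v \<Rightarrow>\<^sub>L 'v"
  assumes "T \<in> carrier (tensor_GL l d \<tau>)"
  shows "bij (blinfun_apply T)"
    and "\<exists>B. (\<forall>i\<in>{1..l}. B i \<in> GL_mat (d i)) \<and>
      (\<forall>x\<in>tuples l d. (inv\<^bsub>GL_space\<^esub> T) (\<tau> x) = \<tau> (\<lambda>i\<in>{1..l}. B i *\<^sub>v x i))"
proof -
  from assms obtain A where A: "\<forall>i\<in>{1..l}. A i \<in> GL_mat (d i)"
    and T: "\<forall>x\<in>tuples l d. T (\<tau> x) = \<tau> (\<lambda>i\<in>{1..l}. A i *\<^sub>v x i)" by (rule tensor_GLE) blast
  have "\<forall>i\<in>{1..l}. \<exists>B\<in>GL_mat (d i). A i * B = 1\<^sub>m (d i)" using GL_matE A by metis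
  then obtain B where B: "\<forall>i\<in>{1..l}. B i \<in> GL_mat (d i)"
    and AB: "\<forall>i\<in>{1..l}. A i * B i = 1\<^sub>m (d i)" by metis
  have inv: "T (\<tau> (\<lambda>i\<in>{1..l}. B i *\<^sub>v x i)) = \<tau> x" if x: "x \<in> tuples l d" for x
  proof -
    have "A i *\<^sub>v (B i *\<^sub>v x i) = x i" if i: "i \<in> {1..l}" for i
    proof -
      have "A i *\<^sub>v (B i *\<^sub>v x i) = (A i * B i) *\<^sub>v x i"
        using bspec[OF A i] bspec[OF B i] tuples_carrier[OF x i]
        by (intro assoc_mult_mat_vec[symmetric]) (auto simp: GL_mat_def)
      then show ?thesis using bspec[OF AB i] tuples_carrier[OF x i] by simp
    qed
    then have "(\<lambda>i\<in>{1..l}. A i *\<^sub>v (\<lambda>i\<in>{1..l}. B i *\<^sub>v x i) i) = x"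
      using x by (intro tuples_ext[OF restrict_tuples x]) (auto simp: tuples_carrier)
    then show ?thesis using bspec[OF T restrict_mult_tuple[OF B x]] by simp
  qed
  show bij: "bij (blinfun_apply T)"
    using inv restrict_mult_tuple[OF B] by (intro bij_if_onto_decomposable) blast
  show "\<exists>B. (\<forall>i\<in>{1..l}. B i \<in> GL_mat (d i)) \<and>
      (\<forall>x\<in>tuples l d. (inv\<^bsub>GL_space\<^esub> T) (\<tau> x) = \<tau> (\<lambda>i\<in>{1..l}. B i *\<^sub>v x i))"
    using B inverse_apply[OF bij inv] by blast
qed

lemma subgroup_tensor_GL: "subgroup (carrier (tensor_GL l d \<tau>)) GL_space"
proof (rule Group.group.subgroupI[OF group_GL_space])
  show "carrier (tensor_GL l d \<tau>) \<subseteq> carrier GL_space" using tensor_GL_bij by auto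
  have "id_blinfun \<in> carrier (tensor_GL l d \<tau>)"
  proof (rule tensor_GLI)
    show "\<forall>i\<in>{1..l}. 1\<^sub>m (d i) \<in> GL_mat (d i)" by (intro ballI GL_matI) auto
    fix x assume x: "x \<in> tuples l d"
    have "(\<lambda>i\<in>{1..l}. 1\<^sub>m (d i) *\<^sub>v x i) = x"
      using tuples_carrier[OF x] by (intro tuples_ext[OF restrict_tuples x]) auto
    then show "id_blinfun (\<tau> x) = \<tau> (\<lambda>i\<in>{1..l}. 1\<^sub>m (d i) *\<^sub>v x i)" by simp
  qed
  then show "carrier (tensor_GL l d \<tau>) \<noteq> {}" by blast
next
  fix T assume "T \<in> carrier (tensor_GL l d \<tau>)"
  from tensor_GL_bij(2)[OF this] show "inv\<^bsub>GL_space\<^esub> T \<in> carrier (tensor_GL l d \<tau>)"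
    unfolding mem_tensor_GL .
next
  fix S T assume "S \<in> carrier (tensor_GL l d \<tau>)" "T \<in> carrier (tensor_GL l d \<tau>)"
  then obtain A B where A: "\<forall>i\<in>{1..l}. A i \<in> GL_mat (d i)"
    and S: "\<forall>x\<in>tuples l d. S (\<tau> x) = \<tau> (\<lambda>i\<in>{1..l}. A i *\<^sub>v x i)"
    and B: "\<forall>i\<in>{1..l}. B i \<in> GL_mat (d i)"
    and T: "\<forall>x\<in>tuples l d. T (\<tau> x) = \<tau> (\<lambda>i\<in>{1..l}. B i *\<^sub>v x i)"
    by (elim tensor_GLE) blast
  have "S o\<^sub>L T \<in> carrier (tensor_GL l d \<tau>)"
  proof (rule tensor_GLI)
    show "\<forall>i\<in>{1..l}. A i * B i \<in> GL_mat (d i)" using GL_mat_mult A B by blast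
    fix x assume x: "x \<in> tuples l d"
    have "(S o\<^sub>L T) (\<tau> x) = \<tau> (\<lambda>i\<in>{1..l}. A i *\<^sub>v (\<lambda>i\<in>{1..l}. B i *\<^sub>v x i) i)"
      using bspec[OF T x] bspec[OF S restrict_mult_tuple[OF B x]] by simp
    also have "(\<lambda>i\<in>{1..l}. A i *\<^sub>v (\<lambda>i\<in>{1..l}. B i *\<^sub>v x i) i) = (\<lambda>i\<in>{1..l}. (A i * B i) *\<^sub>v x i)"
    proof (rule restrict_ext)
      fix i assume i: "i \<in> {1..l}"
      then show "A i *\<^sub>v (\<lambda>i\<in>{1..l}. B i *\<^sub>v x i) i = (A i * B i) *\<^sub>v x i"
        using bspec[OF A i] bspec[OF B i] tuples_carrier[OF x i]
          assoc_mult_mat_vec[of "A i" "d i" "d i" "B i" "d i" "x i"] by (auto simp: GL_mat_def)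
    qed
    finally show "(S o\<^sub>L T) (\<tau> x) = \<tau> (\<lambda>i\<in>{1..l}. (A i * B i) *\<^sub>v x i)" .
  qed
  then show "S \<otimes>\<^bsub>GL_space\<^esub> T \<in> carrier (tensor_GL l d \<tau>)" by simp
qed

section \<open>The group of slot permutations\<close>

lemma permute_inverse:
  assumes "\<sigma> permutes {1..l}" "x \<in> tuples l d"
  shows "(\<lambda>i\<in>{1..l}. (\<lambda>i\<in>{1..l}. x (inv_into UNIV \<sigma> i)) (\<sigma> i)) = x"
    and "(\<lambda>i\<in>{1..l}. (\<lambda>i\<in>{1..l}. x (\<sigma> i)) (inv_into UNIV \<sigma> i)) = x"
proof -
  have x: "x \<in> extensional {1..l}" using assms(2) unfolding tuples_def by (simp add: PiE_iff)
  have \<sigma>: "\<sigma> i \<in> {1..l}" "inv_into UNIV \<sigma> i \<in> {1..l}" if "i \<in> {1..l}" for i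
    using that permutes_in_image[OF assms(1)] permutes_in_image[OF permutes_inv[OF assms(1)]] by blast+
  show "(\<lambda>i\<in>{1..l}. (\<lambda>i\<in>{1..l}. x (inv_into UNIV \<sigma> i)) (\<sigma> i)) = x"
    by (rule extensionalityI[OF restrict_extensional x])
      (simp only: \<sigma> restrict_apply if_True permutes_inverses[OF assms(1)])
  show "(\<lambda>i\<in>{1..l}. (\<lambda>i\<in>{1..l}. x (\<sigma> i)) (inv_into UNIV \<sigma> i)) = x"
    by (rule extensionalityI[OF restrict_extensional x])
      (simp only: \<sigma> restrict_apply if_True permutes_inverses[OF assms(1)])
qed

lemma perm_bij:
  fixes T :: "'v \<Rightarrow>\<^sub>L 'v"
  assumes \<sigma>: "\<sigma> permutes {1..l}" "\<forall>i\<in>{1..l}. d (\<sigma> i) = d i"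
    and T: "\<forall>x\<in>tuples l d. T (\<tau> x) = \<tau> (\<lambda>i\<in>{1..l}. x (\<sigma> i))"
  shows "bij (blinfun_apply T)"
    and "x \<in> tuples l d \<Longrightarrow> (inv\<^bsub>GL_space\<^esub> T) (\<tau> x) = \<tau> (\<lambda>i\<in>{1..l}. x (inv_into UNIV \<sigma> i))"
proof -
  note \<sigma>' = permuted_tuple[OF permutes_inv[OF \<sigma>(1)] dim_inv_permutation[OF \<sigma>]]
  have inv: "T (\<tau> (\<lambda>i\<in>{1..l}. x (inv_into UNIV \<sigma> i))) = \<tau> x" if "x \<in> tuples l d" for x
    unfolding bspec[OF T \<sigma>'[OF that]] permute_inverse[OF \<sigma>(1) that] ..
  show bij: "bij (blinfun_apply T)" using \<sigma>' inv by (intro bij_if_onto_decomposable) blast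
  show "x \<in> tuples l d \<Longrightarrow> (inv\<^bsub>GL_space\<^esub> T) (\<tau> x) = \<tau> (\<lambda>i\<in>{1..l}. x (inv_into UNIV \<sigma> i))"
    by (rule inverse_apply[OF bij inv])
qed

lemma subgroup_perm_group: "subgroup (carrier (perm_group l d \<tau>)) GL_space"
proof (rule Group.group.subgroupI[OF group_GL_space])
  show "carrier (perm_group l d \<tau>) \<subseteq> carrier GL_space"
    using perm_bij(1) by (auto elim!: perm_groupE)
  have "id_blinfun \<in> carrier (perm_group l d \<tau>)"
  proof (rule perm_groupI[OF permutes_id])
    fix x assume "x \<in> tuples l d"
    then have "(\<lambda>i\<in>{1..l}. x (id i)) = x" by (auto simp: tuples_def PiE_iff extensional_def)
    then show "id_blinfun (\<tau> x) = \<tau> (\<lambda>i\<in>{1..l}. x (id i))" by simp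
  qed simp
  then show "carrier (perm_group l d \<tau>) \<noteq> {}" by blast
next
  fix T assume "T \<in> carrier (perm_group l d \<tau>)"
  then obtain \<sigma> where \<sigma>: "\<sigma> permutes {1..l}" "\<forall>i\<in>{1..l}. d (\<sigma> i) = d i"
    and T: "\<forall>x\<in>tuples l d. T (\<tau> x) = \<tau> (\<lambda>i\<in>{1..l}. x (\<sigma> i))" by (rule perm_groupE) blast
  show "inv\<^bsub>GL_space\<^esub> T \<in> carrier (perm_group l d \<tau>)"
    by (rule perm_groupI[OF permutes_inv[OF \<sigma>(1)] dim_inv_permutation[OF \<sigma>]])
      (rule perm_bij(2)[OF \<sigma> T])
next
  fix S T assume "S \<in> carrier (perm_group l d \<tau>)" "T \<in> carrier (perm_group l d \<tau>)"
  then obtain \<sigma> \<rho> where \<sigma>: "\<sigma> permutes {1..l}" "\<forall>i\<in>{1..l}. d (\<sigma> i) = d i"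
    and S: "\<forall>x\<in>tuples l d. S (\<tau> x) = \<tau> (\<lambda>i\<in>{1..l}. x (\<sigma> i))"
    and \<rho>: "\<rho> permutes {1..l}" "\<forall>i\<in>{1..l}. d (\<rho> i) = d i"
    and T: "\<forall>x\<in>tuples l d. T (\<tau> x) = \<tau> (\<lambda>i\<in>{1..l}. x (\<rho> i))"
    by (elim perm_groupE) blast
  have in\<sigma>: "\<sigma> i \<in> {1..l}" if "i \<in> {1..l}" for i using \<sigma>(1) that permutes_in_image by metis
  have "S o\<^sub>L T \<in> carrier (perm_group l d \<tau>)"
  proof (rule perm_groupI)
    \<comment> \<open>The order is reversed: tuples are precomposed with the permutation, so
      applying \<open>\<rho>\<close> first and \<open>\<sigma>\<close> second yields
      \<open>x \<circ> (\<rho> \<circ> \<sigma>)\<close>.\<close>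
    show "\<rho> \<circ> \<sigma> permutes {1..l}" by (rule permutes_compose[OF \<sigma>(1) \<rho>(1)])
    show "\<forall>i\<in>{1..l}. d ((\<rho> \<circ> \<sigma>) i) = d i" using \<sigma>(2) \<rho>(2) in\<sigma> by simp
    fix x assume x: "x \<in> tuples l d"
    have "(\<lambda>i\<in>{1..l}. (\<lambda>i\<in>{1..l}. x (\<rho> i)) (\<sigma> i)) = (\<lambda>i\<in>{1..l}. x ((\<rho> \<circ> \<sigma>) i))"
      by (rule restrict_ext) (simp only: in\<sigma> restrict_apply if_True comp_apply)
    then show "(S o\<^sub>L T) (\<tau> x) = \<tau> (\<lambda>i\<in>{1..l}. x ((\<rho> \<circ> \<sigma>) i))"
      using bspec[OF T x] bspec[OF S permuted_tuple[OF \<rho> x]] by simp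
  qed
  then show "S \<otimes>\<^bsub>GL_space\<^esub> T \<in> carrier (perm_group l d \<tau>)" by simp
qed

lemma perm_group_orthogonal:
  fixes T :: "'v \<Rightarrow>\<^sub>L 'v"
  assumes "T \<in> carrier (perm_group l d \<tau>)"
  shows "orthogonal_transformation (blinfun_apply T)"
proof -
  from assms obtain \<sigma> where \<sigma>: "\<sigma> permutes {1..l}" "\<forall>i\<in>{1..l}. d (\<sigma> i) = d i"
    and T: "\<forall>x\<in>tuples l d. T (\<tau> x) = \<tau> (\<lambda>i\<in>{1..l}. x (\<sigma> i))" by (rule perm_groupE) blast
  show ?thesis
  proof (rule orthogonal_if_preserves_inner_tau)
    fix x y assume xy: "x \<in> tuples l d" "y \<in> tuples l d"
    have "inner (T (\<tau> x)) (T (\<tau> y)) = (\<Prod>i\<in>{1..l}. scalar_prod (x (\<sigma> i)) (y (\<sigma> i)))"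
      unfolding bspec[OF T xy(1)] bspec[OF T xy(2)]
        inner_tau[OF permuted_tuple[OF \<sigma> xy(1)] permuted_tuple[OF \<sigma> xy(2)]]
      by (intro prod.cong) simp_all
    also have "\<dots> = (\<Prod>i\<in>{1..l}. scalar_prod (x i) (y i))"
      by (rule prod.reindex_bij_betw[OF permutes_imp_bij[OF \<sigma>(1)]])
    finally show "inner (T (\<tau> x)) (T (\<tau> y)) = inner (\<tau> x) (\<tau> y)" using inner_tau[OF xy] by simp
  qed
qed

text \<open>The permuted tensor is multilinear in \<open>x\<close>, slot \<open>i\<close>
  reappearing as slot \<open>inv_into UNIV \<sigma> i\<close>, so the universal property provides
  \<open>U\<close>.\<close>

lemma ex_perm_group:
  assumes \<sigma>: "\<sigma> permutes {1..l}" "\<forall>i\<in>{1..l}. d (\<sigma> i) = d i"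
  obtains U :: "'v \<Rightarrow>\<^sub>L 'v" where "U \<in> carrier (perm_group l d \<tau>)"
    "\<forall>x\<in>tuples l d. U (\<tau> x) = \<tau> (\<lambda>i\<in>{1..l}. x (\<sigma> i))"
proof -
  have "multilinear_on_tuples l d (\<lambda>x. \<tau> (\<lambda>i\<in>{1..l}. x (\<sigma> i)))"
    unfolding multilinear_on_tuples_def
  proof (intro ballI allI)
    fix x i and u v :: "real Matrix.vec" and c
    assume x: "x \<in> tuples l d" and i: "i \<in> {1..l}" and uv: "u \<in> carrier_vec (d i)" "v \<in> carrier_vec (d i)"
    let ?j = "inv_into UNIV \<sigma> i"
    have j: "?j \<in> {1..l}" "d ?j = d i"
      using i permutes_in_image[OF permutes_inv[OF \<sigma>(1)]] bspec[OF dim_inv_permutation[OF \<sigma>] i] by auto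
    have "(\<lambda>k\<in>{1..l}. (x(i := w)) (\<sigma> k)) = (\<lambda>k\<in>{1..l}. x (\<sigma> k))(?j := w)" for w
    proof
      fix k
      have "\<sigma> k = i \<longleftrightarrow> k = ?j" using permutes_inverses[OF \<sigma>(1)] by metis
      then show "(\<lambda>k\<in>{1..l}. (x(i := w)) (\<sigma> k)) k = ((\<lambda>k\<in>{1..l}. x (\<sigma> k))(?j := w)) k"
        using j(1) by (cases "k = ?j") simp_all
    qed
    then show "\<tau> (\<lambda>k\<in>{1..l}. (x(i := u + v)) (\<sigma> k)) =
        \<tau> (\<lambda>k\<in>{1..l}. (x(i := u)) (\<sigma> k)) + \<tau> (\<lambda>k\<in>{1..l}. (x(i := v)) (\<sigma> k)) \<and>
      \<tau> (\<lambda>k\<in>{1..l}. (x(i := c \<cdot>\<^sub>v u)) (\<sigma> k)) = c *\<^sub>R \<tau> (\<lambda>k\<in>{1..l}. (x(i := u)) (\<sigma> k))"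
      using tau_add[OF permuted_tuple[OF \<sigma> x] j(1)] tau_smult[OF permuted_tuple[OF \<sigma> x] j(1)] uv j(2)
      by (simp only:)
  qed
  then obtain U :: "'v \<Rightarrow>\<^sub>L 'v" where "\<forall>x\<in>tuples l d. U (\<tau> x) = \<tau> (\<lambda>i\<in>{1..l}. x (\<sigma> i))"
    by (rule ex_blinfun) blast
  then show ?thesis using that perm_groupI[OF \<sigma>] by blast
qed

section \<open>Interaction of the two groups\<close>

text \<open>Conjugation by a slot permutation relabels the factors: slot \<open>i\<close> receives
  \<open>A (\<sigma> i)\<close>, which has the right size because
  \<open>d (\<sigma> i) = d i\<close>.\<close>

lemma perm_group_normalizes_tensor_GL:
  fixes n p :: "'v \<Rightarrow>\<^sub>L 'v"
  assumes "p \<in> carrier (perm_group l d \<tau>)" "n \<in> carrier (tensor_GL l d \<tau>)"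
  shows "p o\<^sub>L n o\<^sub>L inv\<^bsub>GL_space\<^esub> p \<in> carrier (tensor_GL l d \<tau>)"
proof -
  from assms(1) obtain \<sigma> where \<sigma>: "\<sigma> permutes {1..l}" "\<forall>i\<in>{1..l}. d (\<sigma> i) = d i"
    and p: "\<forall>x\<in>tuples l d. p (\<tau> x) = \<tau> (\<lambda>i\<in>{1..l}. x (\<sigma> i))" by (rule perm_groupE) blast
  from assms(2) obtain A where A: "\<forall>i\<in>{1..l}. A i \<in> GL_mat (d i)"
    and n: "\<forall>x\<in>tuples l d. n (\<tau> x) = \<tau> (\<lambda>i\<in>{1..l}. A i *\<^sub>v x i)" by (rule tensor_GLE) blast
  have in\<sigma>: "\<sigma> i \<in> {1..l}" if "i \<in> {1..l}" for i using \<sigma>(1) that permutes_in_image by metis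
  show ?thesis
  proof (rule tensor_GLI)
    show "\<forall>i\<in>{1..l}. A (\<sigma> i) \<in> GL_mat (d i)" using A in\<sigma> \<sigma>(2) by metis
    fix x assume x: "x \<in> tuples l d"
    let ?y = "\<lambda>i\<in>{1..l}. x (inv_into UNIV \<sigma> i)"
    have y: "?y \<in> tuples l d"
      by (rule permuted_tuple[OF permutes_inv[OF \<sigma>(1)] dim_inv_permutation[OF \<sigma>] x])
    have "(p o\<^sub>L n o\<^sub>L inv\<^bsub>GL_space\<^esub> p) (\<tau> x) = \<tau> (\<lambda>i\<in>{1..l}. (\<lambda>i\<in>{1..l}. A i *\<^sub>v ?y i) (\<sigma> i))"
      using perm_bij(2)[OF \<sigma> p x] bspec[OF n y] bspec[OF p restrict_mult_tuple[OF A y]] by simp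
    also have "(\<lambda>i\<in>{1..l}. (\<lambda>i\<in>{1..l}. A i *\<^sub>v ?y i) (\<sigma> i)) = (\<lambda>i\<in>{1..l}. A (\<sigma> i) *\<^sub>v x i)"
      by (rule restrict_ext) (simp only: in\<sigma> restrict_apply if_True permutes_inverses(2)[OF \<sigma>(1)])
    finally show "(p o\<^sub>L n o\<^sub>L inv\<^bsub>GL_space\<^esub> p) (\<tau> x) = \<tau> (\<lambda>i\<in>{1..l}. A (\<sigma> i) *\<^sub>v x i)" .
  qed
qed

text \<open>For a slot \<open>j\<close> in range, this differs from \<open>unit_tuple\<close> in
  slot \<open>j\<close> only, and by another line there; the pair reveals which slot of an image
  depends on slot \<open>j\<close>.\<close>

definition unit_tuple' :: "nat \<Rightarrow> nat \<Rightarrow> real Matrix.vec" where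
  "unit_tuple' j = unit_tuple(j := unit_vec (d j) 1)"

lemma unit_tuple': "j \<in> {1..l} \<Longrightarrow> unit_tuple' j \<in> nonzero_tuples"
  unfolding unit_tuple'_def using two_le_dim[of j]
  by (intro nonzero_tuples_upd[OF unit_tuple]) auto

text \<open>Slot \<open>i\<close> of the image is determined by \<open>x i\<close> for a tensor
  product of maps, but by \<open>x (\<sigma> i)\<close> for a permutation. If
  \<open>\<sigma> i \<noteq> i\<close>, exchanging unit vectors in slot \<open>\<sigma> i\<close>
  leaves \<open>A i *\<^sub>v x i\<close> fixed, so two distinct unit vectors would be
  proportional.\<close>

lemma tensor_GL_Int_perm_group:
  "carrier (tensor_GL l d \<tau>) \<inter> carrier (perm_group l d \<tau>) \<subseteq> {id_blinfun}"
proof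
  fix T assume "T \<in> carrier (tensor_GL l d \<tau>) \<inter> carrier (perm_group l d \<tau>)"
  then have TN: "T \<in> carrier (tensor_GL l d \<tau>)" and TP: "T \<in> carrier (perm_group l d \<tau>)" by auto
  from TP obtain \<sigma> where \<sigma>: "\<sigma> permutes {1..l}" "\<forall>i\<in>{1..l}. d (\<sigma> i) = d i"
    and TP: "\<forall>x\<in>tuples l d. T (\<tau> x) = \<tau> (\<lambda>i\<in>{1..l}. x (\<sigma> i))" by (rule perm_groupE) blast
  from TN obtain A where A: "\<forall>i\<in>{1..l}. A i \<in> GL_mat (d i)"
    and TN: "\<forall>x\<in>tuples l d. T (\<tau> x) = \<tau> (\<lambda>i\<in>{1..l}. A i *\<^sub>v x i)" by (rule tensor_GLE) blast
  have in\<sigma>: "\<sigma> i \<in> {1..l}" if "i \<in> {1..l}" for i using \<sigma>(1) that permutes_in_image by metis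
  have propor: "proportional (A i *\<^sub>v x i) (x (\<sigma> i))" if x: "x \<in> nonzero_tuples" and i: "i \<in> {1..l}" for x i
  proof -
    note x' = nonzero_tuplesD(1)[OF x]
    let ?y = "\<lambda>i\<in>{1..l}. x (\<sigma> i)" and ?z = "\<lambda>i\<in>{1..l}. A i *\<^sub>v x i"
    have eq: "\<tau> ?z = 1 *\<^sub>R \<tau> ?y" using bspec[OF TP x'] bspec[OF TN x'] by simp
    have y: "?y \<in> nonzero_tuples"
      using nonzero_tuplesD(3)[OF x in\<sigma>] \<sigma>(2) by (intro nonzero_tuplesI permuted_tuple[OF \<sigma> x']) auto
    moreover have "?z \<in> nonzero_tuples"
      using eq y tau_eq_0_iff[OF permuted_tuple[OF \<sigma> x']] tau_eq_0_iff[OF restrict_mult_tuple[OF A x']] by simp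
    ultimately have "differing ?z ?y = {}" using scaleR_tau_proportional eq by blast
    then show ?thesis using i unfolding differing_def by force
  qed
  have \<sigma>_id: "\<sigma> i = i" if i: "i \<in> {1..l}" for i
  proof (rule ccontr)
    assume ne: "\<sigma> i \<noteq> i"
    let ?j = "\<sigma> i"
    have "proportional (A i *\<^sub>v unit_tuple i) (unit_vec (d ?j) 0)"
      using propor[OF unit_tuple i] in\<sigma>[OF i] by (simp add: unit_tuple_def)
    moreover have "proportional (A i *\<^sub>v unit_tuple i) (unit_vec (d ?j) 1)"
      using propor[OF unit_tuple'[OF in\<sigma>[OF i]] i] ne by (simp add: unit_tuple'_def)
    ultimately have "proportional (unit_vec (d ?j) 0) (unit_vec (d ?j) 1)" by (rule proportional_euclid)
    then show False using unit_vec_not_proportional[of 0 "d ?j" 1] two_le_dim[OF in\<sigma>[OF i]] by simp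
  qed
  have "T = id_blinfun"
  proof (rule blinfun_eqI_tau)
    fix x assume x: "x \<in> tuples l d"
    have "(\<lambda>i\<in>{1..l}. x (\<sigma> i)) = x"
      using \<sigma>_id by (intro tuples_ext[OF permuted_tuple[OF \<sigma> x] x]) simp
    then show "T (\<tau> x) = id_blinfun (\<tau> x)" using bspec[OF TP x] by simp
  qed
  then show "T \<in> {id_blinfun}" by simp
qed

text \<open>For the inclusion from left to right, composing \<open>T\<close> with the inverse of the
  permutation found by \<open>tensor_decomposition\<close> cancels the relabelling of the slots and
  leaves the tensor product of the matrices \<open>A i\<close>.\<close>

lemma GL_tensor_eq:
  "carrier (GL_tensor l d \<tau>) =
    {n o\<^sub>L p | n p. n \<in> carrier (tensor_GL l d \<tau>) \<and> p \<in> carrier (perm_group l d \<tau>)}" (is "?G = ?H")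
proof
  show "?H \<subseteq> ?G"
  proof clarify
    fix n p assume n: "n \<in> carrier (tensor_GL l d \<tau>)" and p: "p \<in> carrier (perm_group l d \<tau>)"
    have "bij (blinfun_apply (n o\<^sub>L p))"
      using Group.monoid.m_closed[OF Group.group.is_monoid[OF group_GL_space],
          OF subgroup.mem_carrier[OF subgroup_tensor_GL n] subgroup.mem_carrier[OF subgroup_perm_group p]] by simp
    moreover have "(n o\<^sub>L p) (\<tau> x) \<in> decomposable l d \<tau>" if x: "x \<in> tuples l d" for x
    proof -
      from p obtain \<sigma> where \<sigma>: "\<sigma> permutes {1..l}" "\<forall>i\<in>{1..l}. d (\<sigma> i) = d i"
        and p: "\<forall>x\<in>tuples l d. p (\<tau> x) = \<tau> (\<lambda>i\<in>{1..l}. x (\<sigma> i))" by (rule perm_groupE) blast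
      from n obtain A where A: "\<forall>i\<in>{1..l}. A i \<in> GL_mat (d i)"
        and n: "\<forall>x\<in>tuples l d. n (\<tau> x) = \<tau> (\<lambda>i\<in>{1..l}. A i *\<^sub>v x i)" by (rule tensor_GLE) blast
      show ?thesis
        using bspec[OF p x] bspec[OF n permuted_tuple[OF \<sigma> x]] restrict_mult_tuple[OF A permuted_tuple[OF \<sigma> x]]
        unfolding decomposable_def by auto
    qed
    ultimately show "n o\<^sub>L p \<in> ?G" by (auto simp: GL_tensor_def decomposable_def)
  qed
  show "?G \<subseteq> ?H"
  proof
    fix T assume "T \<in> ?G"
    then have T: "bij (blinfun_apply T)" "blinfun_apply T ` decomposable l d \<tau> \<subseteq> decomposable l d \<tau>"
      by (auto simp: GL_tensor_def)
    have lin: "linear (blinfun_apply T)" by (intro bounded_linear.linear blinfun.bounded_linear_right)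
    interpret decomposable_isomorphism l d \<tau> "blinfun_apply T"
      by (intro decomposable_isomorphism.intro tensor_product_axioms decomposable_isomorphism_axioms.intro lin T)
    obtain \<sigma> A where \<sigma>: "\<sigma> permutes {1..l}" "\<forall>i\<in>{1..l}. d (\<sigma> i) = d i"
      and A: "\<forall>i\<in>{1..l}. A i \<in> GL_mat (d i)"
      and TA: "\<forall>x\<in>tuples l d. T (\<tau> x) = \<tau> (\<lambda>i\<in>{1..l}. A i *\<^sub>v x (\<sigma> i))"
      by (rule tensor_decomposition) blast
    obtain U :: "'v \<Rightarrow>\<^sub>L 'v" where U: "U \<in> carrier (perm_group l d \<tau>)"
      and U\<sigma>: "\<forall>x\<in>tuples l d. U (\<tau> x) = \<tau> (\<lambda>i\<in>{1..l}. x (\<sigma> i))" by (rule ex_perm_group[OF \<sigma>])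
    have "T o\<^sub>L inv\<^bsub>GL_space\<^esub> U \<in> carrier (tensor_GL l d \<tau>)"
    proof (rule tensor_GLI[OF A])
      fix x assume x: "x \<in> tuples l d"
      let ?y = "\<lambda>i\<in>{1..l}. x (inv_into UNIV \<sigma> i)"
      have y: "?y \<in> tuples l d"
        by (rule permuted_tuple[OF permutes_inv[OF \<sigma>(1)] dim_inv_permutation[OF \<sigma>] x])
      have "(T o\<^sub>L inv\<^bsub>GL_space\<^esub> U) (\<tau> x) = \<tau> (\<lambda>i\<in>{1..l}. A i *\<^sub>v ?y (\<sigma> i))"
        using perm_bij(2)[OF \<sigma> U\<sigma> x] bspec[OF TA y] by simp
      also have "(\<lambda>i\<in>{1..l}. A i *\<^sub>v ?y (\<sigma> i)) = (\<lambda>i\<in>{1..l}. A i *\<^sub>v x i)"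
        using permutes_in_image[OF \<sigma>(1)]
        by (intro restrict_ext) (simp only: restrict_apply if_True permutes_inverses(2)[OF \<sigma>(1)])
      finally show "(T o\<^sub>L inv\<^bsub>GL_space\<^esub> U) (\<tau> x) = \<tau> (\<lambda>i\<in>{1..l}. A i *\<^sub>v x i)" .
    qed
    moreover have "inv\<^bsub>GL_space\<^esub> U o\<^sub>L U = id_blinfun"
      using Group.group.l_inv[OF group_GL_space, of U] perm_bij(1)[OF \<sigma> U\<sigma>] by simp
    then have "T = (T o\<^sub>L inv\<^bsub>GL_space\<^esub> U) o\<^sub>L U" by (simp add: blinfun_compose_assoc)
    ultimately show "T \<in> ?H" using U by blast
  qed
qed

text \<open>If \<open>T = (A\<^sub>1 \<otimes> \<dots> \<otimes> A\<^sub>l) U\<^sub>\<sigma>\<close> and \<open>\<sigma> j \<noteq> j\<close>, the \<open>j\<close>-th factors of \<open>T x\<close> and \<open>T x'\<close>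
  agree for \<open>x = unit_tuple\<close> and \<open>x' = unit_tuple' j\<close>, so the Gram-type determinant of \<open>T x, T x'\<close>
  against \<open>x, x'\<close> vanishes; it is \<open>1\<close> for \<open>T = 1\<close>.\<close>

lemma tensor_GL_relatively_open:
  obtains W where "open W" "id_blinfun \<in> W" "W \<inter> carrier (GL_tensor l d \<tau>) \<subseteq> carrier (tensor_GL l d \<tau>)"
proof -
  let ?e = "\<tau> unit_tuple" and ?e' = "\<lambda>j. \<tau> (unit_tuple' j)"
  \<comment> \<open>A 2x2 determinant of matrix coefficients. It is continuous in \<open>T\<close>,
    so its nonvanishing is an open condition, and only finitely many \<open>j\<close> are
    involved.\<close>
  define D where "D j T = inner (blinfun_apply T ?e) ?e * inner (blinfun_apply T (?e' j)) (?e' j) -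
    inner (blinfun_apply T ?e) (?e' j) * inner (blinfun_apply T (?e' j)) ?e" for j T
  define W where "W = (\<Inter>j\<in>{1..l}. {T. D j T \<noteq> 0})"
  have u: "unit_tuple \<in> tuples l d" and u': "j \<in> {1..l} \<Longrightarrow> unit_tuple' j \<in> tuples l d" for j
    using unit_tuple unit_tuple' nonzero_tuplesD by blast+
  have "open {T. D j T \<noteq> 0}" for j
    unfolding D_def by (intro open_Collect_neq continuous_intros)
  then have "open W" unfolding W_def by (intro open_INT) auto
  moreover have "D j id_blinfun = 1" if j: "j \<in> {1..l}" for j
  proof -
    have "inner ?e ?e = 1" "inner (?e' j) (?e' j) = 1"
      unfolding inner_tau[OF u u] inner_tau[OF u'[OF j] u'[OF j]]
      using two_le_dim by (force intro!: prod.neutral simp: unit_tuple'_def unit_tuple_def)+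
    moreover have "inner ?e (?e' j) = 0"
      unfolding inner_tau[OF u u'[OF j]] using j two_le_dim[OF j]
      by (intro prod_zero) (auto intro!: bexI[of _ j] simp: unit_tuple'_def unit_tuple_def)
    ultimately show ?thesis by (simp add: D_def inner_commute)
  qed
  then have "id_blinfun \<in> W" unfolding W_def by simp
  moreover have "W \<inter> carrier (GL_tensor l d \<tau>) \<subseteq> carrier (tensor_GL l d \<tau>)"
  proof
    fix T assume T: "T \<in> W \<inter> carrier (GL_tensor l d \<tau>)"
    then obtain n p where n: "n \<in> carrier (tensor_GL l d \<tau>)" and p: "p \<in> carrier (perm_group l d \<tau>)"
      and Tnp: "T = n o\<^sub>L p" unfolding GL_tensor_eq by blast
    from p obtain \<sigma> where \<sigma>: "\<sigma> permutes {1..l}" "\<forall>i\<in>{1..l}. d (\<sigma> i) = d i"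
      and p: "\<forall>x\<in>tuples l d. p (\<tau> x) = \<tau> (\<lambda>i\<in>{1..l}. x (\<sigma> i))" by (rule perm_groupE) blast
    from n obtain A where A: "\<forall>i\<in>{1..l}. A i \<in> GL_mat (d i)"
      and n: "\<forall>x\<in>tuples l d. n (\<tau> x) = \<tau> (\<lambda>i\<in>{1..l}. A i *\<^sub>v x i)" by (rule tensor_GLE) blast
    let ?z = "\<lambda>x. \<lambda>i\<in>{1..l}. A i *\<^sub>v (\<lambda>i\<in>{1..l}. x (\<sigma> i)) i"
    have Tx: "T (\<tau> x) = \<tau> (?z x)" and z: "?z x \<in> tuples l d" if "x \<in> tuples l d" for x
      using bspec[OF p that] bspec[OF n permuted_tuple[OF \<sigma> that]] restrict_mult_tuple[OF A permuted_tuple[OF \<sigma> that]]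
      unfolding Tnp by auto
    have \<sigma>_id: "\<sigma> j = j" if j: "j \<in> {1..l}" for j
    proof (rule ccontr)
      assume ne: "\<sigma> j \<noteq> j"
      let ?x = unit_tuple and ?x' = "unit_tuple' j"
      have zj: "?z ?x j = ?z ?x' j" using ne by (simp add: unit_tuple'_def)
      have xi: "?x i = ?x' i" if "i \<noteq> j" for i using that by (simp add: unit_tuple'_def)
      have "inner (T ?e) ?e * inner (T (?e' j)) (?e' j) =
          (\<Prod>i\<in>{1..l}. scalar_prod (?z ?x i) (?x i) * scalar_prod (?z ?x' i) (?x' i))"
        unfolding Tx[OF u] Tx[OF u'[OF j]] inner_tau[OF z[OF u] u]
          inner_tau[OF z[OF u'[OF j]] u'[OF j]] prod.distrib ..
      \<comment> \<open>In slot \<open>j\<close> the two images agree, and in every other slot the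
        two test tuples agree; either way exchanging the test tuples leaves the factor
        unchanged.\<close>
      also have "\<dots> = (\<Prod>i\<in>{1..l}. scalar_prod (?z ?x i) (?x' i) * scalar_prod (?z ?x' i) (?x i))"
      proof (rule prod.cong[OF refl])
        fix i
        show "scalar_prod (?z ?x i) (?x i) * scalar_prod (?z ?x' i) (?x' i) =
          scalar_prod (?z ?x i) (?x' i) * scalar_prod (?z ?x' i) (?x i)"
        proof (cases "i = j")
          case True
          show ?thesis unfolding True zj by (rule mult.commute)
        next
          case False
          show ?thesis unfolding xi[OF False] ..
        qed
      qed
      also have "\<dots> = inner (T ?e) (?e' j) * inner (T (?e' j)) ?e"
        unfolding Tx[OF u] Tx[OF u'[OF j]] inner_tau[OF z[OF u] u'[OF j]]
          inner_tau[OF z[OF u'[OF j]] u] prod.distrib ..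
      finally have "D j T = 0" by (simp add: D_def)
      then show False using T j unfolding W_def by auto
    qed
    show "T \<in> carrier (tensor_GL l d \<tau>)"
    proof (rule tensor_GLI[OF A])
      fix x assume x: "x \<in> tuples l d"
      have "?z x = (\<lambda>i\<in>{1..l}. A i *\<^sub>v x i)" by (rule restrict_ext) (simp add: \<sigma>_id)
      then show "T (\<tau> x) = \<tau> (\<lambda>i\<in>{1..l}. A i *\<^sub>v x i)" using Tx[OF x] by simp
    qed
  qed
  ultimately show ?thesis using that by blast
qed

text \<open>The factors of an orthogonal \<open>A\<^sub>1 \<otimes> \<dots> \<otimes> A\<^sub>l\<close> are only orthogonal up to scalars, which have
  to be redistributed.\<close>

lemma tensor_O_eq:
  "carrier (tensor_O l d \<tau>) =
    {T \<in> carrier (tensor_GL l d \<tau>). orthogonal_transformation (blinfun_apply T)}" (is "?O = ?N")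
proof
  show "?O \<subseteq> ?N"
  proof
    fix T assume "T \<in> ?O"
    then obtain A where A: "\<forall>i\<in>{1..l}. A i \<in> O_mat (d i)"
      and T: "\<forall>x\<in>tuples l d. T (\<tau> x) = \<tau> (\<lambda>i\<in>{1..l}. A i *\<^sub>v x i)"
      unfolding mem_tensor_O by blast
    have A': "\<forall>i\<in>{1..l}. A i \<in> GL_mat (d i)" using A O_mat_subset_GL_mat by blast
    have "orthogonal_transformation (blinfun_apply T)"
    proof (rule orthogonal_if_preserves_inner_tau)
      fix x y assume xy: "x \<in> tuples l d" "y \<in> tuples l d"
      show "inner (T (\<tau> x)) (T (\<tau> y)) = inner (\<tau> x) (\<tau> y)"
        unfolding bspec[OF T xy(1)] bspec[OF T xy(2)] inner_tau[OF xy]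
          inner_tau[OF restrict_mult_tuple[OF A' xy(1)] restrict_mult_tuple[OF A' xy(2)]]
        using O_mat_scalar_prod[OF bspec[OF A] tuples_carrier[OF xy(1)] tuples_carrier[OF xy(2)]]
        by (intro prod.cong) simp_all
    qed
    then show "T \<in> ?N" using A' T mem_tensor_GL by blast
  qed
  show "?N \<subseteq> ?O"
  proof clarify
    fix T assume "T \<in> carrier (tensor_GL l d \<tau>)" and orth: "orthogonal_transformation (blinfun_apply T)"
    then obtain A where A: "\<forall>i\<in>{1..l}. A i \<in> GL_mat (d i)"
      and T: "\<forall>x\<in>tuples l d. T (\<tau> x) = \<tau> (\<lambda>i\<in>{1..l}. A i *\<^sub>v x i)" by (elim tensor_GLE) blast
    have Ac: "A i \<in> carrier_mat (d i) (d i)" if "i \<in> {1..l}" for i using bspec[OF A that] by (simp add: GL_mat_def)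
    have u: "unit_tuple \<in> tuples l d" using unit_tuple nonzero_tuplesD by blast
    have ee: "scalar_prod (unit_tuple i) (unit_tuple i) = 1" if "i \<in> {1..l}" for i
      using two_le_dim[OF that] that by (simp add: unit_tuple_def)
    have inner_T: "inner (\<tau> x) (\<tau> y) = (\<Prod>i\<in>{1..l}. scalar_prod (A i *\<^sub>v x i) (A i *\<^sub>v y i))"
      if "x \<in> tuples l d" "y \<in> tuples l d" for x y
    proof -
      have "inner (\<tau> x) (\<tau> y) = inner (T (\<tau> x)) (T (\<tau> y))"
        using orth by (simp add: orthogonal_transformation_def)
      then show ?thesis unfolding bspec[OF T that(1)] bspec[OF T that(2)]
          inner_tau[OF restrict_mult_tuple[OF A that(1)] restrict_mult_tuple[OF A that(2)]] by simp
    qed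
    \<comment> \<open>The contribution of all other slots to an inner product when both tuples agree
      with \<open>unit_tuple\<close> there. As \<open>T\<close> preserves inner products and
      \<open>unit_tuple\<close> has unit factors, \<open>A i\<close> divides inner products by
      \<open>r i\<close>, so scaling by \<open>sqrt (r i)\<close> makes it orthogonal.\<close>
    define r where "r i = (\<Prod>k\<in>{1..l}-{i}. scalar_prod (A k *\<^sub>v unit_tuple k) (A k *\<^sub>v unit_tuple k))" for i
    have r: "scalar_prod v w = r i * scalar_prod (A i *\<^sub>v v) (A i *\<^sub>v w)"
      if i: "i \<in> {1..l}" and vw: "v \<in> carrier_vec (d i)" "w \<in> carrier_vec (d i)" for i v w
    proof -
      let ?x = "unit_tuple(i := v)" and ?y = "unit_tuple(i := w)"
      have xy: "?x \<in> tuples l d" "?y \<in> tuples l d" using tuples_upd[OF u i] vw by auto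
      have "inner (\<tau> ?x) (\<tau> ?y) = scalar_prod v w"
        unfolding inner_tau[OF xy] using i ee by (subst prod.remove[of _ i]) (auto intro!: prod.neutral)
      moreover have "inner (\<tau> ?x) (\<tau> ?y) = scalar_prod (A i *\<^sub>v v) (A i *\<^sub>v w) * r i"
        unfolding inner_T[OF xy] r_def using i by (subst prod.remove[of _ i]) (auto intro!: prod.cong)
      ultimately show ?thesis by (simp add: mult.commute)
    qed
    have r0: "0 \<le> r i" if "i \<in> {1..l}" for i
      unfolding r_def by (intro prod_nonneg) (auto simp: scalar_prod_def intro!: sum_nonneg)
    define B where "B i = sqrt (r i) \<cdot>\<^sub>m A i" for i
    have Bv: "B i *\<^sub>v v = sqrt (r i) \<cdot>\<^sub>v (A i *\<^sub>v v)" if "i \<in> {1..l}" "v \<in> carrier_vec (d i)" for i v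
      unfolding B_def using Ac[OF that(1)] that(2)
      by (intro eq_vecI) (auto simp: scalar_prod_def sum_distrib_left mult.assoc)
    have BB: "scalar_prod (B i *\<^sub>v v) (B i *\<^sub>v w) = scalar_prod v w"
      if i: "i \<in> {1..l}" and vw: "v \<in> carrier_vec (d i)" "w \<in> carrier_vec (d i)" for i v w
    proof -
      have "A i *\<^sub>v v \<in> carrier_vec (d i)" "A i *\<^sub>v w \<in> carrier_vec (d i)" using Ac[OF i] vw by auto
      then have "scalar_prod (B i *\<^sub>v v) (B i *\<^sub>v w) = sqrt (r i) * (sqrt (r i) * scalar_prod (A i *\<^sub>v v) (A i *\<^sub>v w))"
        unfolding Bv[OF i vw(1)] Bv[OF i vw(2)] by simp
      also have "\<dots> = (sqrt (r i) * sqrt (r i)) * scalar_prod (A i *\<^sub>v v) (A i *\<^sub>v w)" by (simp only: mult.assoc)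
      also have "\<dots> = scalar_prod v w" using r0[OF i] r[OF i vw] by simp
      finally show ?thesis .
    qed
    have B: "B i \<in> O_mat (d i)" if "i \<in> {1..l}" for i
      using Ac[OF that] BB[OF that] by (intro O_matI) (auto simp: B_def)
    \<comment> \<open>Rescaling every slot multiplies the tensor product by \<open>C\<close>. Norms
      at \<open>unit_tuple\<close> give \<open>C * C = 1\<close>, and the nonnegative square roots
      exclude \<open>C = -1\<close>.\<close>
    define C where "C = (\<Prod>i\<in>{1..l}. sqrt (r i))"
    have TB: "\<tau> (\<lambda>i\<in>{1..l}. B i *\<^sub>v x i) = C *\<^sub>R T (\<tau> x)" if x: "x \<in> tuples l d" for x
    proof -
      have "(\<lambda>i\<in>{1..l}. B i *\<^sub>v x i) = (\<lambda>i\<in>{1..l}. sqrt (r i) \<cdot>\<^sub>v (\<lambda>i\<in>{1..l}. A i *\<^sub>v x i) i)"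
        by (rule restrict_ext) (simp add: Bv tuples_carrier[OF x])
      then show ?thesis
        using tau_smult_all[OF restrict_mult_tuple[OF A x], of "\<lambda>i. sqrt (r i)"] bspec[OF T x] by (simp add: C_def)
    qed
    have "C = 1"
    proof -
      have B': "\<forall>i\<in>{1..l}. B i \<in> GL_mat (d i)" using B O_mat_subset_GL_mat by blast
      let ?y = "\<lambda>i\<in>{1..l}. B i *\<^sub>v unit_tuple i"
      have "inner (\<tau> ?y) (\<tau> ?y) = 1"
        unfolding inner_tau[OF restrict_mult_tuple[OF B' u] restrict_mult_tuple[OF B' u]]
        using BB tuples_carrier[OF u] ee by (intro prod.neutral) simp
      moreover have "inner (T (\<tau> unit_tuple)) (T (\<tau> unit_tuple)) = 1"
        using orth inner_tau[OF u u] ee by (simp add: orthogonal_transformation_def)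
      ultimately have "C * C = 1" unfolding TB[OF u] by simp
      moreover have "0 \<le> C" unfolding C_def using r0 by (intro prod_nonneg) simp
      ultimately show "C = 1" by (simp add: square_eq_1_iff)
    qed
    then show "T \<in> ?O"
      using B TB unfolding mem_tensor_O by (intro exI[of _ B]) simp
  qed
qed

lemma subgroup_orthogonal:
  "subgroup {T. orthogonal_transformation (blinfun_apply T)} (GL_space :: ('v \<Rightarrow>\<^sub>L 'v) monoid)"
proof (rule Group.group.subgroupI[OF group_GL_space])
  show sub: "{T :: 'v \<Rightarrow>\<^sub>L 'v. orthogonal_transformation (blinfun_apply T)} \<subseteq> carrier GL_space"
    using orthogonal_transformation_bij by auto
  have "id_blinfun \<in> {T :: 'v \<Rightarrow>\<^sub>L 'v. orthogonal_transformation (blinfun_apply T)}"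
    by (simp add: orthogonal_transformation_def linear_iff)
  then show "{T :: 'v \<Rightarrow>\<^sub>L 'v. orthogonal_transformation (blinfun_apply T)} \<noteq> {}" by blast
next
  fix T :: "'v \<Rightarrow>\<^sub>L 'v" assume "T \<in> {T. orthogonal_transformation (blinfun_apply T)}"
  then have T: "orthogonal_transformation (blinfun_apply T)" by simp
  have "T ((inv\<^bsub>GL_space\<^esub> T) v) = v" for v
    using inverse_apply[OF orthogonal_transformation_bij[OF T]] orthogonal_transformation_surj[OF T]
    by (metis surjD)
  then have "inner ((inv\<^bsub>GL_space\<^esub> T) v) ((inv\<^bsub>GL_space\<^esub> T) w) = inner v w" for v w
    using T unfolding orthogonal_transformation_def by metis
  then show "inv\<^bsub>GL_space\<^esub> T \<in> {T. orthogonal_transformation (blinfun_apply T)}"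
    unfolding orthogonal_transformation_def
    by (simp add: bounded_linear.linear blinfun.bounded_linear_right)
next
  fix S T :: "'v \<Rightarrow>\<^sub>L 'v"
  assume "S \<in> {T. orthogonal_transformation (blinfun_apply T)}" "T \<in> {T. orthogonal_transformation (blinfun_apply T)}"
  moreover have "blinfun_apply (S o\<^sub>L T) = blinfun_apply S \<circ> blinfun_apply T" by auto
  ultimately show "S \<otimes>\<^bsub>GL_space\<^esub> T \<in> {T. orthogonal_transformation (blinfun_apply T)}"
    using orthogonal_transformation_compose by simp
qed

text \<open>Inverses in \<open>GL_tensor\<close> and \<open>GL_space\<close> agree once
  \<open>GL_tensor\<close> is known to be a subgroup. Its definition says nothing about inverses, so
  this comes from the factorisation \<open>GL_tensor_eq\<close>.\<close>

lemma conjugation_GL_tensor: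
  fixes n p :: "'v \<Rightarrow>\<^sub>L 'v"
  assumes "p \<in> carrier (perm_group l d \<tau>)"
  shows "conjugation (GL_tensor l d \<tau>) p n = p o\<^sub>L n o\<^sub>L inv\<^bsub>GL_space\<^esub> p"
proof -
  have H: "carrier (GL_tensor l d \<tau>) =
      (\<lambda>(n, p). n \<otimes>\<^bsub>GL_space\<^esub> p) ` (carrier (tensor_GL l d \<tau>) \<times> carrier (perm_group l d \<tau>))"
    unfolding GL_tensor_eq by auto
  have sub: "subgroup (carrier (GL_tensor l d \<tau>)) GL_space"
    unfolding H
    by (rule internal_semidirect_product(2)[OF group_GL_space subgroup_tensor_GL subgroup_perm_group])
      (use perm_group_normalizes_tensor_GL tensor_GL_Int_perm_group in auto)
  have "id_blinfun \<in> carrier (tensor_GL l d \<tau>)" using subgroup.one_closed[OF subgroup_tensor_GL] by simp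
  then have "id_blinfun o\<^sub>L p \<in> carrier (GL_tensor l d \<tau>)" unfolding GL_tensor_eq using assms by blast
  then have "p \<in> carrier (GL_tensor l d \<tau>)" by simp
  moreover have "GL_tensor l d \<tau> = GL_space\<lparr>carrier := carrier (GL_tensor l d \<tau>)\<rparr>"
    by (simp add: GL_tensor_def)
  ultimately have "inv\<^bsub>GL_tensor l d \<tau>\<^esub> p = inv\<^bsub>GL_space\<^esub> p"
    using Group.group.m_inv_consistent[OF group_GL_space sub] by metis
  then show ?thesis by (simp add: conjugation_def GL_tensor_def)
qed

end

theorem propositionA4:
  fixes l :: nat and d :: "nat \<Rightarrow> nat"
    and \<tau> :: "(nat \<Rightarrow> real Matrix.vec) \<Rightarrow> 'v::euclidean_space"
  assumes "l \<ge> 2" and "\<forall>i\<in>{1..l}. d i \<ge> 2"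
    and "is_tensor_product l d \<tau>"
  shows "lie_isomorphic (GL_tensor l d \<tau>)
           (semidirect_product (tensor_GL l d \<tau>) (perm_group l d \<tau>) (conjugation (GL_tensor l d \<tau>)))
       \<and> lie_isomorphic (O_tensor l d \<tau>)
           (semidirect_product (tensor_O l d \<tau>) (perm_group l d \<tau>) (conjugation (GL_tensor l d \<tau>)))"
proof
  interpret tensor_product l d \<tau> using assms(2,3) by unfold_locales auto
  let ?N = "carrier (tensor_GL l d \<tau>)" and ?P = "carrier (perm_group l d \<tau>)"
    and ?M = "carrier (tensor_O l d \<tau>)" and ?O = "{T :: 'v \<Rightarrow>\<^sub>L 'v. orthogonal_transformation (blinfun_apply T)}"
  have eqs: "GL_tensor l d \<tau> = GL_space\<lparr>carrier := carrier (GL_tensor l d \<tau>)\<rparr>"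
    "O_tensor l d \<tau> = GL_space\<lparr>carrier := carrier (O_tensor l d \<tau>)\<rparr>"
    "tensor_GL l d \<tau> = GL_space\<lparr>carrier := ?N\<rparr>" "tensor_O l d \<tau> = GL_space\<lparr>carrier := ?M\<rparr>"
    "perm_group l d \<tau> = GL_space\<lparr>carrier := ?P\<rparr>"
    by (simp_all add: GL_tensor_def O_tensor_def tensor_GL_def tensor_O_def perm_group_def)
  obtain W where W: "open W" "id_blinfun \<in> W" "W \<inter> carrier (GL_tensor l d \<tau>) \<subseteq> ?N"
    by (rule tensor_GL_relatively_open)
  have "lie_isomorphic (GL_space\<lparr>carrier := carrier (GL_tensor l d \<tau>)\<rparr>)
      (semidirect_product (GL_space\<lparr>carrier := ?N\<rparr>) (GL_space\<lparr>carrier := ?P\<rparr>) (conjugation (GL_tensor l d \<tau>)))"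
    by (rule lie_isomorphic_internal_semidirect_product[OF subgroup_tensor_GL subgroup_perm_group
          perm_group_normalizes_tensor_GL tensor_GL_Int_perm_group conjugation_GL_tensor GL_tensor_eq W])
  then show "lie_isomorphic (GL_tensor l d \<tau>)
      (semidirect_product (tensor_GL l d \<tau>) (perm_group l d \<tau>) (conjugation (GL_tensor l d \<tau>)))"
    by (simp only: eqs(1,3,5)[symmetric])
  \<comment> \<open>The orthogonal statement arises by intersecting with the orthogonal group
    \<open>?O\<close>, which already contains \<open>?P\<close>.\<close>
  have M: "?M = ?N \<inter> ?O" unfolding tensor_O_eq by blast
  have sM: "subgroup ?M GL_space"
    unfolding M by (rule Group.group.subgroups_Inter_pair[OF group_GL_space subgroup_tensor_GL subgroup_orthogonal])
  have PO: "?P \<subseteq> ?O" using perm_group_orthogonal by blast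
  have comp: "S o\<^sub>L T \<in> ?O" if "S \<in> ?O" "T \<in> ?O" for S T
    using subgroup.m_closed[OF subgroup_orthogonal that] by simp
  have norm: "p o\<^sub>L n o\<^sub>L inv\<^bsub>GL_space\<^esub> p \<in> ?M" if p: "p \<in> ?P" and n: "n \<in> ?M" for p n
  proof -
    have "inv\<^bsub>GL_space\<^esub> p \<in> ?O" using subgroup.m_inv_closed[OF subgroup_orthogonal] p PO by blast
    then show ?thesis using perm_group_normalizes_tensor_GL[OF p] n p PO comp unfolding M by blast
  qed
  have O_eq: "carrier (O_tensor l d \<tau>) = {n o\<^sub>L p | n p. n \<in> ?M \<and> p \<in> ?P}"
  proof -
    \<comment> \<open>The permutation \<open>p\<close> is orthogonal, so an orthogonal product
      \<open>n o\<^sub>L p\<close> has an orthogonal first factor.\<close>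
    have "n \<in> ?O" if "n o\<^sub>L p \<in> ?O" "n \<in> ?N" "p \<in> ?P" for n p
    proof -
      have "p o\<^sub>L inv\<^bsub>GL_space\<^esub> p = id_blinfun"
        using Group.group.r_inv[OF group_GL_space subgroup.mem_carrier[OF subgroup_perm_group that(3)]] by simp
      then have "n = (n o\<^sub>L p) o\<^sub>L inv\<^bsub>GL_space\<^esub> p" by (simp add: blinfun_compose_assoc)
      moreover have "p \<in> ?O" using that(3) PO by blast
      ultimately show ?thesis
        using comp[OF that(1) subgroup.m_inv_closed[OF subgroup_orthogonal \<open>p \<in> ?O\<close>]] by metis
    qed
    then have "carrier (GL_tensor l d \<tau>) \<inter> ?O = {n o\<^sub>L p | n p. n \<in> ?M \<and> p \<in> ?P}"
      unfolding GL_tensor_eq M using comp PO by blast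
    moreover have "carrier (O_tensor l d \<tau>) = carrier (GL_tensor l d \<tau>) \<inter> ?O"
      by (auto simp: O_tensor_def)
    ultimately show ?thesis by simp
  qed
  \<comment> \<open>The same neighbourhood serves: an orthogonal element of \<open>?N\<close> lies
    in \<open>?M\<close>.\<close>
  have "W \<inter> carrier (O_tensor l d \<tau>) \<subseteq> ?M"
    using W(3) unfolding M by (auto simp: O_tensor_def)
  moreover have "?M \<inter> ?P \<subseteq> {id_blinfun}" using tensor_GL_Int_perm_group unfolding M by blast
  ultimately have "lie_isomorphic (GL_space\<lparr>carrier := carrier (O_tensor l d \<tau>)\<rparr>)
      (semidirect_product (GL_space\<lparr>carrier := ?M\<rparr>) (GL_space\<lparr>carrier := ?P\<rparr>) (conjugation (GL_tensor l d \<tau>)))"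
    by (intro lie_isomorphic_internal_semidirect_product[OF sM subgroup_perm_group
          norm _ conjugation_GL_tensor O_eq W(1,2)])
  then show "lie_isomorphic (O_tensor l d \<tau>)
      (semidirect_product (tensor_O l d \<tau>) (perm_group l d \<tau>) (conjugation (GL_tensor l d \<tau>)))"
    by (simp only: eqs(2,4,5)[symmetric])
qed

end
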